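(* Let $M\subseteq N$ be $(D,\aleph_0)$-homogeneous models and let $p\in S_D(N)$ be regular. Then $p\perp M$ if and only if $p\perp q$ for every regular $q\in S_D(M)$.
   Context: $D$ is a totally transcendental good diagram, working in a large $(D,\bar\kappa)$-homogeneous monster model; independence is the rank-based nonforking relation; stationary types have unique free (independent) extensions; $p\perp q$ for stationary types means that realizations of their free extensions to any common model $M_1$ are independent over $M_1$; $p\perp M$ means $p$ is orthogonal to every type in $S_D(M)$; regular types are stationary types each of whose extensions of the restriction to a base is either the free extension or orthogonal to it. *)

theory Defs
  imports Main "HOL-Library.Extended"
begin

unbundle cardinal_syntax

section \<open>First-order syntax and semantics\<close>

datatype 'f tm = Var nat | Fn 'f "'f tm list"

datatype ('f, 'r) fm =
    Eq "'f tm" "'f tm"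
  | Rel 'r "'f tm list"
  | Neg "('f, 'r) fm"
  | And "('f, 'r) fm" "('f, 'r) fm"
  | Ex nat "('f, 'r) fm"

text \<open>The universe of a structure is the whole type \<open>'a\<close>; the values of \<open>fint\<close> and \<open>rint\<close>
  on lists whose length is not the arity are irrelevant.\<close>

record ('f, 'r, 'a) struct =
  farity :: "'f \<Rightarrow> nat"
  rarity :: "'r \<Rightarrow> nat"
  fint :: "'f \<Rightarrow> 'a list \<Rightarrow> 'a"
  rint :: "'r \<Rightarrow> 'a list \<Rightarrow> bool"

fun wf_tm :: "('f, 'r, 'a) struct \<Rightarrow> 'f tm \<Rightarrow> bool" where
  "wf_tm C (Var i) \<longleftrightarrow> True"
| "wf_tm C (Fn f ts) \<longleftrightarrow> length ts = farity C f \<and> (\<forall>t\<in>set ts. wf_tm C t)"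

fun wf_fm :: "('f, 'r, 'a) struct \<Rightarrow> ('f, 'r) fm \<Rightarrow> bool" where
  "wf_fm C (Eq s t) \<longleftrightarrow> wf_tm C s \<and> wf_tm C t"
| "wf_fm C (Rel r ts) \<longleftrightarrow> length ts = rarity C r \<and> (\<forall>t\<in>set ts. wf_tm C t)"
| "wf_fm C (Neg \<phi>) \<longleftrightarrow> wf_fm C \<phi>"
| "wf_fm C (And \<phi> \<psi>) \<longleftrightarrow> wf_fm C \<phi> \<and> wf_fm C \<psi>"
| "wf_fm C (Ex i \<phi>) \<longleftrightarrow> wf_fm C \<phi>"

fun fv_tm :: "'f tm \<Rightarrow> nat set" where
  "fv_tm (Var i) = {i}"
| "fv_tm (Fn f ts) = (\<Union>t\<in>set ts. fv_tm t)"

fun fv :: "('f, 'r) fm \<Rightarrow> nat set" where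
  "fv (Eq s t) = fv_tm s \<union> fv_tm t"
| "fv (Rel r ts) = (\<Union>t\<in>set ts. fv_tm t)"
| "fv (Neg \<phi>) = fv \<phi>"
| "fv (And \<phi> \<psi>) = fv \<phi> \<union> fv \<psi>"
| "fv (Ex i \<phi>) = fv \<phi> - {i}"

fun val :: "('f, 'r, 'a) struct \<Rightarrow> (nat \<Rightarrow> 'a) \<Rightarrow> 'f tm \<Rightarrow> 'a" where
  "val C e (Var i) = e i"
| "val C e (Fn f ts) = fint C f (map (val C e) ts)"

text \<open>Satisfaction in the substructure with universe \<open>M\<close>.\<close>

fun sat :: "('f, 'r, 'a) struct \<Rightarrow> 'a set \<Rightarrow> (nat \<Rightarrow> 'a) \<Rightarrow> ('f, 'r) fm \<Rightarrow> bool" where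
  "sat C M e (Eq s t) \<longleftrightarrow> val C e s = val C e t"
| "sat C M e (Rel r ts) \<longleftrightarrow> rint C r (map (val C e) ts)"
| "sat C M e (Neg \<phi>) \<longleftrightarrow> \<not> sat C M e \<phi>"
| "sat C M e (And \<phi> \<psi>) \<longleftrightarrow> sat C M e \<phi> \<and> sat C M e \<psi>"
| "sat C M e (Ex i \<phi>) \<longleftrightarrow> (\<exists>v\<in>M. sat C M (e(i := v)) \<phi>)"

definition elem_sub :: "('f, 'r, 'a) struct \<Rightarrow> 'a set \<Rightarrow> bool" where
  "elem_sub C M \<longleftrightarrow> M \<noteq> {} \<and>
     (\<forall>f xs. length xs = farity C f \<and> set xs \<subseteq> M \<longrightarrow> fint C f xs \<in> M) \<and>
     (\<forall>\<phi> e. wf_fm C \<phi> \<and> range e \<subseteq> M \<longrightarrow> (sat C M e \<phi> \<longleftrightarrow> sat C UNIV e \<phi>))"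

definition fms :: "('f, 'r, 'a) struct \<Rightarrow> nat \<Rightarrow> ('f, 'r) fm set" where
  "fms C k = {\<phi>. wf_fm C \<phi> \<and> fv \<phi> \<subseteq> {..<k}}"

section \<open>Types\<close>

text \<open>A formula with parameters in the variables \<open>x\<^sub>0, \<dots>, x\<^sub>n\<^sub>-\<^sub>1\<close> is a pair \<open>(\<phi>, a)\<close>, standing for
  \<open>\<phi>(x, a)\<close>: the variables of index \<open>n, n + 1, \<dots>\<close> of \<open>\<phi>\<close> are replaced by the entries of \<open>a\<close>.
  The arity \<open>n\<close> is always given separately.\<close>

type_synonym ('f, 'r, 'a) pfm = "('f, 'r) fm \<times> 'a list"

definition pfms :: "('f, 'r, 'a) struct \<Rightarrow> nat \<Rightarrow> 'a set \<Rightarrow> ('f, 'r, 'a) pfm set" where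
  "pfms C n A = {(\<phi>, a). set a \<subseteq> A \<and> \<phi> \<in> fms C (n + length a)}"

definition realizes :: "('f, 'r, 'a) struct \<Rightarrow> 'a list \<Rightarrow> ('f, 'r, 'a) pfm set \<Rightarrow> bool" where
  "realizes C c p \<longleftrightarrow> (\<forall>(\<phi>, a)\<in>p. sat C UNIV (nth (c @ a)) \<phi>)"

definition tp :: "('f, 'r, 'a) struct \<Rightarrow> 'a list \<Rightarrow> 'a set \<Rightarrow> ('f, 'r, 'a) pfm set" where
  "tp C c A = {(\<phi>, a). (\<phi>, a) \<in> pfms C (length c) A \<and> sat C UNIV (nth (c @ a)) \<phi>}"

definition restr :: "('f, 'r, 'a) pfm set \<Rightarrow> 'a set \<Rightarrow> ('f, 'r, 'a) pfm set" where
  "restr p B = {(\<phi>, a) \<in> p. set a \<subseteq> B}"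

definition complete_types :: "('f, 'r, 'a) struct \<Rightarrow> nat \<Rightarrow> 'a set \<Rightarrow> ('f, 'r, 'a) pfm set set" where
  "complete_types C n A = {p. p \<subseteq> pfms C n A \<and>
     (\<forall>q. finite q \<and> q \<subseteq> p \<longrightarrow> (\<exists>c. length c = n \<and> realizes C c q)) \<and>
     (\<forall>(\<phi>, a)\<in>pfms C n A. (\<phi>, a) \<in> p \<or> (Neg \<phi>, a) \<in> p)}"

section \<open>Diagrams and homogeneous models\<close>

text \<open>A diagram is a family \<open>D\<close>, where \<open>D k\<close> is a set of complete \<open>k\<close>-types over the empty set.\<close>

type_synonym ('f, 'r) diag = "nat \<Rightarrow> ('f, 'r) fm set set"

definition tp0 :: "('f, 'r, 'a) struct \<Rightarrow> 'a list \<Rightarrow> ('f, 'r) fm set" where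
  "tp0 C c = {\<phi> \<in> fms C (length c). sat C UNIV (nth c) \<phi>}"

definition diagram :: "('f, 'r, 'a) struct \<Rightarrow> 'a set \<Rightarrow> ('f, 'r) diag" where
  "diagram C A k = {tp0 C c | c. length c = k \<and> set c \<subseteq> A}"

text \<open>A complete type \<open>p\<close> over \<open>A\<close> belongs to \<open>S\<^sub>D\<close> if \<open>A \<union> c\<close> is a \<open>D\<close>-set for every realization
  \<open>c\<close> of \<open>p\<close>, in any elementary extension.  For \<open>a\<close> in \<open>A\<close>, the type of \<open>c @ a\<close> over the empty set is
  \<open>{\<phi>. (\<phi>, a) \<in> p}\<close>.\<close>

definition S_D :: "('f, 'r, 'a) struct \<Rightarrow> ('f, 'r) diag \<Rightarrow> nat \<Rightarrow> 'a set \<Rightarrow> ('f, 'r, 'a) pfm set set"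
  where "S_D C D n A =
     {p \<in> complete_types C n A. \<forall>a\<in>lists A. {\<phi>. (\<phi>, a) \<in> p} \<in> D (n + length a)}"

definition homogeneous ::
    "('f, 'r, 'a) struct \<Rightarrow> ('f, 'r) diag \<Rightarrow> 'l rel \<Rightarrow> 'a set \<Rightarrow> bool" where
  "homogeneous C D lam M \<longleftrightarrow> elem_sub C M \<and> diagram C M = D \<and>
     (\<forall>A n. \<forall>p\<in>S_D C D n A. A \<subseteq> M \<and> |A| <o lam \<longrightarrow>
        (\<exists>c\<in>lists M. length c = n \<and> realizes C c p))"

abbreviation aleph0_homogeneous ::
    "('f, 'r, 'a) struct \<Rightarrow> ('f, 'r) diag \<Rightarrow> 'a set \<Rightarrow> bool" where
  "aleph0_homogeneous C D M \<equiv> homogeneous C D natLeq M"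

definition small :: "'k rel \<Rightarrow> 'a set \<Rightarrow> bool" where
  "small \<kappa> A \<longleftrightarrow> |A| <o \<kappa>"

text \<open>Goodness of \<open>D\<close> (the existence of arbitrarily large homogeneous models) enters only through
  the existence of \<open>C\<close>.  \<open>T\<close> is the complete theory of \<open>C\<close>; sets and models are subsets of \<open>C\<close> of
  cardinality below \<open>\<kappa>\<close>.\<close>

definition monster :: "('f, 'r, 'a) struct \<Rightarrow> ('f, 'r) diag \<Rightarrow> 'k rel \<Rightarrow> bool" where
  "monster C D \<kappa> \<longleftrightarrow> Card_order \<kappa> \<and>
     |UNIV :: ('f, 'r) fm set| <o \<kappa> \<and> |\<Union>k. D k| <o \<kappa> \<and> \<kappa> \<le>o |UNIV :: 'a set| \<and>
     homogeneous C D \<kappa> UNIV"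

section \<open>Rank\<close>

text \<open>A type of ordinals: \<open>'i set set\<close> well-ordered in the order type of its cardinality.
  It will be used with \<open>'i\<close> the formulas with parameters, so that there are fewer sets of formulas
  than ordinals.  The values of the rank other than \<open>-1\<close> and \<open>\<infinity>\<close> form an initial segment of the
  ordinals (if no set of formulas has rank \<open>\<alpha>\<close>, then \<open>R \<ge> \<alpha>\<close> implies \<open>R \<ge> \<beta>\<close> for all \<open>\<beta>\<close>), hence
  all of them lie in this type, and \<open>R \<ge> \<alpha>\<close> for all \<open>\<alpha>\<close> in this type means \<open>R = \<infinity>\<close>.\<close>

typedef 'i ordinal = "UNIV :: 'i set set set" by simp

instantiation ordinal :: (type) wellorder
begin

definition less_eq_ordinal :: "'a ordinal \<Rightarrow> 'a ordinal \<Rightarrow> bool" where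
  "\<alpha> \<le> \<beta> \<longleftrightarrow> (Rep_ordinal \<alpha>, Rep_ordinal \<beta>) \<in> |UNIV :: 'a set set set|"

definition less_ordinal :: "'a ordinal \<Rightarrow> 'a ordinal \<Rightarrow> bool" where
  "\<alpha> < \<beta> \<longleftrightarrow> \<alpha> \<le> \<beta> \<and> \<not> \<beta> \<le> (\<alpha> :: 'a ordinal)"

instance
proof -
  let ?r = "|UNIV :: 'a set set set|"
  have wo: "well_order_on UNIV ?r"
    by (rule card_of_well_order_on)
  then have refl: "refl ?r" and trans: "trans ?r" and anti: "antisym ?r" and tot: "total ?r"
    and wf: "wf (?r - Id)"
    by (auto simp: well_order_on_def linear_order_on_def partial_order_on_def preorder_on_def)
  have tot': "(x, y) \<in> ?r \<or> (y, x) \<in> ?r" for x y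
    using tot refl by (cases "x = y") (auto simp: total_on_def refl_on_def)
  show "OFCLASS('a ordinal, wellorder_class)"
  proof (intro_classes)
    fix x y z :: "'a ordinal"
    show "x < y \<longleftrightarrow> x \<le> y \<and> \<not> y \<le> x"
      by (rule less_ordinal_def)
    show "x \<le> x"
      using refl by (simp add: less_eq_ordinal_def refl_on_def)
    show "x \<le> y \<Longrightarrow> y \<le> z \<Longrightarrow> x \<le> z"
      using trans unfolding less_eq_ordinal_def by (rule transD)
    show "x \<le> y \<Longrightarrow> y \<le> x \<Longrightarrow> x = y"
      using anti unfolding less_eq_ordinal_def by (metis Rep_ordinal_inject antisymD)
    show "x \<le> y \<or> y \<le> x"
      unfolding less_eq_ordinal_def by (rule tot')
  next
    fix P :: "'a ordinal \<Rightarrow> bool" and a :: "'a ordinal"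
    assume step: "\<And>x. (\<And>y. y < x \<Longrightarrow> P y) \<Longrightarrow> P x"
    have "P (Abs_ordinal u)" for u
      using wf
    proof (induction u rule: wf_induct_rule)
      case (less u)
      show ?case
      proof (rule step)
        fix y assume y: "y < Abs_ordinal u"
        then have "(Rep_ordinal y, u) \<in> ?r - Id"
          using refl by (auto simp: less_ordinal_def less_eq_ordinal_def Abs_ordinal_inverse)
        then show "P y"
          using less.IH[of "Rep_ordinal y"] by (simp add: Rep_ordinal_inverse)
      qed
    qed
    from this[of "Rep_ordinal a"] show "P a"
      by (simp add: Rep_ordinal_inverse)
  qed
qed

end

definition ord_succ :: "'o::wellorder \<Rightarrow> 'o \<Rightarrow> bool" where
  "ord_succ \<alpha> \<beta> \<longleftrightarrow> \<alpha> < \<beta> \<and> \<not> (\<exists>\<gamma>. \<alpha> < \<gamma> \<and> \<gamma> < \<beta>)"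

definition ord_limit :: "'o::wellorder \<Rightarrow> bool" where
  "ord_limit \<delta> \<longleftrightarrow> (\<exists>\<alpha>. \<alpha> < \<delta>) \<and> \<not> (\<exists>\<alpha>. ord_succ \<alpha> \<delta>)"

text \<open>\<open>rank_ge C D n \<alpha> p\<close> is \<open>R[p] \<ge> \<alpha>\<close>, for a set \<open>p\<close> of formulas in \<open>n\<close> variables with finitely
  many parameters.\<close>

inductive rank_ge ::
    "('f, 'r, 'a) struct \<Rightarrow> ('f, 'r) diag \<Rightarrow> nat \<Rightarrow>
     ('f, 'r, 'a) pfm ordinal \<Rightarrow> ('f, 'r, 'a) pfm set \<Rightarrow> bool"
  for C D n where
  zero: "rank_ge C D n \<alpha> p"
    if "\<forall>\<beta>. \<alpha> \<le> \<beta>" and "\<exists>c. length c = n \<and> realizes C c p"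
| limit: "rank_ge C D n \<delta> p"
    if "ord_limit \<delta>" and "\<forall>\<alpha><\<delta>. rank_ge C D n \<alpha> p"
| succ: "rank_ge C D n \<beta> p"
    if "ord_succ \<alpha> \<beta>"
      and "\<exists>a. \<exists>\<phi>\<in>fms C (n + length a).
             rank_ge C D n \<alpha> (p \<union> {(\<phi>, a)}) \<and> rank_ge C D n \<alpha> (p \<union> {(Neg \<phi>, a)})"
      and "\<forall>a. \<exists>q\<in>D (n + length a). rank_ge C D n \<alpha> (p \<union> {(\<phi>, a) | \<phi>. \<phi> \<in> q})"

definition rank_fin ::
    "('f, 'r, 'a) struct \<Rightarrow> ('f, 'r) diag \<Rightarrow> nat \<Rightarrow>
     ('f, 'r, 'a) pfm set \<Rightarrow> ('f, 'r, 'a) pfm ordinal extended" where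
  "rank_fin C D n p =
     (if \<forall>\<alpha>. rank_ge C D n \<alpha> p then \<infinity>
      else if \<forall>\<alpha>. \<not> rank_ge C D n \<alpha> p then -\<infinity>
      else Fin (GREATEST \<alpha>. rank_ge C D n \<alpha> p))"

text \<open>\<open>rank C D n p\<close> is \<open>R[p]\<close> for a set of formulas \<open>p\<close> over an arbitrary set.
  The value \<open>-1\<close> of the rank (of the sets which are not realized) is represented by \<open>-\<infinity>\<close>.\<close>

definition rank ::
    "('f, 'r, 'a) struct \<Rightarrow> ('f, 'r) diag \<Rightarrow> nat \<Rightarrow>
     ('f, 'r, 'a) pfm set \<Rightarrow> ('f, 'r, 'a) pfm ordinal extended" where
  "rank C D n p = (LEAST r. \<exists>B q. finite B \<and> q \<subseteq> restr p B \<and> r = rank_fin C D n q)"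

definition totally_transcendental :: "('f, 'r, 'a) struct \<Rightarrow> ('f, 'r) diag \<Rightarrow> bool" where
  "totally_transcendental C D \<longleftrightarrow> (\<forall>n p. p \<subseteq> pfms C n UNIV \<longrightarrow> rank C D n p < \<infinity>)"

section \<open>Independence, stationary and regular types, orthogonality\<close>

text \<open>\<open>indep C D X B Y\<close>: \<open>X\<close> is independent from \<open>Y\<close> over \<open>B\<close>.\<close>

definition indep ::
    "('f, 'r, 'a) struct \<Rightarrow> ('f, 'r) diag \<Rightarrow> 'a set \<Rightarrow> 'a set \<Rightarrow> 'a set \<Rightarrow> bool" where
  "indep C D X B Y \<longleftrightarrow>
     (\<forall>a\<in>lists X. rank C D (length a) (tp C a B) = rank C D (length a) (tp C a (B \<union> Y)))"

definition free_ext ::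
    "('f, 'r, 'a) struct \<Rightarrow> ('f, 'r) diag \<Rightarrow> nat \<Rightarrow> ('f, 'r, 'a) pfm set \<Rightarrow>
     'a set \<Rightarrow> ('f, 'r, 'a) pfm set \<Rightarrow> bool" where
  "free_ext C D n p B q \<longleftrightarrow> q \<in> S_D C D n B \<and> p \<subseteq> q \<and> rank C D n q = rank C D n p"

definition stationary ::
    "('f, 'r, 'a) struct \<Rightarrow> ('f, 'r) diag \<Rightarrow> 'k rel \<Rightarrow> nat \<Rightarrow> 'a set \<Rightarrow>
     ('f, 'r, 'a) pfm set \<Rightarrow> bool" where
  "stationary C D \<kappa> n A p \<longleftrightarrow> p \<in> S_D C D n A \<and>
     (\<forall>B. A \<subseteq> B \<and> small \<kappa> B \<longrightarrow> (\<exists>!q. free_ext C D n p B q))"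

text \<open>Orthogonality of \<open>p \<in> S\<^sub>D\<^sup>n(A)\<close> and \<open>q \<in> S\<^sub>D\<^sup>m(B)\<close>.  For stationary \<open>p\<close> and \<open>q\<close> the types of
  \<open>a\<close> and \<open>b\<close> over \<open>M\<close> below are the free extensions of \<open>p\<close> and \<open>q\<close>; the definition of \<open>regular\<close>
  also applies \<open>orth\<close> to types \<open>q\<close> which need not be stationary, and there it refers to all the
  free extensions of \<open>q\<close>.\<close>

definition orth ::
    "('f, 'r, 'a) struct \<Rightarrow> ('f, 'r) diag \<Rightarrow> 'k rel \<Rightarrow>
     nat \<Rightarrow> 'a set \<Rightarrow> ('f, 'r, 'a) pfm set \<Rightarrow> nat \<Rightarrow> 'a set \<Rightarrow> ('f, 'r, 'a) pfm set \<Rightarrow> bool" where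
  "orth C D \<kappa> n A p m B q \<longleftrightarrow>
     (\<forall>M a b. aleph0_homogeneous C D M \<and> small \<kappa> M \<and> A \<union> B \<subseteq> M \<and> length a = n \<and> length b = m \<and>
        free_ext C D n p M (tp C a M) \<and> free_ext C D m q M (tp C b M) \<longrightarrow>
        indep C D (set a) M (set b))"

text \<open>\<open>p \<in> S\<^sub>D\<^sup>n(A)\<close> is orthogonal to the model \<open>M\<close>.\<close>

definition orth_model ::
    "('f, 'r, 'a) struct \<Rightarrow> ('f, 'r) diag \<Rightarrow> 'k rel \<Rightarrow>
     nat \<Rightarrow> 'a set \<Rightarrow> ('f, 'r, 'a) pfm set \<Rightarrow> 'a set \<Rightarrow> bool" where
  "orth_model C D \<kappa> n A p M \<longleftrightarrow> (\<forall>m. \<forall>q\<in>S_D C D m M. orth C D \<kappa> n A p m M q)"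

definition based_on ::
    "('f, 'r, 'a) struct \<Rightarrow> ('f, 'r) diag \<Rightarrow> 'k rel \<Rightarrow> nat \<Rightarrow> 'a set \<Rightarrow>
     ('f, 'r, 'a) pfm set \<Rightarrow> 'a set \<Rightarrow> bool" where
  "based_on C D \<kappa> n A p B \<longleftrightarrow>
     B \<subseteq> A \<and> stationary C D \<kappa> n B (restr p B) \<and> free_ext C D n (restr p B) A p"

definition regular ::
    "('f, 'r, 'a) struct \<Rightarrow> ('f, 'r) diag \<Rightarrow> 'k rel \<Rightarrow> nat \<Rightarrow> 'a set \<Rightarrow>
     ('f, 'r, 'a) pfm set \<Rightarrow> bool" where
  "regular C D \<kappa> n A p \<longleftrightarrow> stationary C D \<kappa> n A p \<and>
     (\<exists>B. based_on C D \<kappa> n A p B \<and>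
        (\<forall>E. \<forall>q\<in>S_D C D n E. B \<subseteq> E \<and> small \<kappa> E \<and> restr p B \<subseteq> q \<longrightarrow>
           free_ext C D n (restr p B) E q \<or> orth C D \<kappa> n A p n E q))"

end

theory Submission
  imports Defs
begin

text \<open>Let \<open>p\<close> be regular over \<open>N\<close>, based on a finite tuple \<open>d\<close>, and not orthogonal to some \<open>q\<close>, the type
  of \<open>a\<close> over \<open>M\<close>.  Choose \<open>d\<^sub>0, d\<^sub>1, \<dots>\<close> in \<open>M\<close> such that \<open>d\<^sub>i\<close> has the type of \<open>d\<close> over the base of \<open>q\<close>
  and \<open>d\<^sub>0, \<dots>, d\<^sub>i\<^sub>-\<^sub>1\<close>.  The conjugate \<open>p\<^sub>i\<close> of \<open>p\<close> over \<open>d\<^sub>i\<close> gives a regular type over \<open>M\<close>, realized by some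
  \<open>c\<^sub>i\<close> on which \<open>a\<close> depends.  If \<open>p\<close> were orthogonal to every \<open>p\<^sub>i\<close>, the \<open>p\<^sub>i\<close> would be pairwise orthogonal,
  since \<open>(d\<^sub>j, d\<^sub>i)\<close> and \<open>(d, d\<^sub>i)\<close> have the same type for \<open>i < j\<close>, so the \<open>c\<^sub>i\<close> would be independent; but
  \<open>a\<close> cannot depend on infinitely many independent elements.

  Free extensions need not exist over sets that are not models.  In their place, every tuple \<open>e\<close> has
  a copy over \<open>M \<union> z\<close> dominated by \<open>z\<close>, and an element of minimal rank over such tuples \<open>z\<close> has a
  stationary type.  This yields symmetry of independence, orthogonality over \<open>M \<union> z\<close>, and finite
  weight, without orders of large cardinality or primary models.\<close>


section \<open>Renaming of variables\<close>

text \<open>The obstacle is the second clause in the successor step of the rank: to raise the rank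
  over \<open>B\<close>, every tuple \<open>e\<close> must admit an extension of the same rank. Over
  an arbitrary set this may fail, and then two distinct extensions of full rank do not raise the
  rank, so free extensions need not be unique. The minimality arguments restore that clause. Take a
  family of tuples \<open>z\<close> closed under passing to \<open>e' @ z\<close> for a dominated
  copy \<open>e'\<close> of any given \<open>e\<close>. Where the rank of \<open>c\<close> over
  \<open>M \<union> z\<close> is least, no such copy lowers it further, and transporting the copy
  back to \<open>e\<close> gives the extension that the clause demands (\<open>statI\<close>).
  Symmetry, orthogonality over \<open>M \<union> z\<close> and finite weight differ in the family
  only. Only pairs of the \<open>d\<close>-sequence have a controlled type, so orthogonality is
  recast as an invariant of types over the empty set (\<open>orth_at\<close>). The sequence of the
  \<open>c\<close>'s is never shown independent as a whole: finite weight uses only that two members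
  which are free from \<open>z\<close> remain free when the other is adjoined to \<open>z\<close>,
  so that adjoining a member loses at most that member.\<close>

fun rename_tm :: "(nat \<Rightarrow> nat) \<Rightarrow> 'f tm \<Rightarrow> 'f tm" where
  "rename_tm \<rho> (Var i) = Var (\<rho> i)"
| "rename_tm \<rho> (Fn f ts) = Fn f (map (rename_tm \<rho>) ts)"

text \<open>\<open>\<rho>\<close> need not be injective, so that entries can be repeated; the bound
  variable moves above every image of a free variable, which rules out capture.\<close>

fun rename_fm :: "(nat \<Rightarrow> nat) \<Rightarrow> ('f, 'r) fm \<Rightarrow> ('f, 'r) fm" where
  "rename_fm \<rho> (Eq s t) = Eq (rename_tm \<rho> s) (rename_tm \<rho> t)"
| "rename_fm \<rho> (Rel r ts) = Rel r (map (rename_tm \<rho>) ts)"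
| "rename_fm \<rho> (Neg \<phi>) = Neg (rename_fm \<rho> \<phi>)"
| "rename_fm \<rho> (And \<phi> \<psi>) = And (rename_fm \<rho> \<phi>) (rename_fm \<rho> \<psi>)"
| "rename_fm \<rho> (Ex i \<phi>) =
     (let j = Suc (Max (insert 0 (\<rho> ` fv \<phi>))) in Ex j (rename_fm (\<rho>(i := j)) \<phi>))"

lemma finite_fv_tm: "finite (fv_tm t)"
  by (induction t) auto

lemma finite_fv: "finite (fv \<phi>)"
  by (induction \<phi>) (auto simp: finite_fv_tm)

lemma val_cong: "(\<And>i. i \<in> fv_tm t \<Longrightarrow> e i = e' i) \<Longrightarrow> val C e t = val C e' t"
proof (induction t)
  case (Fn f ts)
  then have "map (val C e) ts = map (val C e') ts" by auto
  then show ?case by (simp del: map_eq_conv)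
qed simp

lemma sat_cong: "(\<And>i. i \<in> fv \<phi> \<Longrightarrow> e i = e' i) \<Longrightarrow> sat C M e \<phi> \<longleftrightarrow> sat C M e' \<phi>"
proof (induction \<phi> arbitrary: e e')
  case (Eq s t)
  then show ?case using val_cong[of s e e' C] val_cong[of t e e' C] by auto
next
  case (Rel r ts)
  then have "map (val C e) ts = map (val C e') ts" by (auto intro!: val_cong)
  then show ?case by (simp del: map_eq_conv)
next
  case (Neg \<phi>)
  have "sat C M e \<phi> = sat C M e' \<phi>" by (rule Neg.IH) (simp add: Neg.prems)
  then show ?case by simp
next
  case (And \<phi> \<psi>)
  have "sat C M e \<phi> = sat C M e' \<phi>" by (rule And.IH) (simp add: And.prems)
  moreover have "sat C M e \<psi> = sat C M e' \<psi>" by (rule And.IH) (simp add: And.prems)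
  ultimately show ?case by simp
next
  case (Ex j \<phi>)
  have "sat C M (e(j := v)) \<phi> = sat C M (e'(j := v)) \<phi>" for v
    by (rule Ex.IH) (use Ex.prems in auto)
  then show ?case by simp
qed

lemma val_rename: "val C e (rename_tm \<rho> t) = val C (e \<circ> \<rho>) t"
  by (induction t) (auto intro!: arg_cong[where f = "fint C _"])

lemma fv_rename_tm: "fv_tm (rename_tm \<rho> t) = \<rho> ` fv_tm t"
  by (induction t) auto

lemma wf_rename_tm: "wf_tm C t \<Longrightarrow> wf_tm C (rename_tm \<rho> t)"
  by (induction t) auto

lemma wf_rename_fm: "wf_fm C \<phi> \<Longrightarrow> wf_fm C (rename_fm \<rho> \<phi>)"
  by (induction \<phi> arbitrary: \<rho>) (auto simp: wf_rename_tm Let_def)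

lemma fresh: "finite A \<Longrightarrow> Suc (Max (insert 0 A)) \<notin> A"
  using Max_ge[of "insert 0 A" "Suc (Max (insert 0 A))"] by (metis Suc_n_not_le_n finite.insertI insertI2)

lemma fv_rename_fm: "fv (rename_fm \<rho> \<phi>) \<subseteq> \<rho> ` fv \<phi>"
proof (induction \<phi> arbitrary: \<rho>)
  case (Ex i \<phi>)
  then show ?case by (fastforce simp: Let_def)
qed (fastforce simp: fv_rename_tm)+

lemma sat_rename: "sat C M e (rename_fm \<rho> \<phi>) \<longleftrightarrow> sat C M (e \<circ> \<rho>) \<phi>"
proof (induction \<phi> arbitrary: e \<rho>)
  case (Rel r ts)
  have "map (val C e) (map (rename_tm \<rho>) ts) = map (val C (e \<circ> \<rho>)) ts"
    by (simp add: val_rename)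
  then show ?case by (simp del: map_map map_eq_conv add: comp_def)
next
  case (Ex i \<phi>)
  define j where "j = Suc (Max (insert 0 (\<rho> ` fv \<phi>)))"
  have j: "j \<notin> \<rho> ` fv \<phi>" unfolding j_def by (rule fresh) (simp add: finite_fv)
  have "sat C M (e(j := v) \<circ> \<rho>(i := j)) \<phi> \<longleftrightarrow> sat C M ((e \<circ> \<rho>)(i := v)) \<phi>" for v
    by (rule sat_cong) (use j in auto)
  moreover have "sat C M e (rename_fm \<rho> (Ex i \<phi>)) \<longleftrightarrow> (\<exists>v\<in>M. sat C M (e(j := v) \<circ> \<rho>(i := j)) \<phi>)"
    using Ex.IH by (simp add: Let_def del: fun_upd_apply o_apply flip: j_def)
  ultimately show ?case by (simp add: comp_def)
qed (auto simp: val_rename)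

text \<open>The last variable is eliminated first, one quantifier at a time. This turns
  satisfiability of finitely many formulas into a single formula about the parameters, which
  elementary maps preserve.\<close>

lemma fms_exists:
  assumes "\<psi> \<in> fms C (l + n)"
  shows "\<exists>\<theta>\<in>fms C l. \<forall>a. length a = l \<longrightarrow>
    (sat C UNIV (nth a) \<theta> \<longleftrightarrow> (\<exists>c. length c = n \<and> sat C UNIV (nth (a @ c)) \<psi>))"
  using assms
proof (induction n arbitrary: \<psi>)
  case 0
  then show ?case by auto
next
  case (Suc n)
  have "Ex (l + n) \<psi> \<in> fms C (l + n)"
    using Suc.prems by (auto simp: fms_def less_Suc_eq subset_iff)
  from Suc.IH[OF this] obtain \<theta> where \<theta>: "\<theta> \<in> fms C l"
    "\<And>a. length a = l \<Longrightarrow> sat C UNIV (nth a) \<theta> \<longleftrightarrow>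
       (\<exists>c. length c = n \<and> sat C UNIV (nth (a @ c)) (Ex (l + n) \<psi>))" by blast
  have step: "sat C UNIV (nth (a @ c)) (Ex (l + n) \<psi>) \<longleftrightarrow> (\<exists>v. sat C UNIV (nth (a @ c @ [v])) \<psi>)"
    if "length a = l" "length c = n" for a c
  proof -
    have "sat C UNIV ((nth (a @ c))(l + n := v)) \<psi> \<longleftrightarrow> sat C UNIV (nth (a @ c @ [v])) \<psi>" for v
      by (rule sat_cong) (use Suc.prems that in \<open>auto simp: fms_def nth_append subset_iff less_Suc_eq\<close>)
    then show ?thesis by simp
  qed
  show ?case
  proof (intro bexI[OF _ \<theta>(1)] allI impI)
    fix a :: "'c list" assume a: "length a = l"
    have "(\<exists>c. length c = n \<and> (\<exists>v. sat C UNIV (nth (a @ c @ [v])) \<psi>)) \<longleftrightarrow>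
      (\<exists>c. length c = Suc n \<and> sat C UNIV (nth (a @ c)) \<psi>)" (is "?L \<longleftrightarrow> ?R")
    proof
      assume ?L
      then obtain c v where "length c = n" "sat C UNIV (nth (a @ c @ [v])) \<psi>" by blast
      then show ?R by (intro exI[of _ "c @ [v]"]) simp
    next
      assume ?R
      then obtain c where c: "length c = Suc n" "sat C UNIV (nth (a @ c)) \<psi>" by blast
      then have "c = butlast c @ [last c]" by (metis append_butlast_last_id length_0_conv nat.distinct(1))
      with c show ?L by (intro exI[of _ "butlast c"]) (auto intro!: exI[of _ "last c"])
    qed
    then show "sat C UNIV (nth a) \<theta> \<longleftrightarrow> (\<exists>c. length c = Suc n \<and> sat C UNIV (nth (a @ c)) \<psi>)"
      using \<theta>(2)[OF a] step[OF a] by blast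
  qed
qed

lemma fms_conj:
  assumes "finite Q" "Q \<subseteq> fms C k"
  shows "\<exists>\<psi>\<in>fms C k. \<forall>e. sat C UNIV e \<psi> \<longleftrightarrow> (\<forall>\<phi>\<in>Q. sat C UNIV e \<phi>)"
  using assms
proof (induction Q rule: finite_induct)
  case empty
  \<comment> \<open>This true sentence has no free variable, so it serves even for
    \<open>k = 0\<close>.\<close>
  have "Ex 0 (Eq (Var 0) (Var 0)) \<in> fms C k" by (simp add: fms_def)
  then show ?case by (intro bexI[of _ "Ex 0 (Eq (Var 0) (Var 0))"]) auto
next
  case (insert \<phi> Q)
  then obtain \<psi> where "\<psi> \<in> fms C k" "\<forall>e. sat C UNIV e \<psi> \<longleftrightarrow> (\<forall>\<phi>\<in>Q. sat C UNIV e \<phi>)" by blast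
  moreover have "\<phi> \<in> fms C k" using insert by blast
  ultimately show ?case by (intro bexI[of _ "And \<phi> \<psi>"]) (auto simp: fms_def)
qed

section \<open>Types of tuples\<close>

lemma tp0_iff: "\<phi> \<in> tp0 C x \<longleftrightarrow> \<phi> \<in> fms C (length x) \<and> sat C UNIV (nth x) \<phi>"
  by (simp add: tp0_def)

lemma Neg_fms: "Neg \<phi> \<in> fms C k \<longleftrightarrow> \<phi> \<in> fms C k"
  by (simp add: fms_def)

lemma tp0_Neg: "\<phi> \<in> fms C (length x) \<Longrightarrow> Neg \<phi> \<in> tp0 C x \<longleftrightarrow> \<phi> \<notin> tp0 C x"
  by (simp add: tp0_iff Neg_fms)

lemma tp0_subset_eq:
  assumes "tp0 C x \<subseteq> tp0 C y" "length x = length y" shows "tp0 C x = tp0 C y"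
proof
  show "tp0 C y \<subseteq> tp0 C x"
  proof
    fix \<phi> assume \<phi>: "\<phi> \<in> tp0 C y"
    then have f: "\<phi> \<in> fms C (length x)" using assms(2) by (simp add: tp0_iff)
    show "\<phi> \<in> tp0 C x"
    proof (rule ccontr)
      assume "\<phi> \<notin> tp0 C x"
      then have "Neg \<phi> \<in> tp0 C y" using f assms(1) tp0_Neg by blast
      then show False using \<phi> f assms(2) tp0_Neg by metis
    qed
  qed
qed (rule assms)

text \<open>The formula \<open>Eq (Var k) (Var k)\<close> lies in a type exactly when
  \<open>k\<close> is below its arity.\<close>

lemma tp0_eq_length:
  assumes "tp0 C x = tp0 C y" shows "length x = length y"
proof -
  have *: "Eq (Var k) (Var k) \<in> tp0 C z \<longleftrightarrow> k < length z" for z k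
    by (auto simp: tp0_iff fms_def)
  have "k < length x \<longleftrightarrow> k < length y" for k using *[of k x] *[of k y] assms by simp
  then show ?thesis by (metis linorder_neqE_nat less_irrefl)
qed

lemma tp0_reindex:
  assumes "tp0 C x = tp0 C y" "set is \<subseteq> {..<length x}"
  shows "tp0 C (map (nth x) is) = tp0 C (map (nth y) is)"
proof -
  have len: "length x = length y" by (rule tp0_eq_length[OF assms(1)])
  define \<rho> where "\<rho> i = is ! i" for i
  have *: "\<phi> \<in> tp0 C (map (nth z) is) \<longleftrightarrow> \<phi> \<in> fms C (length is) \<and> rename_fm \<rho> \<phi> \<in> tp0 C z"
    if "length z = length x" for z \<phi>
  proof (cases "\<phi> \<in> fms C (length is)")
    case True
    have "\<rho> ` fv \<phi> \<subseteq> {..<length x}"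
      using True assms(2) by (auto simp: fms_def \<rho>_def subset_iff)
    then have "rename_fm \<rho> \<phi> \<in> fms C (length z)"
      using True fv_rename_fm[of \<rho> \<phi>] that by (auto simp: fms_def wf_rename_fm)
    moreover have "sat C UNIV (nth z \<circ> \<rho>) \<phi> = sat C UNIV (nth (map (nth z) is)) \<phi>"
      by (rule sat_cong) (use True in \<open>auto simp: fms_def \<rho>_def\<close>)
    ultimately show ?thesis using True by (simp add: tp0_iff sat_rename)
  qed (simp add: tp0_iff)
  show ?thesis by (rule set_eqI) (simp add: * len assms(1))
qed

lemma tp0_nth_eq:
  assumes "tp0 C x = tp0 C y" "i < length x" "j < length x" "x ! i = x ! j"
  shows "y ! i = y ! j"
proof -
  have "Eq (Var i) (Var j) \<in> tp0 C x" unfolding tp0_iff fms_def using assms by simp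
  then show ?thesis unfolding assms(1) by (simp add: tp0_iff)
qed

lemma tp_iff: "(\<phi>, a) \<in> tp C c A \<longleftrightarrow> a \<in> lists A \<and> \<phi> \<in> tp0 C (c @ a)"
  by (auto simp: tp_def pfms_def tp0_iff in_lists_conv_set)

lemma tp_eq_iff: "tp C c A = tp C d A \<longleftrightarrow> (\<forall>a\<in>lists A. tp0 C (c @ a) = tp0 C (d @ a))"
proof
  assume eq: "tp C c A = tp C d A"
  show "\<forall>a\<in>lists A. tp0 C (c @ a) = tp0 C (d @ a)"
  proof
    fix a assume "a \<in> lists A"
    then have "\<phi> \<in> tp0 C (c @ a) \<longleftrightarrow> \<phi> \<in> tp0 C (d @ a)" for \<phi>
      using eq tp_iff[of \<phi> a C c A] tp_iff[of \<phi> a C d A] by simp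
    then show "tp0 C (c @ a) = tp0 C (d @ a)" by blast
  qed
next
  assume *: "\<forall>a\<in>lists A. tp0 C (c @ a) = tp0 C (d @ a)"
  show "tp C c A = tp C d A"
  proof (rule set_eqI)
    fix x :: "('a, 'b, 'c) pfm"
    obtain \<phi> a where x: "x = (\<phi>, a)" by (cases x)
    have "a \<in> lists A \<Longrightarrow> tp0 C (c @ a) = tp0 C (d @ a)" using * by blast
    then show "x \<in> tp C c A \<longleftrightarrow> x \<in> tp C d A" unfolding x tp_iff by blast
  qed
qed

lemma tp_eq_length: "tp C c A = tp C d A \<Longrightarrow> length c = length d"
  using tp0_eq_length[of C "c @ []" "d @ []"] unfolding tp_eq_iff
  by (metis append_Nil2 lists.Nil)

lemma tp_mono_eq: "tp C c B = tp C d B \<Longrightarrow> A \<subseteq> B \<Longrightarrow> tp C c A = tp C d A"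
  unfolding tp_eq_iff by (meson lists_mono subsetD)

lemma tp_empty: "tp C c {} = tp C d {} \<longleftrightarrow> tp0 C c = tp0 C d"
  by (simp add: tp_eq_iff)

lemma restr_tp: "restr (tp C c A) B = tp C c (A \<inter> B)"
  by (auto simp: restr_def tp_iff in_lists_conv_set)

lemma restr_tp': "B \<subseteq> A \<Longrightarrow> restr (tp C c A) B = tp C c B"
  by (simp add: restr_tp Int_absorb1)

lemma tp_subset_iff:
  assumes "A \<subseteq> B" "length c = length d" shows "tp C c A \<subseteq> tp C d B \<longleftrightarrow> tp C c A = tp C d A"
proof
  assume sub: "tp C c A \<subseteq> tp C d B"
  have "tp0 C (c @ a) = tp0 C (d @ a)" if "a \<in> lists A" for a
  proof (rule tp0_subset_eq)
    show "tp0 C (c @ a) \<subseteq> tp0 C (d @ a)"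
    proof
      fix \<phi> assume "\<phi> \<in> tp0 C (c @ a)"
      then have "(\<phi>, a) \<in> tp C d B" using that sub by (metis subsetD tp_iff)
      then show "\<phi> \<in> tp0 C (d @ a)" by (simp add: tp_iff)
    qed
  qed (use assms in simp)
  then show "tp C c A = tp C d A" by (simp add: tp_eq_iff)
next
  assume "tp C c A = tp C d A"
  moreover have "tp C d A \<subseteq> tp C d B" using assms(1) by (force simp: tp_iff)
  ultimately show "tp C c A \<subseteq> tp C d B" by simp
qed

text \<open>Tuples are compared blockwise, so that blocks can be dropped, permuted and repeated.\<close>

definition tps_eq :: "('f, 'r, 'a) struct \<Rightarrow> 'a set \<Rightarrow> 'a list list \<Rightarrow> 'a list list \<Rightarrow> bool" where
  "tps_eq C A xs ys \<longleftrightarrow> map length xs = map length ys \<and> tp C (concat xs) A = tp C (concat ys) A"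

lemma tps_eq_refl: "tps_eq C A xs xs" by (simp add: tps_eq_def)
lemma tps_eq_sym: "tps_eq C A xs ys \<Longrightarrow> tps_eq C A ys xs" by (simp add: tps_eq_def del: map_eq_conv)
lemma tps_eq_trans: "tps_eq C A xs ys \<Longrightarrow> tps_eq C A ys zs \<Longrightarrow> tps_eq C A xs zs"
  by (simp add: tps_eq_def)
lemma tps_eq_mono: "tps_eq C B xs ys \<Longrightarrow> A \<subseteq> B \<Longrightarrow> tps_eq C A xs ys"
  unfolding tps_eq_def using tp_mono_eq by blast

lemma tp_reindex:
  assumes "tp C x A = tp C y A" "set is \<subseteq> {..<length x}"
  shows "tp C (map (nth x) is) A = tp C (map (nth y) is) A"
  unfolding tp_eq_iff
proof
  fix a assume a: "a \<in> lists A"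
  have len: "length x = length y" by (rule tp_eq_length[OF assms(1)])
  let ?js = "is @ [length x..<length x + length a]"
  have *: "map (nth (z @ a)) ?js = map (nth z) is @ a" if "length z = length x" for z
  proof -
    have "map (nth (z @ a)) is = map (nth z) is"
      using assms(2) that by (auto simp: nth_append)
    moreover have "map (nth (z @ a)) [length x..<length x + length a] = a"
      using that by (intro nth_equalityI) (auto simp: nth_append)
    ultimately show ?thesis by simp
  qed
  have "tp0 C (map (nth (x @ a)) ?js) = tp0 C (map (nth (y @ a)) ?js)"
    by (rule tp0_reindex) (use assms a in \<open>auto simp: tp_eq_iff\<close>)
  then show "tp0 C (map (nth x) is @ a) = tp0 C (map (nth y) is @ a)"
    by (simp only: *[OF refl] *[OF len[symmetric]])
qed

text \<open>Block \<open>i\<close> occupies the interval \<open>blk i\<close> of the concatenation,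
  which starts at \<open>off i\<close>; choosing blocks is thus a reindexing of single
  entries.\<close>

lemma tps_eq_reindex:
  assumes "tps_eq C A xs ys" "set is \<subseteq> {..<length xs}"
  shows "tps_eq C A (map (nth xs) is) (map (nth ys) is)"
proof -
  have ml: "map length xs = map length ys" and t: "tp C (concat xs) A = tp C (concat ys) A"
    using assms(1) by (auto simp: tps_eq_def)
  define off where "off i = sum_list (take i (map length xs))" for i
  define blk where "blk i = [off i..<off i + length (xs ! i)]" for i
  have b: "map (nth (concat zs)) (blk i) = zs ! i" if "map length zs = map length xs" "i < length xs" for zs i
  proof -
    have i: "i < length zs" using that by (metis length_map)
    have l: "length (zs ! i) = length (xs ! i)" using that i by (metis nth_map)
    have "concat zs = concat (take i zs) @ zs ! i @ concat (drop (Suc i) zs)"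
      using i by (metis concat.simps(2) concat_append id_take_nth_drop)
    moreover have "length (concat (take i zs)) = off i"
      by (simp add: off_def length_concat take_map flip: that(1))
    ultimately show ?thesis unfolding blk_def
      by (intro nth_equalityI) (auto simp: l nth_append)
  qed
  have bl: "set (blk i) \<subseteq> {..<length (concat xs)}" if "i < length xs" for i
  proof -
    have "concat xs = concat (take i xs) @ xs ! i @ concat (drop (Suc i) xs)"
      using that by (metis concat.simps(2) concat_append id_take_nth_drop)
    then have "length (concat xs) = off i + length (xs ! i) + length (concat (drop (Suc i) xs))"
      by (metis add.assoc length_append length_concat off_def take_map)
    then show ?thesis by (auto simp: blk_def)
  qed
  have c: "map (nth (concat zs)) (concat (map blk is)) = concat (map (nth zs) is)"
    if "map length zs = map length xs" for zs
    using assms(2) b[OF that] by (induction "is") auto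
  have "tp C (map (nth (concat xs)) (concat (map blk is))) A =
    tp C (map (nth (concat ys)) (concat (map blk is))) A"
    by (rule tp_reindex[OF t]) (use assms(2) bl in \<open>fastforce\<close>)
  then have "tp C (concat (map (nth xs) is)) A = tp C (concat (map (nth ys) is)) A"
    using c[of xs] c[of ys] ml by simp
  moreover have "map length (map (nth xs) is) = map length (map (nth ys) is)"
  proof -
    have "length (xs ! i) = length (ys ! i)" if "i < length xs" for i
      using ml that by (metis length_map nth_map)
    then show ?thesis using assms(2) by auto
  qed
  ultimately show ?thesis unfolding tps_eq_def by blast
qed

lemma tps_eq_set:
  assumes "tps_eq C A [x, e] [y, e]" shows "tps_eq C (A \<union> set e) [x] [y]"
proof -
  have len: "length x = length y" and t: "tp C (x @ e) A = tp C (y @ e) A"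
    using assms by (auto simp: tps_eq_def)
  have "tp0 C (x @ a) = tp0 C (y @ a)" if a: "a \<in> lists (A \<union> set e)" for a
  proof -
    \<comment> \<open>The entries of \<open>a\<close> in \<open>A\<close> are kept as
      \<open>b\<close>, the others occur in \<open>e\<close>; hence \<open>a\<close> is a reindexing
      of \<open>e @ b\<close>, about which the hypothesis speaks.\<close>
    define b where "b = filter (\<lambda>v. v \<in> A) a"
    have b: "b \<in> lists A" by (auto simp: b_def)
    have eq: "tp0 C (x @ e @ b) = tp0 C (y @ e @ b)" using t b by (simp add: tp_eq_iff)
    have "\<forall>i<length a. \<exists>j. j < length (e @ b) \<and> (e @ b) ! j = a ! i"
    proof (intro allI impI)
      fix i assume i: "i < length a"
      then have "a ! i \<in> set (e @ b)" using a by (auto simp: b_def in_lists_conv_set)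
      then show "\<exists>j. j < length (e @ b) \<and> (e @ b) ! j = a ! i" by (meson in_set_conv_nth)
    qed
    then obtain h where h: "\<And>i. i < length a \<Longrightarrow> h i < length (e @ b) \<and> (e @ b) ! h i = a ! i" by metis
    let ?js = "[0..<length x] @ map (\<lambda>i. length x + h i) [0..<length a]"
    have *: "map (nth (z @ e @ b)) ?js = z @ a" if "length z = length x" for z
    proof (rule nth_equalityI)
      fix i assume "i < length (map (nth (z @ e @ b)) ?js)"
      then have i: "i < length x + length a" by simp
      show "map (nth (z @ e @ b)) ?js ! i = (z @ a) ! i"
      proof (cases "i < length x")
        case True
        then show ?thesis using that by (simp add: nth_append)
      next
        case False
        then have "map (nth (z @ e @ b)) ?js ! i = (z @ (e @ b)) ! (length z + h (i - length x))"
          using i that by (simp add: nth_append)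
        also have "\<dots> = (z @ a) ! i"
          using h[of "i - length x"] False i that by (simp add: nth_append)
        finally show ?thesis .
      qed
    qed (use that in simp)
    have "tp0 C (map (nth (x @ e @ b)) ?js) = tp0 C (map (nth (y @ e @ b)) ?js)"
      by (rule tp0_reindex[OF eq]) (use h in auto)
    then show ?thesis using *[of x] *[of y] len by simp
  qed
  then show ?thesis by (simp add: tps_eq_def tp_eq_iff len)
qed

lemma tps_eq_unset:
  assumes "tps_eq C (A \<union> set e) xs ys" shows "tps_eq C A (xs @ [e]) (ys @ [e])"
  using assms by (auto simp: tps_eq_def tp_eq_iff)

section \<open>Elementary maps and homogeneity\<close>

definition elem_map :: "('f, 'r, 'a) struct \<Rightarrow> ('a \<Rightarrow> 'a) \<Rightarrow> 'a set \<Rightarrow> bool" where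
  "elem_map C f A \<longleftrightarrow> (\<forall>a\<in>lists A. tp0 C (map f a) = tp0 C a)"

lemma elem_map_inj: "elem_map C f A \<Longrightarrow> inj_on f A"
proof (rule inj_onI)
  fix x y assume f: "elem_map C f A" and xy: "x \<in> A" "y \<in> A" "f x = f y"
  have "[x, y] \<in> lists A" using xy by simp
  then have "tp0 C (map f [x, y]) = tp0 C [x, y]" using f unfolding elem_map_def by blast
  from tp0_nth_eq[OF this, of 0 1] show "x = y" using xy(3) by simp
qed

lemma elem_map_inv:
  assumes "elem_map C f A" shows "elem_map C (inv_into A f) (f ` A)"
  unfolding elem_map_def
proof
  fix b assume b: "b \<in> lists (f ` A)"
  let ?g = "inv_into A f"
  have "map ?g b \<in> lists A" using b by (induction b) (auto intro: inv_into_into)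
  then have "tp0 C (map f (map ?g b)) = tp0 C (map ?g b)" using assms unfolding elem_map_def by blast
  moreover have "map f (map ?g b) = b" using b by (induction b) (auto simp: f_inv_into_f)
  ultimately show "tp0 C (map ?g b) = tp0 C b" by simp
qed

lemma elem_map_subset: "elem_map C f B \<Longrightarrow> A \<subseteq> B \<Longrightarrow> elem_map C f A"
  unfolding elem_map_def using lists_mono by blast

lemma elem_map_adjoin:
  assumes eq: "\<And>a. a \<in> lists A \<Longrightarrow> tp0 C (c' @ map f a) = tp0 C (c @ a)"
  obtains h where "elem_map C h (A \<union> set c)" "\<forall>v\<in>A. h v = f v" "map h c = c'"
proof -
  have len: "length c' = length c" using tp0_eq_length[OF eq[of "[]"]] by simp
  \<comment> \<open>On \<open>A\<close> the map follows \<open>f\<close>; elsewhere it reads off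
    \<open>c'\<close> at the first position where the point occurs in \<open>c\<close>. Equality
    formulas make the choice of the position immaterial and force agreement with \<open>f\<close> on
    the entries of \<open>c\<close> in \<open>A\<close>.\<close>
  define h where "h v = (if v \<in> A then f v else c' ! (LEAST i. i < length c \<and> c ! i = v))" for v
  have hA: "h v = f v" if "v \<in> A" for v using that by (simp add: h_def)
  have hc: "h (c ! i) = c' ! i" if i: "i < length c" for i
  proof (cases "c ! i \<in> A")
    case True
    have "(c' @ map f [c ! i]) ! length c = (c' @ map f [c ! i]) ! i"
      by (rule tp0_nth_eq[OF eq[symmetric]]) (use True i len in \<open>auto simp: nth_append\<close>)
    then show ?thesis using True i len by (simp add: h_def nth_append)
  next
    case False
    define j where "j = (LEAST j. j < length c \<and> c ! j = c ! i)"
    have j: "j < length c \<and> c ! j = c ! i" unfolding j_def by (rule LeastI[of _ i]) (use i in simp)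
    have "(c' @ map f []) ! j = (c' @ map f []) ! i"
      by (rule tp0_nth_eq[OF eq[symmetric]]) (use j i in \<open>auto simp: nth_append\<close>)
    then show ?thesis using False by (simp add: h_def flip: j_def)
  qed
  have "elem_map C h (A \<union> set c)"
    unfolding elem_map_def
  proof
    fix a assume a: "a \<in> lists (A \<union> set c)"
    define b where "b = filter (\<lambda>v. v \<in> A) a"
    have b: "b \<in> lists A" by (auto simp: b_def)
    have mb: "map h b = map f b" using b hA by (auto simp: in_lists_conv_set)
    have mc: "map h c = c'" using hc len by (intro nth_equalityI) auto
    have "\<forall>v\<in>set a. \<exists>j. j < length (c @ b) \<and> (c @ b) ! j = v"
    proof
      fix v assume "v \<in> set a"
      then have "v \<in> set (c @ b)" using a by (auto simp: b_def in_lists_conv_set)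
      then show "\<exists>j. j < length (c @ b) \<and> (c @ b) ! j = v" by (meson in_set_conv_nth)
    qed
    then obtain k where k: "\<And>v. v \<in> set a \<Longrightarrow> k v < length (c @ b) \<and> (c @ b) ! k v = v" by metis
    have 1: "map (nth (c @ b)) (map k a) = a" using k by (simp add: map_idI)
    have 3: "map (nth (map h (c @ b))) (map k a) = map h (map (nth (c @ b)) (map k a))"
    proof -
      have "map h (c @ b) ! k v = h ((c @ b) ! k v)" if "v \<in> set a" for v
        using k[OF that] by (intro nth_map) simp
      then show ?thesis unfolding map_map map_eq_conv comp_def by blast
    qed
    have hcb: "map h (c @ b) = c' @ map f b" unfolding map_append mb mc ..
    have 2: "map (nth (c' @ map f b)) (map k a) = map h a" using 3 unfolding 1 hcb .
    have "tp0 C (map (nth (c' @ map f b)) (map k a)) = tp0 C (map (nth (c @ b)) (map k a))"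
      by (rule tp0_reindex[OF eq[OF b]]) (use k len in auto)
    then show "tp0 C (map h a) = tp0 C a" unfolding 1 2 .
  qed
  moreover have "map h c = c'" using hc len by (intro nth_equalityI) auto
  ultimately show ?thesis using that hA by blast
qed

text \<open>The parameter tuple is put first and the variables last, as \<open>fms_exists\<close>
  expects. The same \<open>\<psi>\<close> works for all \<open>h\<close>, so it can be compared
  before and after an elementary map is applied.\<close>

lemma fms_reindex:
  assumes "b \<in> lists (set a)" "\<phi> \<in> fms C (n + length b)"
  obtains \<psi> where "\<psi> \<in> fms C (length a + n)" "\<And>h d. length d = n \<Longrightarrow>
    sat C UNIV (nth (map h a @ d)) \<psi> \<longleftrightarrow> sat C UNIV (nth (d @ map h b)) \<phi>"
proof -
  have "\<forall>i<length b. \<exists>j<length a. a ! j = b ! i"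
    using assms(1) unfolding in_lists_conv_set by (metis in_set_conv_nth)
  then obtain k where k: "\<And>i. i < length b \<Longrightarrow> k i < length a \<and> a ! k i = b ! i" by metis
  define \<rho> where "\<rho> i = (if i < n then length a + i else k (i - n))" for i
  have "\<rho> ` fv \<phi> \<subseteq> {..<length a + n}"
  proof
    fix j assume "j \<in> \<rho> ` fv \<phi>"
    then obtain i where i: "i \<in> fv \<phi>" "j = \<rho> i" by blast
    have "i < n + length b" using assms(2) i(1) by (auto simp: fms_def)
    then show "j \<in> {..<length a + n}" using k[of "i - n"] i(2)
      by (cases "i < n") (simp_all add: \<rho>_def trans_less_add1)
  qed
  then have 1: "rename_fm \<rho> \<phi> \<in> fms C (length a + n)"
    using assms(2) fv_rename_fm[of \<rho> \<phi>] by (auto simp: fms_def wf_rename_fm)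
  have "sat C UNIV (nth (map h a @ d) \<circ> \<rho>) \<phi> \<longleftrightarrow> sat C UNIV (nth (d @ map h b)) \<phi>"
    if "length d = n" for h d
  proof (rule sat_cong)
    fix i assume "i \<in> fv \<phi>"
    then have "i < n + length b" using assms(2) by (auto simp: fms_def)
    then show "(nth (map h a @ d) \<circ> \<rho>) i = (d @ map h b) ! i"
      using that k[of "i - n"] by (auto simp: \<rho>_def nth_append)
  qed
  then show ?thesis using that[OF 1] by (simp add: sat_rename)
qed

lemma S_D_realized:
  assumes "p \<in> S_D C D n A" "realizes C c p" "length c = n"
  shows "p = tp C c A"
proof
  show "p \<subseteq> tp C c A"
    using assms by (fastforce simp: S_D_def complete_types_def realizes_def tp_def)
  show "tp C c A \<subseteq> p"
  proof
    fix x assume x: "x \<in> tp C c A"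
    obtain \<phi> a where xa: "x = (\<phi>, a)" by (cases x)
    have pf: "(\<phi>, a) \<in> pfms C n A" and s: "sat C UNIV (nth (c @ a)) \<phi>"
      using x xa assms(3) by (auto simp: tp_def)
    have "(\<phi>, a) \<in> p \<or> (Neg \<phi>, a) \<in> p"
      using assms(1) pf by (auto simp: S_D_def complete_types_def)
    moreover have "(Neg \<phi>, a) \<notin> p" using assms(2) s by (auto simp: realizes_def)
    ultimately show "x \<in> p" using xa by blast
  qed
qed

section \<open>Homogeneity of the monster and extension of elementary maps\<close>

locale tt_monster =
  fixes C :: "('f, 'r, 'a) struct" and D :: "('f, 'r) diag" and \<kappa> :: "'k rel"
  assumes monster: "monster C D \<kappa>" and tt: "totally_transcendental C D"
begin

lemma D_eq: "D k = {tp0 C c | c. length c = k}"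
proof -
  have "diagram C UNIV = D" using monster by (simp add: monster_def homogeneous_def)
  then show ?thesis by (auto simp: diagram_def)
qed

lemma tp0_in_D: "length c = k \<Longrightarrow> tp0 C c \<in> D k"
  by (auto simp: D_eq)

lemma infinite_fm: "infinite (UNIV :: ('f, 'r) fm set)"
proof -
  have "inj (\<lambda>n. Eq (Var n) (Var n) :: ('f, 'r) fm)" by (auto intro: injI)
  then show ?thesis using finite_imageD infinite_UNIV_nat finite_subset[OF subset_UNIV] by blast
qed

lemma Card_order_\<kappa>: "Card_order \<kappa>" and fm_less_\<kappa>: "|UNIV :: ('f, 'r) fm set| <o \<kappa>"
  and D_less_\<kappa>: "|\<Union>k. D k| <o \<kappa>"
  using monster by (auto simp: monster_def)

lemma infinite_\<kappa>: "infinite (Field \<kappa>)"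
proof -
  have "|UNIV :: ('f, 'r) fm set| \<le>o |Field \<kappa>|"
    using fm_less_\<kappa> card_of_Field_ordIso[OF Card_order_\<kappa>]
    by (blast intro: ordLess_imp_ordLeq ordLess_ordIso_trans ordIso_symmetric)
  then show ?thesis using infinite_fm card_of_ordLeq_infinite by blast
qed

lemma small_finite: "finite A \<Longrightarrow> small \<kappa> A"
proof -
  have "Well_order \<kappa>" using Card_order_\<kappa> by (simp add: card_order_on_def)
  moreover assume "finite A"
  then have "finite (Field |A| )" by (simp add: Field_card_of)
  ultimately show ?thesis unfolding small_def
    using finite_ordLess_infinite[OF card_of_Well_order _ _ infinite_\<kappa>] by blast
qed

lemma small_Un: "small \<kappa> A \<Longrightarrow> small \<kappa> B \<Longrightarrow> small \<kappa> (A \<union> B)"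
  unfolding small_def by (rule card_of_Un_ordLess_infinite_Field[OF infinite_\<kappa> Card_order_\<kappa>])

lemma small_subset: "small \<kappa> B \<Longrightarrow> A \<subseteq> B \<Longrightarrow> small \<kappa> A"
  unfolding small_def by (meson card_of_mono1 ordLeq_ordLess_trans)

lemma small_image: "small \<kappa> A \<Longrightarrow> small \<kappa> (f ` A)"
  unfolding small_def by (meson card_of_image ordLeq_ordLess_trans)

lemma tp_in_S_D: "tp C c A \<in> S_D C D (length c) A"
proof -
  have "{\<phi>. (\<phi>, a) \<in> tp C c A} = tp0 C (c @ a)" if "a \<in> lists A" for a
    using that by (auto simp: tp_iff)
  then have "\<forall>a\<in>lists A. {\<phi>. (\<phi>, a) \<in> tp C c A} \<in> D (length c + length a)"
    by (simp add: tp0_in_D)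
  moreover have "tp C c A \<in> complete_types C (length c) A"
    by (auto simp: complete_types_def tp_def realizes_def pfms_def Neg_fms intro!: exI[of _ c])
  ultimately show ?thesis by (simp add: S_D_def)
qed

lemma S_D_tp:
  assumes "p \<in> S_D C D n A" "small \<kappa> A" obtains c where "length c = n" "p = tp C c A"
proof -
  have "homogeneous C D \<kappa> UNIV" using monster by (simp add: monster_def)
  then obtain c where "length c = n" "realizes C c p"
    using assms unfolding homogeneous_def small_def by blast
  then show ?thesis using that S_D_realized[OF assms(1)] by blast
qed

text \<open>The type to be realized is prescribed by the complete types \<open>r a\<close> of
  \<open>c @ a\<close>. Membership in \<open>S_D\<close> then amounts to each \<open>r a\<close>
  lying in \<open>D\<close> and finite parts being satisfied; homogeneity does the rest.\<close>

lemma realize_family: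
  assumes A: "small \<kappa> A" and r: "\<And>a. a \<in> lists A \<Longrightarrow> r a \<in> D (n + length a)"
    and fin: "\<And>q. finite q \<Longrightarrow> q \<subseteq> {(\<phi>, a). a \<in> lists A \<and> \<phi> \<in> r a} \<Longrightarrow>
      \<exists>c. length c = n \<and> realizes C c q"
  obtains c where "length c = n" "\<forall>a\<in>lists A. tp0 C (c @ a) = r a"
proof -
  let ?p = "{(\<phi>, a). a \<in> lists A \<and> \<phi> \<in> r a}"
  have r': "\<exists>d. length d = n + length a \<and> r a = tp0 C d" if "a \<in> lists A" for a
    using r[OF that] by (auto simp: D_eq)
  have sub: "?p \<subseteq> pfms C n A"
  proof
    fix x assume "x \<in> ?p"
    then obtain \<phi> a where x: "x = (\<phi>, a)" "a \<in> lists A" "\<phi> \<in> r a" by blast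
    obtain d where d: "length d = n + length a" "r a = tp0 C d" using r'[OF x(2)] by blast
    have "\<phi> \<in> fms C (n + length a)" using x(3) d by (simp add: tp0_iff)
    then show "x \<in> pfms C n A" using x(1,2) by (simp add: pfms_def lists_eq_set)
  qed
  have compl: "(\<phi>, a) \<in> ?p \<or> (Neg \<phi>, a) \<in> ?p" if pf: "(\<phi>, a) \<in> pfms C n A" for \<phi> a
  proof -
    have a: "a \<in> lists A" and \<phi>: "\<phi> \<in> fms C (n + length a)" using pf by (auto simp: pfms_def)
    obtain d where d: "length d = n + length a" "r a = tp0 C d" using r'[OF a] by blast
    have "\<phi> \<in> r a \<or> Neg \<phi> \<in> r a" using tp0_Neg[of \<phi> C d] d \<phi> by auto
    then show ?thesis using a by blast
  qed
  have p: "?p \<in> S_D C D n A"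
  proof -
    have 1: "?p \<in> complete_types C n A"
      unfolding complete_types_def
    proof (intro CollectI conjI)
      show "\<forall>q. finite q \<and> q \<subseteq> ?p \<longrightarrow> (\<exists>c. length c = n \<and> realizes C c q)" using fin by fast
      show "\<forall>(\<phi>, a)\<in>pfms C n A. (\<phi>, a) \<in> ?p \<or> (Neg \<phi>, a) \<in> ?p" using compl by fast
    qed (rule sub)
    have 2: "{\<phi>. (\<phi>, a) \<in> ?p} = r a" if "a \<in> lists A" for a using that by blast
    have "\<forall>a\<in>lists A. {\<phi>. (\<phi>, a) \<in> ?p} \<in> D (n + length a)"
    proof
      fix a assume a: "a \<in> lists A"
      show "{\<phi>. (\<phi>, a) \<in> ?p} \<in> D (n + length a)" unfolding 2[OF a] by (rule r[OF a])
    qed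
    with 1 show ?thesis unfolding S_D_def by (intro CollectI conjI)
  qed
  obtain c where c: "length c = n" "?p = tp C c A" by (rule S_D_tp[OF p A])
  have "tp0 C (c @ a) = r a" if "a \<in> lists A" for a
  proof (rule set_eqI)
    fix \<phi>
    have "\<phi> \<in> tp0 C (c @ a) \<longleftrightarrow> (\<phi>, a) \<in> tp C c A" using that by (simp add: tp_iff)
    also have "\<dots> \<longleftrightarrow> (\<phi>, a) \<in> ?p" by (simp only: c(2))
    finally show "\<phi> \<in> tp0 C (c @ a) \<longleftrightarrow> \<phi> \<in> r a" using that by blast
  qed
  then show ?thesis using that c(1) by blast
qed

text \<open>A finite part of the type of \<open>c\<close>, moved along \<open>f\<close>, is
  satisfied because an existential formula about its finitely many parameters holds at
  \<open>a\<close> and hence at \<open>map f a\<close>.\<close>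

lemma elem_map_realize:
  assumes f: "elem_map C f A" and A: "small \<kappa> A"
  obtains c' where "\<forall>a\<in>lists A. tp0 C (c' @ map f a) = tp0 C (c @ a)"
proof -
  define g where "g = inv_into A f"
  have gf: "g (f x) = x" if "x \<in> A" for x
    using that elem_map_inj[OF f] by (simp add: g_def)
  have gA: "map g b \<in> lists A" and fg: "map f (map g b) = b" if "b \<in> lists (f ` A)" for b
    using that by (induction b) (auto simp: gf)
  obtain c' where c': "\<forall>b\<in>lists (f ` A). tp0 C (c' @ b) = tp0 C (c @ map g b)"
  proof (rule realize_family[of "f ` A" "\<lambda>b. tp0 C (c @ map g b)" "length c"])
    show "small \<kappa> (f ` A)" by (rule small_image[OF A])
    show "tp0 C (c @ map g b) \<in> D (length c + length b)" for b by (simp add: tp0_in_D)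
    fix q assume q: "finite q" "q \<subseteq> {(\<phi>, b). b \<in> lists (f ` A) \<and> \<phi> \<in> tp0 C (c @ map g b)}"
    have qf: "b \<in> lists (f ` A)" "\<phi> \<in> tp0 C (c @ map g b)" if "(\<phi>, b) \<in> q" for \<phi> b
      using that q(2) by blast+
    define V where "V = (\<Union>(\<phi>, b)\<in>q. set (map g b))"
    have "finite V" unfolding V_def using q(1) by auto
    then obtain a where a: "set a = V" using finite_list by blast
    have "set (map g b) \<subseteq> A" if "(\<phi>, b) \<in> q" for \<phi> b
      using gA[OF qf(1)[OF that]] by (metis in_lists_conv_set subsetI)
    then have "V \<subseteq> A" unfolding V_def by blast
    then have aA: "a \<in> lists A" using a by (simp add: lists_eq_set)
    have ex: "\<exists>\<psi>. \<psi> \<in> fms C (length a + length c) \<and> (\<forall>h d. length d = length c \<longrightarrow>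
        (sat C UNIV (nth (map h a @ d)) \<psi> \<longleftrightarrow> sat C UNIV (nth (d @ map h (map g b))) \<phi>))"
      if "(\<phi>, b) \<in> q" for \<phi> b
    proof -
      have "set (map g b) \<subseteq> set a" using that unfolding a V_def by blast
      then have 1: "map g b \<in> lists (set a)" by (simp add: lists_eq_set)
      have 2: "\<phi> \<in> fms C (length c + length (map g b))" using qf(2)[OF that] by (simp add: tp0_iff)
      show ?thesis by (rule fms_reindex[OF 1 2]) blast
    qed
    define \<Psi> where "\<Psi> x = (SOME \<psi>. \<psi> \<in> fms C (length a + length c) \<and> (\<forall>h d. length d = length c \<longrightarrow>
        (sat C UNIV (nth (map h a @ d)) \<psi> \<longleftrightarrow> sat C UNIV (nth (d @ map h (map g (snd x)))) (fst x))))" for x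
    have \<Psi>: "\<Psi> (\<phi>, b) \<in> fms C (length a + length c)"
      "\<And>h d. length d = length c \<Longrightarrow>
        sat C UNIV (nth (map h a @ d)) (\<Psi> (\<phi>, b)) \<longleftrightarrow> sat C UNIV (nth (d @ map h (map g b))) \<phi>"
      if "(\<phi>, b) \<in> q" for \<phi> b
      using someI_ex[OF ex[OF that]] by (simp_all add: \<Psi>_def)
    obtain \<psi> where \<psi>: "\<psi> \<in> fms C (length a + length c)"
      "\<And>e. sat C UNIV e \<psi> \<longleftrightarrow> (\<forall>\<phi>\<in>\<Psi> ` q. sat C UNIV e \<phi>)"
    proof -
      have "\<Psi> ` q \<subseteq> fms C (length a + length c)" using \<Psi>(1) by fast
      then show ?thesis using fms_conj[of "\<Psi> ` q" C "length a + length c"] q(1) that by blast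
    qed
    obtain \<theta> where \<theta>: "\<theta> \<in> fms C (length a)" "\<And>a'. length a' = length a \<Longrightarrow>
        sat C UNIV (nth a') \<theta> \<longleftrightarrow> (\<exists>d. length d = length c \<and> sat C UNIV (nth (a' @ d)) \<psi>)"
      using fms_exists[OF \<psi>(1)] by blast
    have "sat C UNIV (nth (map id a @ c)) (\<Psi> (\<phi>, b))" if "(\<phi>, b) \<in> q" for \<phi> b
      using \<Psi>(2)[OF that, of c id] qf(2)[OF that] by (simp add: tp0_iff)
    then have "sat C UNIV (nth (a @ c)) \<psi>" using \<psi>(2) by auto
    then have "\<theta> \<in> tp0 C a" using \<theta> by (auto simp: tp0_iff)
    then have "\<theta> \<in> tp0 C (map f a)" using f aA by (simp add: elem_map_def)
    then obtain d where d: "length d = length c" "sat C UNIV (nth (map f a @ d)) \<psi>"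
      using \<theta>(2)[of "map f a"] by (auto simp: tp0_iff)
    have "sat C UNIV (nth (d @ b)) \<phi>" if "(\<phi>, b) \<in> q" for \<phi> b
    proof -
      have "sat C UNIV (nth (map f a @ d)) (\<Psi> (\<phi>, b))" using d(2) \<psi>(2) that by blast
      then show ?thesis using \<Psi>(2)[OF that d(1), of f] fg[OF qf(1)[OF that]] by simp
    qed
    then show "\<exists>c'. length c' = length c \<and> realizes C c' q"
      using d(1) by (auto simp: realizes_def)
  qed blast
  have "tp0 C (c' @ map f a) = tp0 C (c @ a)" if "a \<in> lists A" for a
  proof -
    have 1: "map f a \<in> lists (f ` A)" using that by auto
    have "map g (map f a) = a" using that by (induction a) (auto simp: gf)
    then show ?thesis using bspec[OF c' 1] by simp
  qed
  then show ?thesis using that by blast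
qed

lemma elem_map_extend:
  assumes f: "elem_map C f A" and A: "small \<kappa> A"
  obtains h where "elem_map C h (A \<union> set c)" "\<forall>v\<in>A. h v = f v"
proof -
  obtain c' where c': "\<forall>a\<in>lists A. tp0 C (c' @ map f a) = tp0 C (c @ a)"
    by (rule elem_map_realize[OF assms])
  show ?thesis by (rule elem_map_adjoin[OF bspec[OF c']]) (assumption, rule that)
qed

lemma elem_map_tps:
  assumes "tps_eq C A [x] [y]"
  obtains h where "elem_map C h (A \<union> set x)" "\<forall>v\<in>A. h v = v" "map h x = y"
proof (rule elem_map_adjoin[of A C y id x])
  show "tp0 C (y @ map id a) = tp0 C (x @ a)" if "a \<in> lists A" for a
    using assms that by (simp add: tps_eq_def tp_eq_iff)
qed (use that in auto)

lemma elem_map_tps_eq: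
  assumes "elem_map C h (A \<union> (\<Union>x\<in>set xs. set x))" "\<forall>v\<in>A. h v = v"
  shows "tps_eq C A (map (map h) xs) xs"
proof -
  have "tp0 C (map h (concat xs) @ a) = tp0 C (concat xs @ a)" if "a \<in> lists A" for a
  proof -
    have 1: "map h a = a" using that by (induction a) (auto simp: assms(2))
    have "set (concat xs @ a) \<subseteq> A \<union> (\<Union>x\<in>set xs. set x)"
      using that by (auto simp: lists_eq_set)
    then have "tp0 C (map h (concat xs @ a)) = tp0 C (concat xs @ a)"
      using assms(1) unfolding elem_map_def lists_eq_set by blast
    then show ?thesis using 1 by simp
  qed
  then show ?thesis by (simp add: tps_eq_def tp_eq_iff map_concat)
qed

lemma transport:
  assumes "tps_eq C A [x] [x']" "small \<kappa> A"
  obtains y' where "tps_eq C A [y', x'] [y, x]"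
proof -
  obtain h where h: "elem_map C h (A \<union> set x)" "\<forall>v\<in>A. h v = v" "map h x = x'"
    by (rule elem_map_tps[OF assms(1)])
  obtain k where k: "elem_map C k (A \<union> set x \<union> set y)" "\<forall>v\<in>A \<union> set x. k v = h v"
    by (rule elem_map_extend[OF h(1) small_Un[OF assms(2) small_finite[OF finite_set]], of y])
  have "map k x = map h x" using k(2) by simp
  then have "map k x = x'" using h(3) by (rule trans)
  moreover have "tps_eq C A (map (map k) [y, x]) [y, x]"
    by (rule elem_map_tps_eq) (use k h in \<open>auto simp: Un_ac\<close>)
  ultimately show ?thesis using that[of "map k y"] by simp
qed

end

section \<open>Rank of types of tuples\<close>

lemma rank_ge_antimono: "rank_ge C D n \<alpha> p \<Longrightarrow> p' \<subseteq> p \<Longrightarrow> rank_ge C D n \<alpha> p'"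
proof (induction arbitrary: p' rule: rank_ge.induct)
  case (zero \<alpha> p)
  then have "\<exists>c. length c = n \<and> realizes C c p'" unfolding realizes_def by blast
  with zero(1) show ?case by (rule rank_ge.zero)
next
  case (limit \<delta> p)
  then show ?case by (intro rank_ge.limit) auto
next
  case (succ \<alpha> \<beta> p)
  show ?case
  proof (rule rank_ge.succ[OF succ(1)])
    obtain a \<phi> where *: "\<phi> \<in> fms C (n + length a)"
      "\<And>p'. p' \<subseteq> p \<union> {(\<phi>, a)} \<Longrightarrow> rank_ge C D n \<alpha> p'"
      "\<And>p'. p' \<subseteq> p \<union> {(Neg \<phi>, a)} \<Longrightarrow> rank_ge C D n \<alpha> p'"
      using succ(2) by blast
    have "p' \<union> {(\<phi>, a)} \<subseteq> p \<union> {(\<phi>, a)}" "p' \<union> {(Neg \<phi>, a)} \<subseteq> p \<union> {(Neg \<phi>, a)}"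
      using succ.prems by auto
    then show "\<exists>a. \<exists>\<phi>\<in>fms C (n + length a).
        rank_ge C D n \<alpha> (p' \<union> {(\<phi>, a)}) \<and> rank_ge C D n \<alpha> (p' \<union> {(Neg \<phi>, a)})"
      using * by blast
    show "\<forall>a. \<exists>q\<in>D (n + length a). rank_ge C D n \<alpha> (p' \<union> {(\<phi>, a) |\<phi>. \<phi> \<in> q})"
    proof
      fix a
      obtain q where q: "q \<in> D (n + length a)"
        "\<And>p'. p' \<subseteq> p \<union> {(\<phi>, a) |\<phi>. \<phi> \<in> q} \<Longrightarrow> rank_ge C D n \<alpha> p'"
        using succ(3) by blast
      have "rank_ge C D n \<alpha> (p' \<union> {(\<phi>, a) |\<phi>. \<phi> \<in> q})" by (rule q(2)) (use succ.prems in blast)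
      with q(1) show "\<exists>q\<in>D (n + length a). rank_ge C D n \<alpha> (p' \<union> {(\<phi>, a) |\<phi>. \<phi> \<in> q})" by blast
    qed
  qed
qed

lemma rank_ge_le: "rank_ge C D n \<beta> p \<Longrightarrow> \<alpha> \<le> \<beta> \<Longrightarrow> rank_ge C D n \<alpha> p"
proof (induction \<beta> arbitrary: p rule: less_induct)
  case (less \<beta>)
  show ?case
  proof (cases "\<alpha> = \<beta>")
    case False
    then have \<alpha>: "\<alpha> < \<beta>" using less.prems by simp
    from less.prems(1) show ?thesis
    proof cases
      case zero
      then show ?thesis using \<alpha> leD by blast
    next
      case limit
      then show ?thesis using \<alpha> by blast
    next
      case (succ \<gamma>)
      then obtain a \<phi> where "rank_ge C D n \<gamma> (p \<union> {(\<phi>, a)})" by blast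
      then have "rank_ge C D n \<gamma> p" by (rule rank_ge_antimono) blast
      moreover have "\<gamma> < \<beta>" "\<alpha> \<le> \<gamma>" using succ(1) \<alpha> by (auto simp: ord_succ_def not_less)
      ultimately show ?thesis using less.IH by blast
    qed
  qed (use less.prems in simp)
qed

lemma ord_cases: "(\<forall>\<beta>. \<alpha> \<le> \<beta>) \<or> ord_limit \<alpha> \<or> (\<exists>\<gamma>. ord_succ \<gamma> (\<alpha> :: 'o::wellorder))"
  unfolding ord_limit_def by (meson not_le)

text \<open>The least level that fails cannot be a limit, by the limit clause, so it is the first
  ordinal or a successor. Hence the levels reached, if neither all nor none, have a greatest one, as
  \<open>GREATEST\<close> in \<open>rank_fin\<close> requires.\<close>

lemma rank_ge_values:
  "(\<forall>\<alpha>. rank_ge C D n \<alpha> p) \<or> (\<forall>\<alpha>. \<not> rank_ge C D n \<alpha> p) \<or>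
    (\<exists>\<rho>. \<forall>\<alpha>. rank_ge C D n \<alpha> p \<longleftrightarrow> \<alpha> \<le> \<rho>)"
proof (cases "\<forall>\<alpha>. rank_ge C D n \<alpha> p")
  case False
  define \<beta> where "\<beta> = (LEAST \<beta>. \<not> rank_ge C D n \<beta> p)"
  have \<beta>: "\<not> rank_ge C D n \<beta> p" unfolding \<beta>_def using False by (metis LeastI)
  have lt: "rank_ge C D n \<alpha> p" if "\<alpha> < \<beta>" for \<alpha> using that not_less_Least unfolding \<beta>_def by blast
  have iff: "rank_ge C D n \<alpha> p \<longleftrightarrow> \<alpha> < \<beta>" for \<alpha>
    using \<beta> lt rank_ge_le[of C D n \<alpha> p \<beta>] by (meson not_le)
  consider "\<forall>\<gamma>. \<beta> \<le> \<gamma>" | "ord_limit \<beta>" | \<gamma> where "ord_succ \<gamma> \<beta>" using ord_cases[of \<beta>] by blast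
  then show ?thesis
  proof cases
    case 1
    then show ?thesis using iff by (meson leD)
  next
    case 2
    then show ?thesis using \<beta> lt rank_ge.limit by blast
  next
    case 3
    then have "\<alpha> < \<beta> \<longleftrightarrow> \<alpha> \<le> \<gamma>" for \<alpha> unfolding ord_succ_def by (meson le_less_trans not_le)
    then show ?thesis using iff by blast
  qed
qed simp

lemma rank_fin_ge: "Fin \<alpha> \<le> rank_fin C D n p \<longleftrightarrow> rank_ge C D n \<alpha> p"
proof -
  consider "\<forall>\<alpha>. rank_ge C D n \<alpha> p" | "\<forall>\<alpha>. \<not> rank_ge C D n \<alpha> p"
    | \<rho> where "\<not> (\<forall>\<alpha>. rank_ge C D n \<alpha> p)" "\<forall>\<alpha>. rank_ge C D n \<alpha> p \<longleftrightarrow> \<alpha> \<le> \<rho>"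
    using rank_ge_values[of C D n p] by blast
  then show ?thesis
  proof cases
    case 3
    then have "(GREATEST \<alpha>. rank_ge C D n \<alpha> p) = \<rho>" by (intro Greatest_equality) auto
    then have "rank_fin C D n p = Fin \<rho>" using 3 by (auto simp: rank_fin_def)
    then show ?thesis using 3 by simp
  qed (auto simp: rank_fin_def)
qed

text \<open>At a last ordinal all levels would be reached and the value would be
  \<open>\<infinity>\<close>. The room above provides the successor level used in
  \<open>stat_unique\<close>.\<close>

lemma rank_fin_Fin_bounded:
  assumes "rank_fin C D n p = Fin \<rho>" shows "\<exists>\<beta>. \<rho> < \<beta>"
proof (rule ccontr)
  assume "\<nexists>\<beta>. \<rho> < \<beta>"
  then have "\<forall>\<alpha>. rank_ge C D n \<alpha> p"
    using assms rank_fin_ge[of _ C D n p] by (simp add: not_less)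
  then show False using assms by (simp add: rank_fin_def)
qed

context tt_monster
begin

text \<open>A realized type has no fragment of value \<open>-\<infinity>\<close>, and total
  transcendence excludes \<open>\<infinity>\<close>, so the least value is an ordinal. Every
  fragment over a finite set lies in some \<open>tp C c B\<close>, so testing these is
  enough.\<close>

lemma rank_tp:
  obtains \<rho> where "rank C D (length c) (tp C c A) = Fin \<rho>"
    "\<forall>\<alpha>. \<alpha> \<le> \<rho> \<longleftrightarrow> (\<forall>B. finite B \<and> B \<subseteq> A \<longrightarrow> rank_ge C D (length c) \<alpha> (tp C c B))"
    "\<exists>\<beta>. \<rho> < \<beta>"
proof -
  let ?n = "length c"
  define S where "S r \<longleftrightarrow> (\<exists>B q. finite B \<and> q \<subseteq> restr (tp C c A) B \<and> r = rank_fin C D ?n q)" for r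
  have rank: "rank C D ?n (tp C c A) = (LEAST r. S r)" by (simp add: rank_def S_def)
  have Minf: "r \<noteq> -\<infinity>" if Sr: "S r" for r
  proof -
    from Sr[unfolded S_def] obtain B q where q: "q \<subseteq> restr (tp C c A) B" "r = rank_fin C D ?n q"
      by (elim exE conjE)
    define \<alpha> :: "('f, 'r, 'a) pfm ordinal" where "\<alpha> = (LEAST \<alpha>. True)"
    have "realizes C c q" using q(1) by (auto simp: realizes_def restr_def tp_def)
    then have "rank_ge C D ?n \<alpha> q" by (intro rank_ge.zero) (auto simp: \<alpha>_def Least_le)
    then have "Fin \<alpha> \<le> r" using q(2) rank_fin_ge by blast
    then show ?thesis by auto
  qed
  have "\<exists>\<sigma>. S (Fin \<sigma>)"
  proof (rule ccontr)
    assume no: "\<nexists>\<sigma>. S (Fin \<sigma>)"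
    then have all: "r = \<infinity>" if "S r" for r using that Minf by (cases r) auto
    have "S (rank_fin C D ?n {})" unfolding S_def by blast
    then have "S \<infinity>" using all by metis
    then have "(LEAST r. S r) = \<infinity>" using all by (intro Least_equality) auto
    moreover have "tp C c A \<subseteq> pfms C ?n UNIV" by (auto simp: tp_def pfms_def)
    ultimately have "rank C D ?n (tp C c A) < \<infinity>" using tt unfolding totally_transcendental_def by blast
    then show False using \<open>(LEAST r. S r) = \<infinity>\<close> rank by simp
  qed
  define \<sigma> where "\<sigma> = (LEAST \<sigma>. S (Fin \<sigma>))"
  have \<sigma>: "S (Fin \<sigma>)" "\<And>\<tau>. S (Fin \<tau>) \<Longrightarrow> \<sigma> \<le> \<tau>"
    unfolding \<sigma>_def using \<open>\<exists>\<sigma>. S (Fin \<sigma>)\<close> by (rule LeastI_ex) (rule Least_le)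
  have le: "Fin \<sigma> \<le> r" if "S r" for r using \<sigma>(2) that Minf[OF that] by (cases r) auto
  have "rank C D ?n (tp C c A) = Fin \<sigma>" unfolding rank by (rule Least_equality) (use \<sigma>(1) le in auto)
  moreover have "\<forall>\<alpha>. \<alpha> \<le> \<sigma> \<longleftrightarrow> (\<forall>B. finite B \<and> B \<subseteq> A \<longrightarrow> rank_ge C D ?n \<alpha> (tp C c B))"
  proof (intro allI iffI impI)
    fix \<alpha> B assume \<alpha>: "\<alpha> \<le> \<sigma>" and B: "finite B \<and> B \<subseteq> A"
    have "S (rank_fin C D ?n (tp C c B))"
      unfolding S_def using B restr_tp'[of B A C c] by blast
    then have "Fin \<alpha> \<le> rank_fin C D ?n (tp C c B)" using le \<alpha> by (meson less_eq_extended.simps(1) order_trans)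
    then show "rank_ge C D ?n \<alpha> (tp C c B)" by (simp add: rank_fin_ge)
  next
    fix \<alpha> assume *: "\<forall>B. finite B \<and> B \<subseteq> A \<longrightarrow> rank_ge C D ?n \<alpha> (tp C c B)"
    obtain B q where q: "finite B" "q \<subseteq> restr (tp C c A) B" "Fin \<sigma> = rank_fin C D ?n q"
      using \<sigma>(1)[unfolded S_def] by (elim exE conjE)
    have "rank_ge C D ?n \<alpha> (tp C c (A \<inter> B))" using * q(1) by blast
    then have "rank_ge C D ?n \<alpha> q" by (rule rank_ge_antimono) (use q(2) restr_tp in blast)
    then have "Fin \<alpha> \<le> Fin \<sigma>" using rank_fin_ge q(3) by metis
    then show "\<alpha> \<le> \<sigma>" by simp
  qed
  moreover have "\<exists>\<beta>. \<sigma> < \<beta>"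
  proof -
    obtain q where "Fin \<sigma> = rank_fin C D ?n q" using \<sigma>(1)[unfolded S_def] by (elim exE conjE)
    then show ?thesis using rank_fin_Fin_bounded by metis
  qed
  ultimately show ?thesis using that by blast
qed

definition rk :: "'a list \<Rightarrow> 'a set \<Rightarrow> ('f, 'r, 'a) pfm ordinal" where
  "rk c A = (THE \<rho>. rank C D (length c) (tp C c A) = Fin \<rho>)"

lemma rank_eq_rk: "rank C D (length c) (tp C c A) = Fin (rk c A)"
proof -
  obtain \<rho> where "rank C D (length c) (tp C c A) = Fin \<rho>" by (rule rank_tp)
  then show ?thesis unfolding rk_def by simp
qed

lemma le_rk_iff:
  "\<alpha> \<le> rk c A \<longleftrightarrow> (\<forall>B. finite B \<and> B \<subseteq> A \<longrightarrow> rank_ge C D (length c) \<alpha> (tp C c B))"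
proof -
  obtain \<rho> where "rank C D (length c) (tp C c A) = Fin \<rho>"
    "\<forall>\<alpha>. \<alpha> \<le> \<rho> \<longleftrightarrow> (\<forall>B. finite B \<and> B \<subseteq> A \<longrightarrow> rank_ge C D (length c) \<alpha> (tp C c B))"
    by (rule rank_tp)
  moreover from this have "rk c A = \<rho>" using rank_eq_rk[of c A] by simp
  ultimately show ?thesis by simp
qed

lemma rk_bounded: "\<exists>\<beta>. rk c A < \<beta>"
proof -
  obtain \<rho> where "rank C D (length c) (tp C c A) = Fin \<rho>" "\<exists>\<beta>. \<rho> < \<beta>" by (rule rank_tp)
  then show ?thesis using rank_eq_rk[of c A] by simp
qed

lemma rk_antimono: "A \<subseteq> B \<Longrightarrow> rk c B \<le> rk c A"
  using le_rk_iff[of "rk c B" c B] le_rk_iff[of "rk c B" c A] by (meson order_refl subset_trans)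

lemma le_rk_finite:
  assumes "finite A" shows "\<alpha> \<le> rk c A \<longleftrightarrow> rank_ge C D (length c) \<alpha> (tp C c A)"
proof -
  have "rank_ge C D (length c) \<alpha> (tp C c B)" if "rank_ge C D (length c) \<alpha> (tp C c A)" "B \<subseteq> A" for B
    using that(1) by (rule rank_ge_antimono) (use that(2) tp_subset_iff[of B A c c C] in simp)
  then show ?thesis unfolding le_rk_iff using assms by blast
qed

text \<open>Local character: the ranks over finite subsets form a nonempty set of ordinals, and its
  least element is the rank over \<open>A\<close>.\<close>

lemma rk_base: obtains B where "finite B" "B \<subseteq> A" "rk c B = rk c A"
proof -
  define P where "P \<rho> \<longleftrightarrow> (\<exists>B. finite B \<and> B \<subseteq> A \<and> rk c B = \<rho>)" for \<rho>
  define \<sigma> where "\<sigma> = (LEAST \<rho>. P \<rho>)"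
  have "P (rk c {})" unfolding P_def by blast
  then have "P \<sigma>" unfolding \<sigma>_def by (rule LeastI)
  then obtain B where B: "finite B" "B \<subseteq> A" "rk c B = \<sigma>" unfolding P_def by blast
  have "\<sigma> \<le> rk c A"
    unfolding le_rk_iff
  proof (intro allI impI)
    fix B assume B: "finite B \<and> B \<subseteq> A"
    then have "\<sigma> \<le> rk c B" unfolding \<sigma>_def by (intro Least_le) (auto simp: P_def)
    then show "rank_ge C D (length c) \<sigma> (tp C c B)" using B le_rk_finite by blast
  qed
  moreover have "rk c A \<le> \<sigma>" using rk_antimono[OF B(2), of c] B(3) by simp
  ultimately show ?thesis using that B by auto
qed

lemma rk_base_mono: "rk c B = rk c A \<Longrightarrow> B \<subseteq> B' \<Longrightarrow> B' \<subseteq> A \<Longrightarrow> rk c B' = rk c A"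
  by (metis rk_antimono order_antisym)

lemma rk_tp_cong: "tp C c A = tp C c' A \<Longrightarrow> rk c A = rk c' A"
  unfolding rk_def using tp_eq_length by metis

section \<open>Invariance of the rank under elementary maps\<close>

lemma rank_ge_elem_map:
  assumes "rank_ge C D n \<alpha> p" "elem_map C f A" "finite A" "p \<subseteq> pfms C n A"
  shows "rank_ge C D n \<alpha> ((\<lambda>(\<phi>, a). (\<phi>, map f a)) ` p)"
  using assms
proof (induction arbitrary: f A rule: rank_ge.induct)
  case (zero \<alpha> p)
  then obtain c where c: "length c = n" "realizes C c p" by blast
  obtain c' where c': "\<forall>a\<in>lists A. tp0 C (c' @ map f a) = tp0 C (c @ a)"
    by (rule elem_map_realize[OF zero.prems(1) small_finite[OF zero.prems(2)]])
  have "tp0 C (c' @ map f []) = tp0 C (c @ [])" using c' by blast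
  then have len: "length c' = length c" using tp0_eq_length[of C "c' @ map f []" "c @ []"] by simp
  have "sat C UNIV (nth (c' @ map f a)) \<phi>" if "(\<phi>, a) \<in> p" for \<phi> a
  proof -
    have pf: "a \<in> lists A" "\<phi> \<in> fms C (n + length a)"
      using that zero.prems(3) by (auto simp: pfms_def lists_eq_set)
    have "sat C UNIV (nth (c @ a)) \<phi>" using c(2) that by (auto simp: realizes_def)
    then have "\<phi> \<in> tp0 C (c' @ map f a)" using pf c' c(1) by (simp add: tp0_iff)
    then show ?thesis by (simp add: tp0_iff)
  qed
  then have "realizes C c' ((\<lambda>(\<phi>, a). (\<phi>, map f a)) ` p)" by (auto simp: realizes_def)
  then show ?case using zero(1) len c(1) by (intro rank_ge.zero) auto
next
  case (limit \<delta> p)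
  then show ?case by (intro rank_ge.limit) auto
next
  case (succ \<alpha> \<beta> p)
  let ?F = "\<lambda>f. (\<lambda>(\<phi>, a). (\<phi>, map f a))"
  have agree: "?F h ` p = ?F f ` p" if "\<forall>v\<in>A. h v = f v" for h
  proof (rule image_cong[OF refl])
    fix x assume "x \<in> p"
    moreover obtain \<phi> a where x: "x = (\<phi>, a)" by (cases x)
    ultimately have "set a \<subseteq> A" using succ.prems(3) by (auto simp: pfms_def)
    then show "?F h x = ?F f x" using that x by auto
  qed
  have p_mono: "p \<subseteq> pfms C n (A \<union> B)" for B
    using succ.prems(3) by (auto simp: pfms_def)
  show ?case
  proof (rule rank_ge.succ[OF succ(1)])
    obtain a \<phi> where a: "\<phi> \<in> fms C (n + length a)"
      and IH: "\<And>g B. elem_map C g B \<Longrightarrow> finite B \<Longrightarrow> p \<union> {(\<phi>, a)} \<subseteq> pfms C n B \<Longrightarrow>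
          rank_ge C D n \<alpha> (?F g ` (p \<union> {(\<phi>, a)}))"
        "\<And>g B. elem_map C g B \<Longrightarrow> finite B \<Longrightarrow> p \<union> {(Neg \<phi>, a)} \<subseteq> pfms C n B \<Longrightarrow>
          rank_ge C D n \<alpha> (?F g ` (p \<union> {(Neg \<phi>, a)}))"
      using succ(2) by blast
    obtain h where h: "elem_map C h (A \<union> set a)" "\<forall>v\<in>A. h v = f v"
      by (rule elem_map_extend[OF succ.prems(1) small_finite[OF succ.prems(2)]])
    have "p \<union> {(\<phi>, a)} \<subseteq> pfms C n (A \<union> set a)" "p \<union> {(Neg \<phi>, a)} \<subseteq> pfms C n (A \<union> set a)"
      using p_mono a by (auto simp: pfms_def Neg_fms)
    then have "rank_ge C D n \<alpha> (?F h ` (p \<union> {(\<phi>, a)}))" "rank_ge C D n \<alpha> (?F h ` (p \<union> {(Neg \<phi>, a)}))"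
      using IH h(1) succ.prems(2) by auto
    then have "rank_ge C D n \<alpha> (?F f ` p \<union> {(\<phi>, map h a)})" "rank_ge C D n \<alpha> (?F f ` p \<union> {(Neg \<phi>, map h a)})"
      by (simp_all add: agree[OF h(2)])
    moreover have "\<phi> \<in> fms C (n + length (map h a))" using a by simp
    ultimately show "\<exists>a. \<exists>\<phi>\<in>fms C (n + length a). rank_ge C D n \<alpha> (?F f ` p \<union> {(\<phi>, a)}) \<and>
        rank_ge C D n \<alpha> (?F f ` p \<union> {(Neg \<phi>, a)})" by blast
    show "\<forall>b. \<exists>q\<in>D (n + length b). rank_ge C D n \<alpha> (?F f ` p \<union> {(\<phi>, b) |\<phi>. \<phi> \<in> q})"
    proof
      fix b
      \<comment> \<open>The second clause quantifies over tuples \<open>b\<close> on the target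
        side, so the inverse of \<open>f\<close> is extended to \<open>b\<close> by
        \<open>k\<close>; then \<open>g\<close>, the inverse of \<open>k\<close>, extends
        \<open>f\<close> and takes \<open>map k b\<close> back to \<open>b\<close>.\<close>
      have inv: "elem_map C (inv_into A f) (f ` A)" by (rule elem_map_inv[OF succ.prems(1)])
      obtain k where k: "elem_map C k (f ` A \<union> set b)" "\<forall>v\<in>f ` A. k v = inv_into A f v"
        by (rule elem_map_extend[OF inv small_finite]) (use succ.prems(2) in auto)
      define g where "g = inv_into (f ` A \<union> set b) k"
      have kg: "elem_map C g (k ` (f ` A \<union> set b))" unfolding g_def by (rule elem_map_inv[OF k(1)])
      have gk: "g (k v) = v" if "v \<in> f ` A \<union> set b" for v
        using elem_map_inj[OF k(1)] that by (simp add: g_def)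
      have kf: "k (f v) = v" if "v \<in> A" for v
        using k(2) that elem_map_inj[OF succ.prems(1)] by simp
      have gA: "\<forall>v\<in>A. g v = f v"
      proof
        fix v assume v: "v \<in> A"
        then show "g v = f v" using gk[of "f v"] kf[OF v] by auto
      qed
      have gb: "map g (map k b) = b" using gk by (simp add: map_idI)
      have "k ` f ` A = A" using kf by force
      then have dom: "k ` (f ` A \<union> set b) = A \<union> set (map k b)" by (simp add: image_Un)
      obtain q where q: "q \<in> D (n + length (map k b))"
        and IH: "\<And>g B. elem_map C g B \<Longrightarrow> finite B \<Longrightarrow> p \<union> {(\<phi>, map k b) |\<phi>. \<phi> \<in> q} \<subseteq> pfms C n B \<Longrightarrow>
          rank_ge C D n \<alpha> (?F g ` (p \<union> {(\<phi>, map k b) |\<phi>. \<phi> \<in> q}))"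
        using succ(3) by blast
      have "q \<subseteq> fms C (n + length (map k b))" using q by (auto simp: D_eq tp0_iff)
      then have "p \<union> {(\<phi>, map k b) |\<phi>. \<phi> \<in> q} \<subseteq> pfms C n (A \<union> set (map k b))"
        using p_mono by (auto simp: pfms_def)
      then have "rank_ge C D n \<alpha> (?F g ` (p \<union> {(\<phi>, map k b) |\<phi>. \<phi> \<in> q}))"
        by (intro IH) (use kg dom succ.prems(2) in auto)
      moreover have "?F g ` {(\<phi>, map k b) |\<phi>. \<phi> \<in> q} = {(\<phi>, b) |\<phi>. \<phi> \<in> q}" using gb by force
      ultimately have "rank_ge C D n \<alpha> (?F f ` p \<union> {(\<phi>, b) |\<phi>. \<phi> \<in> q})"
        by (simp add: image_Un agree[OF gA])
      then show "\<exists>q\<in>D (n + length b). rank_ge C D n \<alpha> (?F f ` p \<union> {(\<phi>, b) |\<phi>. \<phi> \<in> q})" using q by auto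
    qed
  qed
qed

text \<open>A finite set on the primed side is pulled back along an elementary map that fixes
  \<open>A\<close> pointwise; injectivity keeps it finite, and \<open>rank_ge\<close> is
  preserved.\<close>

lemma rk_tps_le:
  assumes "tps_eq C A [c, e] [c', e']"
  shows "rk c (A \<union> set e) \<le> rk c' (A \<union> set e')"
  unfolding le_rk_iff[of "rk c (A \<union> set e)" c']
proof (intro allI impI)
  have t: "tps_eq C A [c @ e] [c' @ e']" and len: "length c = length c'" "length e = length e'"
    using assms by (auto simp: tps_eq_def)
  obtain h where h: "elem_map C h (A \<union> set (c @ e))" "\<forall>v\<in>A. h v = v" "map h (c @ e) = c' @ e'"
    by (rule elem_map_tps[OF t])
  have hc: "map h c = c'" "map h e = e'" using h(3) len by simp_all
  fix B' assume B': "finite B' \<and> B' \<subseteq> A \<union> set e'"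
  define B where "B = (A \<union> set e) \<inter> h -` B'"
  have "h ` set e = set e'" using hc(2) by (metis set_map)
  moreover have "h ` A = A" using h(2) by simp
  ultimately have "h ` (A \<union> set e) = A \<union> set e'" by (simp only: image_Un)
  moreover have "h ` B = h ` (A \<union> set e) \<inter> B'" unfolding B_def by auto
  ultimately have hB: "h ` B = B'" using B' by (simp add: Int_absorb1)
  have "inj_on h B" using elem_map_inj[OF h(1)] by (rule inj_on_subset) (auto simp: B_def)
  then have fB: "finite B" using hB B' finite_image_iff by metis
  have "rank_ge C D (length c) (rk c (A \<union> set e)) (tp C c B)"
    using le_rk_iff[of "rk c (A \<union> set e)" c "A \<union> set e"] fB unfolding B_def by blast
  then have "rank_ge C D (length c) (rk c (A \<union> set e)) ((\<lambda>(\<phi>, a). (\<phi>, map h a)) ` tp C c B)"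
  proof (rule rank_ge_elem_map[of _ _ _ _ B])
    show "elem_map C h B" by (rule elem_map_subset[OF h(1)]) (auto simp: B_def)
  qed (use fB in \<open>auto simp: tp_def\<close>)
  then show "rank_ge C D (length c') (rk c (A \<union> set e)) (tp C c' B')"
    unfolding len(1)
  proof (rule rank_ge_antimono)
    show "tp C c' B' \<subseteq> (\<lambda>(\<phi>, a). (\<phi>, map h a)) ` tp C c B"
    proof
      fix x assume x: "x \<in> tp C c' B'"
      obtain \<phi> b where xb: "x = (\<phi>, b)" by (cases x)
      have b: "b \<in> lists B'" "\<phi> \<in> tp0 C (c' @ b)" using x by (auto simp: xb tp_iff)
      then obtain a where a: "a \<in> lists B" "map h a = b"
        unfolding hB[symmetric] lists_image by blast
      have "set (c @ a) \<subseteq> A \<union> set (c @ e)" using a(1) by (auto simp: B_def lists_eq_set)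
      then have "tp0 C (map h (c @ a)) = tp0 C (c @ a)"
        using h(1) unfolding elem_map_def lists_eq_set by blast
      then have "\<phi> \<in> tp0 C (c @ a)" using b(2) a(2) hc(1) by simp
      then have "(\<phi>, a) \<in> tp C c B" using a(1) by (simp add: tp_iff)
      then show "x \<in> (\<lambda>(\<phi>, a). (\<phi>, map h a)) ` tp C c B" using a(2) xb by force
    qed
  qed
qed

lemma rk_tps:
  assumes "tps_eq C A [c, e] [c', e']"
  shows "rk c (A \<union> set e) = rk c' (A \<union> set e')"
  using rk_tps_le[OF assms] rk_tps_le[OF tps_eq_sym[OF assms]] by (rule order_antisym)

section \<open>Stationary types over finite sets\<close>

text \<open>If \<open>stat c B\<close>, then the second clause in the definition of \<open>R \<ge> \<alpha> + 1\<close> holds with \<open>\<alpha>\<close> the rank of \<open>c\<close>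
  over \<open>B\<close>, so the first one fails, which makes the extensions of rank \<open>\<alpha>\<close> unique.\<close>

definition stat :: "'a list \<Rightarrow> 'a set \<Rightarrow> bool" where
  "stat c B \<longleftrightarrow> finite B \<and> (\<forall>e. \<exists>c'. tp C c' B = tp C c B \<and> rk c B \<le> rk c' (B \<union> set e))"

lemma stat_unique:
  assumes c: "stat c B" and 1: "tp C c1 B = tp C c B" "rk c B \<le> rk c1 (B \<union> A)"
    and 2: "tp C c2 B = tp C c B" "rk c B \<le> rk c2 (B \<union> A)"
  shows "tp C c1 (B \<union> A) = tp C c2 (B \<union> A)"
proof (rule ccontr)
  assume "tp C c1 (B \<union> A) \<noteq> tp C c2 (B \<union> A)"
  then obtain a where a: "a \<in> lists (B \<union> A)" "tp0 C (c1 @ a) \<noteq> tp0 C (c2 @ a)" unfolding tp_eq_iff by blast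
  have len: "length c1 = length c" "length c2 = length c" using 1 2 tp_eq_length by blast+
  obtain \<phi> where \<phi>: "\<phi> \<in> tp0 C (c1 @ a)" "\<phi> \<notin> tp0 C (c2 @ a)"
    using a(2) tp0_subset_eq[of C "c1 @ a" "c2 @ a"] len by auto
  have f: "\<phi> \<in> fms C (length c + length a)" using \<phi>(1) len by (simp add: tp0_iff)
  have n: "Neg \<phi> \<in> tp0 C (c2 @ a)" using \<phi>(2) f len tp0_Neg[of \<phi> C "c2 @ a"] by simp
  have B: "finite B" using c by (simp add: stat_def)
  let ?\<alpha> = "rk c B"
  \<comment> \<open>The level just above the rank of \<open>c\<close>. The separating formula gives
    the first clause of the successor step and \<open>stat\<close> the second, so \<open>c\<close>
    would reach it.\<close>
  define \<beta> where "\<beta> = (LEAST \<beta>. ?\<alpha> < \<beta>)"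
  have \<beta>: "?\<alpha> < \<beta>" unfolding \<beta>_def using rk_bounded[of c B] by (metis LeastI)
  have succ: "ord_succ ?\<alpha> \<beta>"
    unfolding ord_succ_def using \<beta> not_less_Least unfolding \<beta>_def by blast
  have big: "rank_ge C D (length c) ?\<alpha> (tp C c B \<union> q)"
    if "tp C d B = tp C c B" "?\<alpha> \<le> rk d (B \<union> set e)" "q \<subseteq> tp C d (B \<union> set e)" for d e q
  proof -
    have "length d = length c" by (rule tp_eq_length[OF that(1)])
    then have "rank_ge C D (length c) ?\<alpha> (tp C d (B \<union> set e))"
      using that(2) B le_rk_finite[of "B \<union> set e" ?\<alpha> d] by simp
    then show ?thesis
    proof (rule rank_ge_antimono)
      have "tp C d B \<subseteq> tp C d (B \<union> set e)" using tp_subset_iff[of B "B \<union> set e" d d C] by simp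
      then show "tp C c B \<union> q \<subseteq> tp C d (B \<union> set e)" using that by simp
    qed
  qed
  have aBA: "B \<union> set a \<subseteq> B \<union> A" using a(1) by (auto simp: lists_eq_set)
  have al: "a \<in> lists (B \<union> set a)" by (auto simp: lists_eq_set)
  have "rank_ge C D (length c) \<beta> (tp C c B)"
  proof (rule rank_ge.succ[OF succ])
    have "rank_ge C D (length c) ?\<alpha> (tp C c B \<union> {(\<phi>, a)})"
      by (rule big[OF 1(1) order_trans[OF 1(2) rk_antimono[OF aBA]]]) (use \<phi> al in \<open>simp add: tp_iff\<close>)
    moreover have "rank_ge C D (length c) ?\<alpha> (tp C c B \<union> {(Neg \<phi>, a)})"
      by (rule big[OF 2(1) order_trans[OF 2(2) rk_antimono[OF aBA]]]) (use n al in \<open>simp add: tp_iff\<close>)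
    ultimately show "\<exists>a. \<exists>\<phi>\<in>fms C (length c + length a). rank_ge C D (length c) ?\<alpha> (tp C c B \<union> {(\<phi>, a)}) \<and>
        rank_ge C D (length c) ?\<alpha> (tp C c B \<union> {(Neg \<phi>, a)})" using f by blast
    show "\<forall>e. \<exists>q\<in>D (length c + length e). rank_ge C D (length c) ?\<alpha> (tp C c B \<union> {(\<phi>, e) |\<phi>. \<phi> \<in> q})"
    proof
      fix e
      obtain d where d: "tp C d B = tp C c B" "?\<alpha> \<le> rk d (B \<union> set e)" using c by (auto simp: stat_def)
      have "e \<in> lists (B \<union> set e)" by (auto simp: lists_eq_set)
      then have "{(\<phi>, e) |\<phi>. \<phi> \<in> tp0 C (d @ e)} \<subseteq> tp C d (B \<union> set e)" by (auto simp: tp_iff)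
      from big[OF d this] have "rank_ge C D (length c) ?\<alpha> (tp C c B \<union> {(\<phi>, e) |\<phi>. \<phi> \<in> tp0 C (d @ e)})" .
      moreover have "tp0 C (d @ e) \<in> D (length c + length e)" using tp_eq_length[OF d(1)] by (simp add: tp0_in_D)
      ultimately show "\<exists>q\<in>D (length c + length e). rank_ge C D (length c) ?\<alpha> (tp C c B \<union> {(\<phi>, e) |\<phi>. \<phi> \<in> q})"
        by blast
    qed
  qed
  then have "\<beta> \<le> ?\<alpha>" using le_rk_finite[OF B] by blast
  then show False using \<beta> by simp
qed

text \<open>The extensions \<open>T a\<close> over single finite tuples are coherent by uniqueness,
  so they glue to one type over \<open>B \<union> A\<close>, whose finite parts are each satisfied
  by a single \<open>T b\<close>.\<close>

lemma stat_free_ext: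
  assumes c: "stat c B" and A: "small \<kappa> A"
  obtains c' where "tp C c' B = tp C c B" "rk c' (B \<union> A) = rk c B"
proof -
  have B: "finite B" using c by (simp add: stat_def)
  define T where "T a = (SOME c'. tp C c' B = tp C c B \<and> rk c B \<le> rk c' (B \<union> set a))" for a
  have T: "tp C (T a) B = tp C c B \<and> rk c B \<le> rk (T a) (B \<union> set a)" for a
    unfolding T_def by (rule someI_ex) (use c in \<open>auto simp: stat_def\<close>)
  have len: "length (T a) = length c" for a using T tp_eq_length by blast
  have coh: "tp0 C (T b @ a) = tp0 C (T a @ a)" if "set a \<subseteq> set b" for a b
  proof -
    have "B \<union> set a \<subseteq> B \<union> set b" using that by blast
    then have "rk c B \<le> rk (T b) (B \<union> set a)" using T[of b] rk_antimono order_trans by blast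
    then have "tp C (T b) (B \<union> set a) = tp C (T a) (B \<union> set a)" using stat_unique[OF c] T by blast
    moreover have "a \<in> lists (B \<union> set a)" by (auto simp: lists_eq_set)
    ultimately show ?thesis unfolding tp_eq_iff by blast
  qed
  obtain c' where c': "length c' = length c" "\<forall>a\<in>lists (B \<union> A). tp0 C (c' @ a) = tp0 C (T a @ a)"
  proof (rule realize_family[of "B \<union> A" "\<lambda>a. tp0 C (T a @ a)" "length c"])
    show "small \<kappa> (B \<union> A)" using A B by (simp add: small_Un small_finite)
    show "tp0 C (T a @ a) \<in> D (length c + length a)" for a by (simp add: tp0_in_D len)
    fix q assume q: "finite q" "q \<subseteq> {(\<phi>, a). a \<in> lists (B \<union> A) \<and> \<phi> \<in> tp0 C (T a @ a)}"
    have "finite (\<Union>x\<in>q. set (snd x))" using q(1) by auto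
    from finite_list[OF this] obtain b where b: "set b = (\<Union>x\<in>q. set (snd x))" ..
    have "sat C UNIV (nth (T b @ a)) \<phi>" if "(\<phi>, a) \<in> q" for \<phi> a
    proof -
      have "set a \<subseteq> set b" unfolding b using that by force
      moreover have "\<phi> \<in> tp0 C (T a @ a)" using subsetD[OF q(2) that] by simp
      ultimately have "\<phi> \<in> tp0 C (T b @ a)" using coh[of a b] by simp
      then show ?thesis by (simp add: tp0_iff)
    qed
    then show "\<exists>d. length d = length c \<and> realizes C d q"
      using len[of b] by (auto simp: realizes_def)
  qed blast
  have tpb: "tp C c' (set b) = tp C (T b) (set b)" if "set b \<subseteq> B \<union> A" for b
    unfolding tp_eq_iff
  proof
    fix a assume a: "a \<in> lists (set b)"
    then have "a \<in> lists (B \<union> A)" "set a \<subseteq> set b" using that by (auto simp: lists_eq_set)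
    then show "tp0 C (c' @ a) = tp0 C (T b @ a)" using c'(2) coh by metis
  qed
  obtain b where b: "set b = B" using B finite_list by blast
  have 1: "tp C c' B = tp C c B" using tpb[of b] b T[of b] by simp
  obtain F where F: "finite F" "F \<subseteq> B \<union> A" "rk c' F = rk c' (B \<union> A)" by (rule rk_base)
  obtain d where d: "set d = B \<union> F" using finite_list F(1) B by (metis finite_Un)
  have "rk c B \<le> rk (T d) (B \<union> set d)" using T by blast
  also have "\<dots> = rk c' (set d)" using rk_tp_cong[OF tpb[of d]] d F(2) by (simp add: Un_absorb1)
  also have "\<dots> \<le> rk c' F" using d by (intro rk_antimono) blast
  finally have "rk c B \<le> rk c' (B \<union> A)" using F(3) by simp
  moreover have "rk c' (B \<union> A) \<le> rk c B"
    using rk_antimono[of B "B \<union> A" c'] rk_tp_cong[OF 1] by simp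
  ultimately show ?thesis using that 1 by simp
qed

end

lemma minimal_witness:
  fixes f :: "'x \<Rightarrow> 'o::wellorder"
  assumes "P x" obtains z where "P z" "\<forall>y. P y \<longrightarrow> f z \<le> f y"
proof -
  define v where "v = (LEAST v. \<exists>z. P z \<and> f z = v)"
  have "\<exists>z. P z \<and> f z = v" unfolding v_def by (rule LeastI[of _ "f x"]) (use assms in blast)
  moreover have "v \<le> f y" if "P y" for y unfolding v_def by (rule Least_le) (use that in blast)
  ultimately show ?thesis using that by blast
qed

lemma tps_eq_append:
  "tps_eq C A (x # y # zs) (x' # y' # zs') \<Longrightarrow> tps_eq C A ((x @ y) # zs) ((x' @ y') # zs')"
  by (simp add: tps_eq_def)

text \<open>Cutting the first block into singletons reduces this to the choice of blocks in
  \<open>tps_eq_reindex\<close>.\<close>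

lemma tps_eq_sublist:
  assumes "tps_eq C A (c # xs) (c' # xs')" "set is \<subseteq> {..<length c}"
  shows "tps_eq C A (map (nth c) is # xs) (map (nth c') is # xs')"
proof -
  let ?s = "map (\<lambda>v. [v])"
  have conc: "concat (?s ys @ zs) = ys @ concat zs" for ys :: "'c list" and zs by (induction ys) auto
  have len: "length c = length c'" "length xs = length xs'"
    using assms(1) by (auto simp: tps_eq_def dest: map_eq_imp_length_eq)
  have "map length (?s c @ xs) = map length (?s c' @ xs')"
    using assms(1) len by (simp add: tps_eq_def comp_def map_replicate_const)
  then have t: "tps_eq C A (?s c @ xs) (?s c' @ xs')"
    using assms(1) conc[of c xs] conc[of c' xs'] unfolding tps_eq_def by simp
  let ?js = "is @ [length c..<length c + length xs]"
  have r: "map (nth (?s d @ ys)) ?js = ?s (map (nth d) is) @ ys"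
    if "length d = length c" "length ys = length xs" for d ys
  proof -
    have "map (nth (?s d @ ys)) is = ?s (map (nth d) is)"
      using assms(2) that by (auto simp: nth_append)
    moreover have "map (nth (?s d @ ys)) [length c..<length c + length xs] = ys"
      using that by (intro nth_equalityI) (auto simp: nth_append)
    ultimately show ?thesis by simp
  qed
  have "tps_eq C A (map (nth (?s c @ xs)) ?js) (map (nth (?s c' @ xs')) ?js)"
    by (rule tps_eq_reindex[OF t]) (use assms(2) in auto)
  then have "tps_eq C A (?s (map (nth c) is) @ xs) (?s (map (nth c') is) @ xs')"
    unfolding r[OF refl refl] r[OF len(1)[symmetric] len(2)[symmetric]] .
  then show ?thesis
    using conc[of "map (nth c) is" xs] conc[of "map (nth c') is" xs'] assms(1)
    unfolding tps_eq_def by simp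
qed

context tt_monster
begin

abbreviation hom_model :: "'a set \<Rightarrow> bool" where
  "hom_model M \<equiv> aleph0_homogeneous C D M"

lemma hom_realize:
  assumes "hom_model M" "finite B" "B \<subseteq> M"
  obtains x' where "x' \<in> lists M" "tps_eq C B [x'] [x]"
proof -
  have "|B| <o natLeq" using assms(2) finite_iff_ordLess_natLeq by blast
  then obtain x' where x': "x' \<in> lists M" "length x' = length x" "realizes C x' (tp C x B)"
    using assms tp_in_S_D[of x B] unfolding homogeneous_def by blast
  then have "tp C x B = tp C x' B" using S_D_realized[OF tp_in_S_D] by metis
  then show ?thesis using that x' by (simp add: tps_eq_def)
qed

lemma rk_tps1: "tps_eq C A [c] [c'] \<Longrightarrow> rk c A = rk c' A"
  by (rule rk_tp_cong) (simp add: tps_eq_def)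

lemma rk_base_over:
  obtains B where "finite B" "B \<subseteq> M" "rk c (B \<union> X) = rk c (M \<union> X)"
proof -
  obtain F where F: "finite F" "F \<subseteq> M \<union> X" "rk c F = rk c (M \<union> X)" by (rule rk_base)
  have "rk c ((F \<inter> M) \<union> X) = rk c (M \<union> X)" by (rule rk_base_mono[OF F(3)]) (use F(2) in auto)
  then show ?thesis using that[of "F \<inter> M"] F(1) by simp
qed

lemma rk_base_over_mono:
  "rk c (B \<union> X) = rk c (M \<union> X) \<Longrightarrow> B \<subseteq> B' \<Longrightarrow> B' \<subseteq> M \<Longrightarrow> rk c (B' \<union> X) = rk c (M \<union> X)"
  by (rule rk_base_mono) (assumption | blast)+

text \<open>Each \<open>e\<close> may be replaced by a copy over \<open>B\<close> that does not
  lower the rank of \<open>c\<close>: transport along the copy moves \<open>(c, e')\<close> to a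
  pair \<open>(c', e)\<close>, and \<open>c'\<close> is the required extension.\<close>

lemma statI:
  assumes B: "finite B"
    and copies: "\<And>e. \<exists>e'. tps_eq C B [e'] [e] \<and> rk c B \<le> rk c (B \<union> set e')"
  shows "stat c B"
  unfolding stat_def
proof (intro conjI allI)
  fix e
  obtain e' where e': "tps_eq C B [e'] [e]" "rk c B \<le> rk c (B \<union> set e')" using copies by blast
  obtain c' where c': "tps_eq C B [c', e] [c, e']" by (rule transport[OF e'(1) small_finite[OF B]])
  have "tp C c' B = tp C c B" using tps_eq_reindex[OF c', of "[0]"] by (simp add: tps_eq_def)
  then show "\<exists>c'. tp C c' B = tp C c B \<and> rk c B \<le> rk c' (B \<union> set e)"
    using rk_tps[OF c'] e'(2) by auto
qed (rule B)

text \<open>Every \<open>e\<close> has a copy inside the model, and over the model \<open>c\<close>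
  keeps its rank over \<open>B\<close>.\<close>

lemma stat_hom:
  assumes M: "hom_model M" and B: "finite B" "B \<subseteq> M" "rk c B = rk c M"
  shows "stat c B"
proof (rule statI[OF B(1)])
  fix e
  obtain e' where e': "e' \<in> lists M" "tps_eq C B [e'] [e]" by (rule hom_realize[OF M B(1,2)])
  have "rk c M \<le> rk c (B \<union> set e')" using B(2) e'(1) by (intro rk_antimono) (auto simp: lists_eq_set)
  then show "\<exists>e'. tps_eq C B [e'] [e] \<and> rk c B \<le> rk c (B \<union> set e')" using B(3) e'(2) by auto
qed

lemma stat_pair:
  assumes c: "stat c B" and c12: "tps_eq C B [c1] [c]" "tps_eq C B [c2] [c]"
    and x: "tps_eq C B [x1] [x2]"
    and rk: "rk c B \<le> rk c1 (B \<union> set x1)" "rk c B \<le> rk c2 (B \<union> set x2)"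
  shows "tps_eq C B [c1, x1] [c2, x2]"
proof -
  have "finite B" using c by (simp add: stat_def)
  then obtain d where d: "tps_eq C B [d, x2] [c1, x1]" by (metis transport[OF x] small_finite)
  have "tps_eq C B [d] [c1]" using tps_eq_reindex[OF d, of "[0]"] by simp
  then have t: "tp C d B = tp C c B" "tp C c2 B = tp C c B" using c12 by (simp_all add: tps_eq_def)
  have "tp C d (B \<union> set x2) = tp C c2 (B \<union> set x2)"
    by (rule stat_unique[OF c t(1) _ t(2) rk(2)]) (use rk(1) rk_tps[OF d] in simp)
  then have "tps_eq C (B \<union> set x2) [d] [c2]" using t tp_eq_length by (auto simp: tps_eq_def)
  from tps_eq_unset[OF this] have "tps_eq C B [d, x2] [c2, x2]" by simp
  then show ?thesis using tps_eq_trans[OF tps_eq_sym[OF d]] by blast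
qed

section \<open>Independence over homogeneous models\<close>

text \<open>Only the rank of the whole tuple is compared, whereas \<open>indep\<close> asks this of
  every tuple from a set; \<open>ind_sub\<close> closes the gap.\<close>

definition ind :: "'a set \<Rightarrow> 'a list \<Rightarrow> 'a set \<Rightarrow> bool" where
  "ind M c X \<longleftrightarrow> rk c (M \<union> X) = rk c M"

lemma ind_mono: "ind M c X \<Longrightarrow> Y \<subseteq> M \<union> X \<Longrightarrow> ind M c Y"
  unfolding ind_def by (metis Un_subset_iff order_antisym rk_antimono sup_ge1)

lemma not_ind: "\<not> ind M c X \<longleftrightarrow> rk c (M \<union> X) < rk c M"
  unfolding ind_def using rk_antimono[of M "M \<union> X" c] by auto

text \<open>Nonsplitting: the free extension of the type of \<open>c\<close> over \<open>B\<close>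
  is unique, so the type of \<open>x\<close> over \<open>B\<close> determines that of
  \<open>c @ x\<close>.\<close>

lemma ind_nonsplit:
  assumes M: "hom_model M" and c: "ind M c X" and B: "finite B" "B \<subseteq> M" "rk c B = rk c M"
    and x: "x \<in> lists (M \<union> X)" "y \<in> lists (M \<union> X)" "tps_eq C B [x] [y]"
  shows "tps_eq C B [c, x] [c, y]"
proof (rule stat_pair[OF stat_hom[OF M B] tps_eq_refl tps_eq_refl x(3)])
  have "rk c B = rk c (M \<union> X)" using c B by (simp add: ind_def)
  then show "rk c B \<le> rk c (B \<union> set x)" "rk c B \<le> rk c (B \<union> set y)"
    using B(2) x by (auto intro!: rk_antimono simp: lists_eq_set)
qed

text \<open>Converse of \<open>ind_nonsplit\<close>: the finitely many points of
  \<open>M \<union> X\<close> that determine the rank are reflected to a tuple of \<open>M\<close>,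
  where the rank cannot drop. The criterion speaks of types alone and so applies to tuples whose
  ranks have no evident relation.\<close>

lemma indI:
  assumes M: "hom_model M" and B: "finite B" "B \<subseteq> M"
    and *: "\<And>x y. x \<in> lists (M \<union> X) \<Longrightarrow> y \<in> lists M \<Longrightarrow> tps_eq C B [x] [y] \<Longrightarrow>
      tps_eq C B [c, x] [c, y]"
  shows "ind M c X"
proof -
  obtain F where F: "finite F" "F \<subseteq> M \<union> X" "rk c F = rk c (M \<union> X)" by (rule rk_base)
  from finite_list[OF F(1)] obtain x where x: "set x = F" ..
  obtain y where y: "y \<in> lists M" "tps_eq C B [y] [x]" by (rule hom_realize[OF M B])
  have "x \<in> lists (M \<union> X)" using x F(2) by (simp add: lists_eq_set)
  from *[OF this y(1) tps_eq_sym[OF y(2)]]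
  have "rk c (B \<union> set x) = rk c (B \<union> set y)" by (rule rk_tps)
  moreover have "rk c M \<le> rk c (B \<union> set y)" using B(2) y(1) by (intro rk_antimono) (auto simp: lists_eq_set)
  moreover have "rk c (B \<union> set x) \<le> rk c F" using x by (intro rk_antimono) simp
  moreover have "rk c (M \<union> X) \<le> rk c M" by (intro rk_antimono) simp
  ultimately show ?thesis unfolding ind_def using F(3) by simp
qed

lemma ind_Nil: assumes "hom_model M" shows "ind M [] X"
  by (rule indI[OF assms, of "{}"]) (simp_all add: tps_eq_def)

lemma ind_sub:
  assumes M: "hom_model M" and c: "ind M c X" and d: "set d \<subseteq> set c"
  shows "ind M d X"
proof -
  obtain B where B: "finite B" "B \<subseteq> M" "rk c B = rk c M" by (rule rk_base)
  have "\<forall>v\<in>set d. \<exists>i<length c. c ! i = v" using d by (metis in_set_conv_nth subsetD)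
  then obtain k where k: "\<forall>v\<in>set d. k v < length c \<and> c ! k v = v" by metis
  have md: "map (nth c) (map k d) = d" using k by (simp add: map_idI)
  show ?thesis
  proof (rule indI[OF M B(1,2)])
    fix x y assume xy: "x \<in> lists (M \<union> X)" "y \<in> lists M" "tps_eq C B [x] [y]"
    have "y \<in> lists (M \<union> X)" using xy(2) by (auto simp: lists_eq_set)
    then have "tps_eq C B [c, x] [c, y]" using ind_nonsplit[OF M c B xy(1) _ xy(3)] by blast
    from tps_eq_sublist[OF this, of "map k d"] show "tps_eq C B [d, x] [d, y]"
      using k unfolding md by auto
  qed
qed

text \<open>Nonsplitting is applied twice, in place of additivity of the rank: \<open>u\<close> is
  replaced by \<open>v\<close> next to \<open>y\<close>, then \<open>y @ u\<close> by
  \<open>y @ v\<close> next to \<open>z\<close>.\<close>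

lemma ind_pair:
  assumes M: "hom_model M" and y: "ind M y X" and z: "ind M z (X \<union> set y)"
  shows "ind M (z @ y) X"
proof -
  obtain By where By: "finite By" "By \<subseteq> M" "rk y By = rk y M" by (rule rk_base)
  obtain Bz where Bz: "finite Bz" "Bz \<subseteq> M" "rk z Bz = rk z M" by (rule rk_base)
  define B where "B = By \<union> Bz"
  have B: "finite B" "B \<subseteq> M" "rk y B = rk y M" "rk z B = rk z M"
    using By Bz by (auto simp: B_def intro: rk_base_mono)
  show ?thesis
  proof (rule indI[OF M B(1,2)])
    fix u v assume uv: "u \<in> lists (M \<union> X)" "v \<in> lists M" "tps_eq C B [u] [v]"
    have v: "v \<in> lists (M \<union> X)" using uv(2) by (auto simp: lists_eq_set)
    have "tps_eq C B [y, u] [y, v]" by (rule ind_nonsplit[OF M y B(1,2,3) uv(1) v uv(3)])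
    then have "tps_eq C B [y @ u] [y @ v]" by (rule tps_eq_append)
    moreover have "y @ u \<in> lists (M \<union> (X \<union> set y))" "y @ v \<in> lists (M \<union> (X \<union> set y))"
      using uv(1) v by (auto simp: lists_eq_set)
    ultimately have "tps_eq C B [z, y @ u] [z, y @ v]" using ind_nonsplit[OF M z B(1,2,4)] by blast
    then show "tps_eq C B [z @ y, u] [z @ y, v]" by (simp add: tps_eq_def)
  qed
qed

lemma ind_unique:
  assumes M: "hom_model M" and c: "tps_eq C M [c] [d]" "ind M c X" "ind M d X"
  shows "tps_eq C (M \<union> X) [c] [d]"
proof -
  obtain B where B: "finite B" "B \<subseteq> M" "rk c B = rk c M" by (rule rk_base)
  have "tps_eq C B [c] [d]" by (rule tps_eq_mono[OF c(1) B(2)])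
  then have t: "tp C d B = tp C c B" by (simp add: tps_eq_def)
  have BM: "B \<union> (M \<union> X) = M \<union> X" using B(2) by blast
  have "rk c B = rk c (M \<union> X)" "rk c B = rk d (M \<union> X)"
    using c B(3) rk_tps1[OF c(1)] by (simp_all add: ind_def)
  then have "tp C c (M \<union> X) = tp C d (M \<union> X)"
    using stat_unique[OF stat_hom[OF M B], of c "M \<union> X" d] t BM by simp
  then show ?thesis using c(1) by (simp add: tps_eq_def)
qed

lemma hom_free_ext:
  assumes M: "hom_model M" "small \<kappa> M" and A: "small \<kappa> A"
  obtains c' where "tps_eq C M [c'] [c]" "ind M c' A"
proof -
  obtain B where B: "finite B" "B \<subseteq> M" "rk c B = rk c M" by (rule rk_base)
  obtain d where d: "tp C d B = tp C c B" "rk d (B \<union> (M \<union> A)) = rk c B"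
    by (rule stat_free_ext[OF stat_hom[OF M(1) B] small_Un[OF M(2) A]])
  have BM: "B \<union> (M \<union> A) = M \<union> A" "B \<union> M = M" using B(2) by blast+
  have le: "rk c B \<le> rk d M" using rk_antimono[of M "M \<union> A" d] d(2) BM by simp
  have "tp C d (B \<union> M) = tp C c (B \<union> M)"
    by (rule stat_unique[OF stat_hom[OF M(1) B]]) (use d(1) le B(3) BM in simp_all)
  then have t: "tps_eq C M [d] [c]" using tp_eq_length[OF d(1)] BM by (simp add: tps_eq_def)
  have "ind M d A" using d(2) BM rk_tps1[OF t] B(3) by (simp add: ind_def)
  then show ?thesis using that t by blast
qed

text \<open>Choose the rank of \<open>e' @ z\<close> over \<open>M\<close> minimal.  If \<open>X\<close> were independent from \<open>z\<close> but not from \<open>e' @ z\<close>, then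
  reflecting the relevant part of \<open>X\<close> into \<open>M\<close> would produce a copy of smaller rank.\<close>

lemma dominated_copy:
  assumes M: "hom_model M" and B: "finite B" "B \<subseteq> M"
  obtains e' where "tps_eq C B [e', z] [e, z]" "\<forall>X. ind M z X \<longrightarrow> ind M (e' @ z) X"
proof -
  let ?P = "\<lambda>e'. tps_eq C B [e', z] [e, z]"
  obtain e' where e': "?P e'" and min: "\<forall>d. ?P d \<longrightarrow> rk (e' @ z) M \<le> rk (d @ z) M"
    by (rule minimal_witness[of ?P e "\<lambda>d. rk (d @ z) M"]) (rule tps_eq_refl)
  have "ind M (e' @ z) X" if z: "ind M z X" for X
  proof (rule ccontr)
    assume "\<not> ind M (e' @ z) X"
    then have lt: "rk (e' @ z) (M \<union> X) < rk (e' @ z) M" by (simp add: not_ind)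
    obtain F where F: "finite F" "F \<subseteq> M \<union> X" "rk (e' @ z) F = rk (e' @ z) (M \<union> X)" by (rule rk_base)
    from finite_list[OF F(1)] obtain x where x: "set x = F" ..
    have xl: "x \<in> lists (M \<union> X)" using x F(2) by (simp add: lists_eq_set)
    obtain Bz where Bz: "finite Bz" "Bz \<subseteq> M" "rk z Bz = rk z M" by (rule rk_base)
    \<comment> \<open>Enlarging \<open>B\<close> by a base of \<open>z\<close> gives
      \<open>(z, x)\<close> and \<open>(z, y)\<close> the same type over \<open>B'\<close>, so that
      \<open>y\<close> in \<open>M\<close> can play the role of \<open>x\<close>.\<close>
    define B' where "B' = B \<union> Bz"
    have B': "finite B'" "B' \<subseteq> M" "rk z B' = rk z M" "B \<subseteq> B'"
      using B Bz by (auto simp: B'_def intro: rk_base_mono)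
    obtain y where y: "y \<in> lists M" "tps_eq C B' [y] [x]" by (rule hom_realize[OF M B'(1,2)])
    have yl: "y \<in> lists (M \<union> X)" using y(1) by (auto simp: lists_eq_set)
    have "tps_eq C B' [z, x] [z, y]" by (rule ind_nonsplit[OF M z B'(1,2,3) xl yl tps_eq_sym[OF y(2)]])
    from tps_eq_append[OF this] have "tps_eq C B' [z @ x] [z @ y]" .
    \<comment> \<open>\<open>d\<close> stands to \<open>y\<close> as \<open>e'\<close> stands to
      \<open>x\<close>. Since \<open>y\<close> is in \<open>M\<close>, the drop of rank caused by
      \<open>x\<close> already occurs over \<open>M\<close>.\<close>
    then obtain d where d: "tps_eq C B' [d, z @ y] [e', z @ x]"
      by (rule transport[OF _ small_finite[OF B'(1)]])
    have d3: "tps_eq C B' [d, z, y] [e', z, x]" using d by (auto simp: tps_eq_def)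
    have "tps_eq C B' [d, z] [e', z]" using tps_eq_reindex[OF d3, of "[0, 1]"] by simp
    then have "?P d" using tps_eq_mono[OF _ B'(4)] e' tps_eq_trans by blast
    then have "rk (e' @ z) M \<le> rk (d @ z) M" using min by blast
    also have "\<dots> \<le> rk (d @ z) (B' \<union> set y)" using B'(2) y(1) by (intro rk_antimono) (auto simp: lists_eq_set)
    also have "\<dots> = rk (e' @ z) (B' \<union> set x)" by (rule rk_tps[OF tps_eq_append[OF d3]])
    also have "\<dots> \<le> rk (e' @ z) F" using x by (intro rk_antimono) simp
    finally show False using lt F(3) by simp
  qed
  then show ?thesis using that e' by blast
qed


text \<open>Suppose that \<open>a\<close> is independent from \<open>b\<close> but not conversely; put \<open>g = a @ b\<close>, and let
  \<open>g\<^sub>u\<close>, \<open>g\<^sub>t\<close> continue \<open>g\<close> to a Morley sequence over \<open>M\<close>, so that the pair \<open>(a\<^sub>i, b\<^sub>j)\<close> distinguishes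
  \<open>i \<ge> j\<close> from \<open>i < j\<close>.  Among the \<open>z\<close> independent from \<open>g\<close> choose one minimizing the rank of \<open>b\<close> over
  \<open>M \<union> z\<close>.  By dominated copies the type of \<open>b\<close> over \<open>z\<close> is stationary, but it is also realized
  by \<open>b\<^sub>t\<close>, and both \<open>b\<close> and \<open>b\<^sub>t\<close> keep their rank over \<open>g\<^sub>u\<close>, although \<open>a\<^sub>u\<close> distinguishes them.\<close>

lemma ind_sym:
  assumes M: "hom_model M" "small \<kappa> M" and ab: "ind M a (set b)"
  shows "ind M b (set a)"
proof (rule ccontr)
  assume "\<not> ind M b (set a)"
  then have N: "rk b (M \<union> set a) < rk b M" by (simp add: not_ind)
  define g where "g = a @ b"
  let ?K = "\<lambda>z. ind M z (set g)"
  obtain z0 where z0: "?K z0" and min0: "\<forall>z. ?K z \<longrightarrow> rk b (M \<union> set z0) \<le> rk b (M \<union> set z)"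
    by (rule minimal_witness[of ?K "[]" "\<lambda>z. rk b (M \<union> set z)"]) (rule ind_Nil[OF M(1)])
  define \<beta> where "\<beta> = rk b (M \<union> set z0)"
  obtain gu where gu: "tps_eq C M [gu] [g]" "ind M gu (set g)"
    by (rule hom_free_ext[OF M small_finite[OF finite_set]])
  obtain gt where gt: "tps_eq C M [gt] [g]" "ind M gt (set (g @ gu))"
    by (rule hom_free_ext[OF M small_finite[OF finite_set]])
  obtain z where z: "tps_eq C M [z] [z0]" "ind M z (set (g @ gu @ gt))"
    by (rule hom_free_ext[OF M small_finite[OF finite_set]])
  have zg: "?K z" by (rule ind_mono[OF z(2)]) auto
  have "tps_eq C (M \<union> set g) [z] [z0]" by (rule ind_unique[OF M(1) z(1) zg z0])
  from tps_eq_unset[OF this] have "tps_eq C M [z, a @ b] [z0, a @ b]" by (simp add: g_def)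
  then have "tps_eq C M [z, a, b] [z0, a, b]" by (simp add: tps_eq_def)
  from tps_eq_reindex[OF this, of "[2, 0]"] have "tps_eq C M [b, z] [b, z0]" by simp
  then have z\<beta>: "rk b (M \<union> set z) = \<beta>" unfolding \<beta>_def by (rule rk_tps)
  have min: "\<beta> \<le> rk b (M \<union> set y)" if "?K y" for y using min0 that by (simp add: \<beta>_def)
  obtain B1 where B1: "finite B1" "B1 \<subseteq> M" "rk z B1 = rk z M" by (rule rk_base)
  obtain B2 where B2: "finite B2" "B2 \<subseteq> M" "rk g B2 = rk g M" by (rule rk_base)
  obtain B3 where B3: "finite B3" "B3 \<subseteq> M" "rk a B3 = rk a M" by (rule rk_base)
  obtain B4 where B4: "finite B4" "B4 \<subseteq> M" "rk b (B4 \<union> set z) = rk b (M \<union> set z)" by (rule rk_base_over)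
  obtain B5 where B5: "finite B5" "B5 \<subseteq> M" "rk b (B5 \<union> set a) = rk b (M \<union> set a)" by (rule rk_base_over)
  define B where "B = B1 \<union> B2 \<union> B3 \<union> B4 \<union> B5"
  have B: "finite B" "B \<subseteq> M" using B1 B2 B3 B4 B5 by (auto simp: B_def)
  have Bz: "rk z B = rk z M" by (rule rk_base_mono[OF B1(3)]) (use B in \<open>auto simp: B_def\<close>)
  have Bg: "rk g B = rk g M" by (rule rk_base_mono[OF B2(3)]) (use B in \<open>auto simp: B_def\<close>)
  have Ba: "rk a B = rk a M" by (rule rk_base_mono[OF B3(3)]) (use B in \<open>auto simp: B_def\<close>)
  have Bbz: "rk b (B \<union> set z) = \<beta>" unfolding z\<beta>[symmetric]
    by (rule rk_base_over_mono[OF B4(3)]) (use B in \<open>auto simp: B_def\<close>)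
  have Bba: "rk b (B \<union> set a) = rk b (M \<union> set a)"
    by (rule rk_base_over_mono[OF B5(3)]) (use B in \<open>auto simp: B_def\<close>)
  have Bgu: "rk gu B = rk gu M" and Bgt: "rk gt B = rk gt M"
    using Bg rk_tps1[OF gu(1)] rk_tps1[OF gt(1)]
      rk_tps1[OF tps_eq_mono[OF gu(1) B(2)]] rk_tps1[OF tps_eq_mono[OF gt(1) B(2)]] by simp_all
  have st: "stat b (B \<union> set z)"
  proof (rule statI)
    show "finite (B \<union> set z)" using B by simp
    fix e
    obtain e' where e': "tps_eq C B [e', z] [e, z]" "\<forall>X. ind M z X \<longrightarrow> ind M (e' @ z) X"
      by (rule dominated_copy[OF M(1) B])
    have "\<beta> \<le> rk b (M \<union> set (e' @ z))" by (rule min) (use e'(2) zg in blast)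
    also have "\<dots> \<le> rk b (B \<union> set z \<union> set e')" using B(2) by (intro rk_antimono) auto
    finally have le: "\<beta> \<le> rk b (B \<union> set z \<union> set e')" .
    then show "\<exists>e'. tps_eq C (B \<union> set z) [e'] [e] \<and> rk b (B \<union> set z) \<le> rk b (B \<union> set z \<union> set e')"
      using tps_eq_set[OF e'(1)] Bbz by auto
  qed
  \<comment> \<open>\<open>z @ gu\<close> belongs to the family again, so by minimality
    \<open>b\<close> keeps its rank when \<open>gu\<close> is adjoined to \<open>z\<close>.\<close>
  have "ind M (z @ gu) (set g)"
    by (rule ind_pair[OF M(1) gu(2)]) (rule ind_mono[OF z(2)], auto)
  then have "\<beta> \<le> rk b (M \<union> set (z @ gu))" by (rule min)
  also have "\<dots> \<le> rk b (B \<union> set z \<union> set gu)" using B(2) by (intro rk_antimono) auto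
  finally have big1: "\<beta> \<le> rk b (B \<union> set z \<union> set gu)" .
  have lens: "length gu = length a + length b" "length gt = length a + length b"
    using gu(1) gt(1) by (auto simp: tps_eq_def g_def)
  define au bu at bt where "au = take (length a) gu" and "bu = drop (length a) gu"
    and "at = take (length a) gt" and "bt = drop (length a) gt"
  have gsplit: "gu = au @ bu" "gt = at @ bt" and l: "length au = length a" "length bu = length b"
      "length at = length a" "length bt = length b"
    by (simp_all add: au_def bu_def at_def bt_def lens)
  \<comment> \<open>The copy \<open>gv\<close> of \<open>gu\<close> lies in \<open>M\<close>, over
    which \<open>gt\<close> and \<open>g\<close> have the same type; hence \<open>(gt, gu)\<close>
    and \<open>(g, gv)\<close> agree over \<open>B\<close>, also next to \<open>z\<close>. As
    \<open>gv\<close> is in \<open>M\<close>, this shows that \<open>bt\<close> keeps its rank over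
    \<open>z\<close> and \<open>gu\<close>.\<close>
  obtain gv where gv: "gv \<in> lists M" "tps_eq C B [gv] [gu]" by (rule hom_realize[OF M(1) B])
  have lv: "length gv = length a + length b" using gv(2) lens by (simp add: tps_eq_def)
  define av bv where "av = take (length a) gv" and "bv = drop (length a) gv"
  have gvs: "gv = av @ bv" and lv': "length av = length a" "length bv = length b"
    by (simp_all add: av_def bv_def lv)
  have listsI: "x \<in> lists (M \<union> X)" if "set x \<subseteq> M \<union> X" for x X using that by (auto simp: lists_eq_set)
  have setv: "set gv \<subseteq> M" using gv(1) by (auto simp: lists_eq_set)
  have t1: "tps_eq C B [gt, gv] [gt, gu]"
    by (rule ind_nonsplit[OF M(1) gt(2) B Bgt _ _ gv(2)]) (use setv in \<open>auto intro!: listsI\<close>)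
  have over_gv: "tps_eq C B [y, gv] [g, gv]" if "tps_eq C M [y] [g]" for y
  proof -
    have "tps_eq C (B \<union> set gv) [y] [g]" by (rule tps_eq_mono[OF that]) (use B(2) setv in auto)
    from tps_eq_unset[OF this] show ?thesis by simp
  qed
  have t2: "tps_eq C B [gt, gv] [g, gv]" by (rule over_gv[OF gt(1)])
  have z1: "tps_eq C B [z, gt @ gv] [z, gt @ gu]"
    by (rule ind_nonsplit[OF M(1) z(2) B Bz _ _ tps_eq_append[OF t1]])
      (use setv in \<open>auto intro!: listsI\<close>)
  have z2: "tps_eq C B [z, gt @ gv] [z, g @ gv]"
    by (rule ind_nonsplit[OF M(1) z(2) B Bz _ _ tps_eq_append[OF t2]])
      (use setv in \<open>auto intro!: listsI\<close>)
  have "tps_eq C B [z, gt @ gu] [z, g @ gv]" by (rule tps_eq_trans[OF tps_eq_sym[OF z1] z2])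
  then have t3: "tps_eq C B [z, at, bt, au, bu] [z, a, b, av, bv]"
    unfolding gsplit gvs g_def using l lv' by (simp add: tps_eq_def)
  have "tps_eq C B [bt, z, au, bu] [b, z, av, bv]"
    using tps_eq_reindex[OF t3, of "[2, 0, 3, 4]"] by simp
  then have "tps_eq C B [bt, z @ gu] [b, z @ gv]" by (simp add: tps_eq_def gsplit gvs)
  then have "rk bt (B \<union> set (z @ gu)) = rk b (B \<union> set (z @ gv))" by (rule rk_tps)
  also have "\<dots> \<ge> rk b (M \<union> set z)" using B(2) setv by (intro rk_antimono) auto
  finally have big2: "\<beta> \<le> rk bt (B \<union> set z \<union> set gu)" using z\<beta> by (simp add: Un_assoc)
  have "tps_eq C B [z, gt] [z, g]"
    by (rule ind_nonsplit[OF M(1) z(2) B Bz _ _ tps_eq_mono[OF gt(1) B(2)]]) (auto intro!: listsI)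
  then have "tps_eq C B [z, at, bt] [z, a, b]" unfolding gsplit g_def using l by (simp add: tps_eq_def)
  from tps_eq_reindex[OF this, of "[2, 0]"] have "tps_eq C B [bt, z] [b, z]" by simp
  from tps_eq_set[OF this] have "tp C bt (B \<union> set z) = tp C b (B \<union> set z)" by (simp add: tps_eq_def)
  then have "tp C b (B \<union> set z \<union> set gu) = tp C bt (B \<union> set z \<union> set gu)"
    using stat_unique[OF st refl _ _ ] big1 big2 Bbz by metis
  then have "tp C b (B \<union> set au) = tp C bt (B \<union> set au)"
    by (rule tp_mono_eq) (auto simp: gsplit)
  then have eq: "rk b (B \<union> set au) = rk bt (B \<union> set au)" by (rule rk_tp_cong)
  have "tps_eq C B [bt, au] [b, av]" using tps_eq_reindex[OF t3, of "[2, 3]"] by simp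
  then have "rk bt (B \<union> set au) = rk b (B \<union> set av)" by (rule rk_tps)
  also have "\<dots> \<ge> rk b M" using B(2) setv by (intro rk_antimono) (auto simp: gvs)
  finally have ge: "rk b M \<le> rk b (B \<union> set au)" using eq by simp
  \<comment> \<open>Now \<open>g\<close> is reflected into \<open>M\<close>, which gives
    \<open>(gu, g)\<close> the type of \<open>(g, gs)\<close> and \<open>(b, au)\<close> that of
    \<open>(bs, a)\<close>. Independence of \<open>a\<close> from \<open>b\<close> replaces
    \<open>bs\<close> by \<open>b\<close>, so \<open>au\<close> lowers the rank of \<open>b\<close>
    exactly as \<open>a\<close> does.\<close>
  obtain gs where gs: "gs \<in> lists M" "tps_eq C B [gs] [g]" by (rule hom_realize[OF M(1) B])
  define as bs where "as = take (length a) gs" and "bs = drop (length a) gs"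
  have "length gs = length a + length b" using gs(2) by (simp add: tps_eq_def g_def)
  then have gss: "gs = as @ bs" and ls: "length as = length a" "length bs = length b"
    by (simp_all add: as_def bs_def)
  have sets: "set gs \<subseteq> M" using gs(1) by (auto simp: lists_eq_set)
  have u1: "tps_eq C B [gu, g] [gu, gs]"
    by (rule ind_nonsplit[OF M(1) gu(2) B Bgu _ _ tps_eq_sym[OF gs(2)]]) (use sets in \<open>auto intro!: listsI\<close>)
  have "tps_eq C (B \<union> set gs) [gu] [g]" by (rule tps_eq_mono[OF gu(1)]) (use B(2) sets in auto)
  from tps_eq_unset[OF this] have "tps_eq C B [gu, gs] [g, gs]" by simp
  from tps_eq_trans[OF u1 this] have "tps_eq C B [au, bu, a, b] [a, b, as, bs]"
    unfolding gsplit gss g_def using l ls by (simp add: tps_eq_def)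
  from tps_eq_reindex[OF this, of "[3, 0]"] have u2: "tps_eq C B [b, au] [bs, a]" by simp
  have "tps_eq C B [as, bs] [a, b]" using gs(2) ls unfolding gss g_def by (simp add: tps_eq_def)
  from tps_eq_reindex[OF this, of "[1]"] have bs: "tps_eq C B [bs] [b]" by simp
  have "tps_eq C B [a, bs] [a, b]"
    by (rule ind_nonsplit[OF M(1) ab B Ba _ _ bs]) (use sets in \<open>auto intro!: listsI simp: gss\<close>)
  from tps_eq_reindex[OF this, of "[1, 0]"] have "tps_eq C B [bs, a] [b, a]" by simp
  from tps_eq_trans[OF u2 this] have "rk b (B \<union> set au) = rk b (B \<union> set a)" by (rule rk_tps)
  then show False using ge N Bba by simp
qed

section \<open>Existence of homogeneous models\<close>

lemma card_lists_le:
  assumes Z: "infinite Z" and X: "|X| \<le>o |Z|" shows "|lists X| \<le>o |Z|"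
proof -
  let ?L = "\<lambda>n. {xs \<in> lists X. length xs = n}"
  have fin: "infinite (Field |Z| )" using Z by (simp add: Field_card_of)
  have "|?L n| \<le>o |Z|" for n
  proof (induction n)
    case 0
    have "finite (?L 0)" by simp
    then have "|?L 0| \<le>o |Z|" using Z
      by (meson card_of_Well_order card_of_ordLeq_finite ordLeq_total)
    then show ?case .
  next
    case (Suc n)
    have "|X \<times> ?L n| \<le>o |Z|"
      by (rule card_of_Times_ordLeq_infinite_Field[OF fin X Suc card_of_Card_order])
    moreover have "?L (Suc n) \<subseteq> (\<lambda>(x, xs). x # xs) ` (X \<times> ?L n)"
      by (force simp: length_Suc_conv)
    then have "|?L (Suc n)| \<le>o |X \<times> ?L n|" by (rule surj_imp_ordLeq)
    ultimately show ?case by (rule ordLeq_transitive[rotated])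
  qed
  moreover have "|UNIV :: nat set| \<le>o |Z|" using Z by (simp add: infinite_iff_card_of_nat)
  ultimately have "|\<Union>n. ?L n| \<le>o |Z|"
    by (intro card_of_UNION_ordLeq_infinite[OF Z]) auto
  moreover have "(\<Union>n. ?L n) = lists X" by auto
  ultimately show ?thesis by simp
qed

text \<open>Realizing types of tuples over tuples gives all clauses at once: a function value is
  determined by its type over the arguments, the Tarski-Vaught test asks for one realization,
  \<open>e = []\<close> yields the diagram, and types over finite sets are first realized in the
  monster.\<close>

lemma hom_modelI:
  assumes closed: "\<And>e c. e \<in> lists M \<Longrightarrow> \<exists>c'\<in>lists M. tp0 C (c' @ e) = tp0 C (c @ e)"
  shows "hom_model M"
proof -
  have closed1: "\<exists>v'\<in>M. tp0 C (v' # e) = tp0 C (v # e)" if e: "e \<in> lists M" for e v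
  proof -
    obtain c' where c': "c' \<in> lists M" "tp0 C (c' @ e) = tp0 C ([v] @ e)" using closed[OF e] by blast
    then have "length c' = 1" using tp0_eq_length[OF c'(2)] by simp
    then obtain v' where "c' = [v']" by (auto simp: length_Suc_conv)
    then show ?thesis using c' by auto
  qed
  have ne: "M \<noteq> {}" using closed1[of "[]"] by auto
  have fun_closed: "fint C f xs \<in> M" if xs: "length xs = farity C f" "set xs \<subseteq> M" for f xs
  proof -
    let ?\<phi> = "Eq (Var 0) (Fn f (map Var [1..<Suc (length xs)]))"
    have val: "map (\<lambda>i. (v # xs) ! i) [1..<Suc (length xs)] = xs" for v
      by (intro nth_equalityI) (auto simp del: upt_Suc)
    have s: "sat C UNIV (nth (v # xs)) ?\<phi> \<longleftrightarrow> v = fint C f xs" for v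
      using val[of v] by (simp add: comp_def del: upt_Suc)
    have "?\<phi> \<in> fms C (length (v # xs))" for v using xs(1) by (auto simp: fms_def)
    then have "?\<phi> \<in> tp0 C (v # xs) \<longleftrightarrow> v = fint C f xs" for v unfolding tp0_iff using s by blast
    moreover have "xs \<in> lists M" using xs(2) by (auto simp: lists_eq_set)
    ultimately show ?thesis using closed1[of xs "fint C f xs"] by metis
  qed
  have tv: "sat C M e \<phi> \<longleftrightarrow> sat C UNIV e \<phi>" if "wf_fm C \<phi>" "range e \<subseteq> M" for \<phi> e
    using that
  proof (induction \<phi> arbitrary: e)
    case (Ex i \<phi>)
    have IH: "sat C M (e(i := v)) \<phi> \<longleftrightarrow> sat C UNIV (e(i := v)) \<phi>" if "v \<in> M" for v
      by (rule Ex.IH) (use Ex.prems that in auto)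
    have "\<exists>v'\<in>M. sat C UNIV (e(i := v')) \<phi>" if v: "sat C UNIV (e(i := v)) \<phi>" for v
    proof -
      \<comment> \<open>Only the values of \<open>e\<close> below \<open>k\<close> matter. They are
        listed as \<open>es\<close>, and \<open>\<rho>\<close> moves the quantified variable to
        position 0 and the others up by one.\<close>
      define k where "k = Suc (Max (insert 0 (fv \<phi>)))"
      have k: "j < k" if "j \<in> fv \<phi>" for j
        using that finite_fv[of \<phi>] by (simp add: k_def less_Suc_eq_le)
      define es where "es = map e [0..<k]"
      define \<rho> where "\<rho> j = (if j = i then 0 else Suc j)" for j
      have r: "sat C UNIV (nth (w # es)) (rename_fm \<rho> \<phi>) \<longleftrightarrow> sat C UNIV (e(i := w)) \<phi>" for w
        unfolding sat_rename by (rule sat_cong) (use k in \<open>auto simp: \<rho>_def es_def\<close>)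
      have "\<rho> ` fv \<phi> \<subseteq> {..<Suc k}" using k by (auto simp: \<rho>_def)
      then have "rename_fm \<rho> \<phi> \<in> fms C (length (w # es))" for w
        using Ex.prems(1) fv_rename_fm[of \<rho> \<phi>] by (auto simp: fms_def wf_rename_fm es_def)
      then have r': "rename_fm \<rho> \<phi> \<in> tp0 C (w # es) \<longleftrightarrow> sat C UNIV (e(i := w)) \<phi>" for w
        unfolding tp0_iff using r by blast
      have "es \<in> lists M" using Ex.prems(2) by (auto simp: es_def lists_eq_set)
      then show ?thesis using closed1[of es v] r' v by metis
    qed
    then show ?case using IH by auto
  qed auto
  have diag: "diagram C M = D"
  proof
    fix k
    have "\<exists>c'. tp0 C c' = tp0 C c \<and> length c' = length c \<and> set c' \<subseteq> M" for c
    proof -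
      obtain c' where c': "c' \<in> lists M" "tp0 C c' = tp0 C c" using closed[of "[]" c] by auto
      then show ?thesis using tp0_eq_length[OF c'(2)] by (intro exI[of _ c']) (auto simp: lists_eq_set)
    qed
    then show "diagram C M k = D k" unfolding D_eq diagram_def by blast
  qed
  have real: "\<exists>c\<in>lists M. length c = n \<and> realizes C c p"
    if p: "p \<in> S_D C D n A" "A \<subseteq> M" "finite A" for p n A
  proof -
    obtain c where c: "length c = n" "p = tp C c A" by (rule S_D_tp[OF p(1) small_finite[OF p(3)]])
    from finite_list[OF p(3)] obtain e where e: "set e = A" ..
    have el: "e \<in> lists M" using e p(2) by (simp add: lists_eq_set)
    obtain c' where c': "c' \<in> lists M" "tp0 C (c' @ e) = tp0 C (c @ e)" using closed[OF el] by blast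
    have len: "length c' = length c" using tp0_eq_length[OF c'(2)] by simp
    have "tps_eq C {} [c', e] [c, e]" using c' len by (simp add: tps_eq_def tp_empty)
    from tps_eq_set[OF this] have "tp C c' A = p" using c e by (simp add: tps_eq_def)
    moreover have "realizes C c' (tp C c' A)" by (auto simp: realizes_def tp_def)
    ultimately show ?thesis using c' len c(1) by auto
  qed
  show ?thesis
    unfolding homogeneous_def elem_sub_def
    using ne fun_closed tv diag real by (auto simp: finite_iff_ordLess_natLeq)
qed

lemma hom_model_exists:
  assumes A: "small \<kappa> A"
  obtains M where "hom_model M" "small \<kappa> M" "A \<subseteq> M"
proof -
  \<comment> \<open>A set of size below \<open>\<kappa>\<close> that bounds \<open>A\<close> and the
    number of types and is infinite through its formulas; every stage of the construction has at
    most its cardinality.\<close>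
  define Z where "Z = (A <+> (UNIV :: ('f, 'r) fm set)) <+> (\<Union>k. D k)"
  have "|A| <o \<kappa>" using A by (simp add: small_def)
  then have Z_less: "|Z| <o \<kappa>" unfolding Z_def
    by (intro card_of_Plus_ordLess_infinite_Field[OF infinite_\<kappa> Card_order_\<kappa>] fm_less_\<kappa> D_less_\<kappa>)
  have Zinf: "infinite Z" unfolding Z_def using infinite_fm by auto
  have AZ: "|A| \<le>o |Z|" unfolding Z_def by (meson card_of_Plus1 ordLeq_transitive)
  have DZ: "|\<Union>k. D k| \<le>o |Z|" unfolding Z_def by (rule card_of_Plus2)
  have fZ: "infinite (Field |Z| )" using Zinf by (simp add: Field_card_of)
  \<comment> \<open>If no tuple has the type \<open>q\<close> together with \<open>e\<close>, the
    choice is arbitrary; it still adds only finitely many points.\<close>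
  define pick where "pick q e = (SOME c. tp0 C (c @ e) = q)" for q e
  define step where "step X = X \<union> (\<Union>x\<in>(\<Union>k. D k) \<times> lists X. set (pick (fst x) (snd x)))" for X
  define S where "S n = (step ^^ n) A" for n
  have fin: "|F| \<le>o |Z|" if "finite F" for F :: "'a set"
    using Zinf that by (meson card_of_Well_order card_of_ordLeq_finite ordLeq_total)
  have SZ: "|S n| \<le>o |Z|" for n
  proof (induction n)
    case (Suc n)
    have "|(\<Union>k. D k) \<times> lists (S n)| \<le>o |Z|"
      by (rule card_of_Times_ordLeq_infinite_Field[OF fZ DZ card_lists_le[OF Zinf Suc] card_of_Card_order])
    then have "|\<Union>x\<in>(\<Union>k. D k) \<times> lists (S n). set (pick (fst x) (snd x))| \<le>o |Z|"
      by (rule card_of_UNION_ordLeq_infinite[OF Zinf]) (simp add: fin)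
    then have "|step (S n)| \<le>o |Z|" unfolding step_def
      by (rule card_of_Un_ordLeq_infinite_Field[OF fZ Suc _ card_of_Card_order])
    then show ?case by (simp add: S_def)
  qed (simp add: S_def AZ)
  define M where "M = (\<Union>n. S n)"
  have "|M| \<le>o |Z|" unfolding M_def
    by (rule card_of_UNION_ordLeq_infinite[OF Zinf]) (use SZ Zinf infinite_iff_card_of_nat in auto)
  then have "small \<kappa> M" unfolding small_def using Z_less by (rule ordLeq_ordLess_trans)
  moreover have "A \<subseteq> M" unfolding M_def using UN_upper[of 0 UNIV S] by (simp add: S_def)
  moreover have "hom_model M"
  proof (rule hom_modelI)
    fix e c assume e: "e \<in> lists M"
    have mono: "S n \<subseteq> S (n + k)" for n k
      by (induction k) (auto simp: S_def step_def)
    have "\<exists>n. set e \<subseteq> S n" using e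
    proof (induction e)
      case (Cons v e)
      then obtain n m where "set e \<subseteq> S n" "v \<in> S m" by (auto simp: M_def)
      then have "set (v # e) \<subseteq> S (n + m)" using mono[of n m] mono[of m n] by (auto simp: add.commute)
      then show ?case by blast
    qed simp
    then obtain n where n: "set e \<subseteq> S n" ..
    define q where "q = tp0 C (c @ e)"
    have p: "tp0 C (pick q e @ e) = q" unfolding pick_def by (rule someI[of _ c]) (simp add: q_def)
    have "q \<in> (\<Union>k. D k)" unfolding q_def using tp0_in_D[OF refl] by blast
    moreover have "e \<in> lists (S n)" using n by (simp add: lists_eq_set)
    ultimately have "(q, e) \<in> (\<Union>k. D k) \<times> lists (S n)" by blast
    then have "set (pick q e) \<subseteq> step (S n)" unfolding step_def by fastforce
    then have "set (pick q e) \<subseteq> S (Suc n)" by (simp add: S_def)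
    then have "pick q e \<in> lists M" unfolding M_def lists_eq_set by blast
    then show "\<exists>c'\<in>lists M. tp0 C (c' @ e) = tp0 C (c @ e)" using p q_def by blast
  qed
  ultimately show ?thesis using that by blast
qed


section \<open>Transfer between models\<close>

lemma hom_realize_list:
  assumes M: "hom_model M" and e: "e' \<in> lists M" "tps_eq C {} [e'] [e]"
  obtains x' where "x' \<in> lists M" "tps_eq C {} [x', e'] [x, e]"
proof -
  obtain y where y: "tps_eq C {} [y, e'] [x, e]"
    by (rule transport[OF tps_eq_sym[OF e(2)] small_finite]) auto
  obtain x' where x': "x' \<in> lists M" "tps_eq C (set e') [x'] [y]"
    by (rule hom_realize[OF M finite_set]) (use e(1) in \<open>auto simp: lists_eq_set\<close>)
  have "tps_eq C {} [x', e'] [y, e']" using tps_eq_unset[of C "{}" e' "[x']" "[y]"] x'(2) by simp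
  then show ?thesis using that x'(1) tps_eq_trans y by blast
qed

lemma stat_tps:
  assumes t: "tps_eq C {} [g, b] [g', b']" and g: "stat g (set b)"
  shows "stat g' (set b')"
  unfolding stat_def
proof (intro conjI allI)
  fix e'
  have fe: "small \<kappa> {}" by (simp add: small_finite)
  have bb: "tps_eq C {} [b'] [b]" using tps_eq_reindex[OF tps_eq_sym[OF t], of "[1]"] by simp
  obtain e where e: "tps_eq C {} [e, b] [e', b']" by (rule transport[OF bb fe])
  obtain c where c: "tp C c (set b) = tp C g (set b)" "rk g (set b) \<le> rk c (set b \<union> set e)"
    using g by (auto simp: stat_def)
  have "tps_eq C (set b) [c] [g]" using c(1) tp_eq_length by (auto simp: tps_eq_def)
  then have cb: "tps_eq C {} [c, b] [g, b]" using tps_eq_unset[of C "{}" b "[c]" "[g]"] by simp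
  obtain d where d: "tps_eq C {} [d, e' @ b'] [c, e @ b]"
    by (rule transport[OF tps_eq_append[OF e] fe])
  have d3: "tps_eq C {} [d, e', b'] [c, e, b]" using d e by (simp add: tps_eq_def)
  have "tps_eq C {} [d, b'] [c, b]" using tps_eq_reindex[OF d3, of "[0, 2]"] by simp
  then have "tps_eq C {} [d, b'] [g', b']" using cb t tps_eq_trans by blast
  from tps_eq_set[OF this] have "tp C d (set b') = tp C g' (set b')" by (simp add: tps_eq_def)
  moreover have "rk d (set b' \<union> set e') = rk c (set b \<union> set e)"
    using rk_tps[OF d] by (simp add: Un_commute)
  moreover have "rk g' (set b') = rk g (set b)" using rk_tps[OF t] by simp
  ultimately show "\<exists>d. tp C d (set b') = tp C g' (set b') \<and> rk g' (set b') \<le> rk d (set b' \<union> set e')"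
    using c(2) by auto
qed simp

text \<open>\<open>g'\<close> is the free extension to \<open>A\<close> of the copy over
  \<open>b'\<close>. A tuple \<open>n\<close> of \<open>A\<close> has a copy \<open>m\<close> in
  \<open>M\<close>, taken next to \<open>b\<close>, and \<open>g\<close> is free from it as well;
  uniqueness of free extensions matches the two configurations. Thus configurations move to another
  set without conjugating whole models.\<close>

lemma transfer:
  assumes M: "hom_model M" and b: "b \<in> lists M" "rk g (set b) = rk g M"
    and b': "tps_eq C {} [b'] [b]" and A: "small \<kappa> A"
  obtains g' where "\<forall>n\<in>lists A. \<exists>m\<in>lists M. tps_eq C {} [g', b', n] [g, b, m]"
proof -
  have fe: "small \<kappa> {}" by (simp add: small_finite)
  have bM: "set b \<subseteq> M" using b(1) by (auto simp: lists_eq_set)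
  have st: "stat g (set b)" by (rule stat_hom[OF M finite_set bM b(2)])
  obtain g0 where g0: "tps_eq C {} [g0, b'] [g, b]" by (rule transport[OF tps_eq_sym[OF b'] fe])
  have st0: "stat g0 (set b')" by (rule stat_tps[OF tps_eq_sym[OF g0] st])
  obtain g' where g': "tp C g' (set b') = tp C g0 (set b')" "rk g' (set b' \<union> A) = rk g0 (set b')"
    by (rule stat_free_ext[OF st0 A])
  have "tps_eq C (set b') [g'] [g0]" using g'(1) tp_eq_length by (auto simp: tps_eq_def)
  then have "tps_eq C {} [g', b'] [g0, b']" using tps_eq_unset[of C "{}" b' "[g']" "[g0]"] by simp
  then have gb: "tps_eq C {} [g', b'] [g, b]" using g0 tps_eq_trans by blast
  have rk0: "rk g0 (set b') = rk g (set b)" using rk_tps[OF g0] by simp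
  have "\<exists>m\<in>lists M. tps_eq C {} [g', b', n] [g, b, m]" if n: "n \<in> lists A" for n
  proof -
    obtain m where m: "m \<in> lists M" "tps_eq C {} [m, b] [n, b']"
      by (rule hom_realize_list[OF M b(1) tps_eq_sym[OF b']])
    obtain d where "tps_eq C {} [d, m @ b] [g', n @ b']"
      by (rule transport[OF tps_eq_append[OF tps_eq_sym[OF m(2)]] fe])
    then have d: "tps_eq C {} [d, m, b] [g', n, b']" using m(2) by (simp add: tps_eq_def)
    have "tps_eq C {} [d, b] [g', b']" using tps_eq_reindex[OF d, of "[0, 2]"] by simp
    from tps_eq_set[OF tps_eq_trans[OF this gb]]
    have t: "tp C d (set b) = tp C g (set b)" by (simp add: tps_eq_def)
    have "tps_eq C {} [d, m @ b] [g', n @ b']" using d by (auto simp: tps_eq_def)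
    then have "rk d (set b \<union> set m) = rk g' (set b' \<union> set n)"
      using rk_tps[of "{}" d "m @ b" g' "n @ b'"] by (simp add: Un_commute)
    also have "\<dots> \<ge> rk g' (set b' \<union> A)" using n by (intro rk_antimono) (auto simp: lists_eq_set)
    finally have rd: "rk g (set b) \<le> rk d (set b \<union> set m)" using g'(2) rk0 by simp
    have "rk g M \<le> rk g (set b \<union> set m)" using bM m(1) by (intro rk_antimono) (auto simp: lists_eq_set)
    then have "tp C d (set b \<union> set m) = tp C g (set b \<union> set m)"
      using stat_unique[OF st t rd refl] b(2) by simp
    then have "tps_eq C ({} \<union> set (b @ m)) [d] [g]"
      using tp_eq_length[OF t] by (simp add: tps_eq_def)
    from tps_eq_unset[OF this] have "tps_eq C {} [d, b, m] [g, b, m]" by (simp add: tps_eq_def)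
    moreover have "tps_eq C {} [g', b', n] [d, b, m]"
      using tps_eq_reindex[OF tps_eq_sym[OF d], of "[0, 2, 1]"] by simp
    ultimately show ?thesis using m(1) tps_eq_trans by blast
  qed
  then show ?thesis using that by blast
qed

text \<open>The dependent pair is moved as one tuple \<open>c @ a\<close> over a finite base that
  sees the dependence. Each component is free over \<open>M2\<close>, since any finite part of
  \<open>M2\<close> reflects into \<open>M1\<close>, over which the original component is
  free.\<close>

lemma dependence_transfer:
  assumes M1: "hom_model M1" and u: "u \<in> lists M1"
    and c: "rk c (set u) = rk c M1" and a: "rk a (set u) = rk a M1" and ca: "\<not> ind M1 c (set a)"
    and M2: "small \<kappa> M2" "hom_model M2" and u': "u' \<in> lists M2" "tps_eq C {} [u'] [u]"
  obtains c' a' where "tps_eq C {} [c', u'] [c, u]" "tps_eq C {} [a', u'] [a, u]"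
    "rk c' M2 = rk c (set u)" "rk a' M2 = rk a (set u)" "\<not> ind M2 c' (set a')"
proof -
  obtain B1 where B1: "finite B1" "B1 \<subseteq> M1" "rk c (B1 \<union> set a) = rk c (M1 \<union> set a)" by (rule rk_base_over)
  obtain B2 where B2: "finite B2" "B2 \<subseteq> M1" "rk (c @ a) B2 = rk (c @ a) M1" by (rule rk_base)
  from finite_list[of "B1 \<union> B2"] B1(1) B2(1) obtain e where e: "set e = B1 \<union> B2" by auto
  have uM: "set u \<subseteq> M1" using u by (auto simp: lists_eq_set)
  have eM: "e \<in> lists M1" using e B1 B2 by (auto simp: lists_eq_set)
  obtain e' where e': "e' \<in> lists M2" "tps_eq C {} [e', u'] [e, u]"
    by (rule hom_realize_list[OF M2(2) u'])
  have r1: "rk c (set (e @ u) \<union> set a) = rk c (M1 \<union> set a)"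
    by (rule rk_base_over_mono[OF B1(3)]) (use e uM B1 B2 in auto)
  have r2: "rk (c @ a) (set (e @ u)) = rk (c @ a) M1"
    by (rule rk_base_mono[OF B2(3)]) (use e uM B1 B2 in auto)
  have eu: "e @ u \<in> lists M1" using eM u by simp
  obtain g' where g': "\<forall>n\<in>lists M2. \<exists>m\<in>lists M1. tps_eq C {} [g', e' @ u', n] [c @ a, e @ u, m]"
    by (rule transfer[OF M1 eu r2 tps_eq_append[OF e'(2)] M2(1)])
  obtain m0 where m0: "tps_eq C {} [g', e' @ u', []] [c @ a, e @ u, m0]" using g' by blast
  have "length g' = length c + length a" using m0 by (simp add: tps_eq_def)
  then obtain c' a' where g's: "g' = c' @ a'" "length c' = length c" "length a' = length a"
    by (metis add_diff_cancel_left' append_take_drop_id length_append length_drop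
        append_eq_conv_conj le_add1 length_take min.absorb2)
  have le: "length e' = length e" "length u' = length u" using e'(2) by (auto simp: tps_eq_def)
  have g5: "\<exists>m\<in>lists M1. tps_eq C {} [c', a', e', u', n] [c, a, e, u, m]" if n: "n \<in> lists M2" for n
    using bspec[OF g' n] g's le by (auto simp: tps_eq_def)
  then obtain m where m: "tps_eq C {} [c', a', e', u', []] [c, a, e, u, m]" by blast
  have cu: "tps_eq C {} [c', u'] [c, u]" using tps_eq_reindex[OF m, of "[0, 3]"] by simp
  have au: "tps_eq C {} [a', u'] [a, u]" using tps_eq_reindex[OF m, of "[1, 3]"] by simp
  have "tps_eq C {} [c', a', e', u'] [c, a, e, u]" using tps_eq_reindex[OF m, of "[0, 1, 2, 3]"] by simp
  then have cae: "tps_eq C {} [c', a' @ e' @ u'] [c, a @ e @ u]" by (simp add: tps_eq_def)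
  have free: "rk x' M2 = rk x (set u)"
    if x: "tps_eq C {} [x', u'] [x, u]" "rk x (set u) = rk x M1"
      and ext: "\<And>n. n \<in> lists M2 \<Longrightarrow> \<exists>m\<in>lists M1. tps_eq C {} [x', n] [x, m]" for x x'
  proof (rule order_antisym)
    have "rk x' M2 \<le> rk x' (set u')" using u'(1) by (intro rk_antimono) (auto simp: lists_eq_set)
    then show "rk x' M2 \<le> rk x (set u)" using rk_tps[OF x(1)] by simp
    obtain F where F: "finite F" "F \<subseteq> M2" "rk x' F = rk x' M2" by (rule rk_base)
    from finite_list[OF F(1)] obtain n where n: "set n = F" ..
    have "n \<in> lists M2" using n F(2) by (simp add: lists_eq_set)
    then obtain m where m: "m \<in> lists M1" "tps_eq C {} [x', n] [x, m]" using ext by blast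
    have "rk x (set u) \<le> rk x (set m)"
      unfolding x(2) using m(1) by (intro rk_antimono) (auto simp: lists_eq_set)
    then show "rk x (set u) \<le> rk x' M2" using rk_tps[OF m(2)] n F(3) by simp
  qed
  have rc: "rk c' M2 = rk c (set u)"
  proof (rule free[OF cu c])
    fix n assume "n \<in> lists M2"
    then obtain m where "m \<in> lists M1" and m: "tps_eq C {} [c', a', e', u', n] [c, a, e, u, m]"
      using g5 by blast
    then show "\<exists>m\<in>lists M1. tps_eq C {} [c', n] [c, m]"
      using tps_eq_reindex[OF m, of "[0, 4]"] by auto
  qed
  have ra: "rk a' M2 = rk a (set u)"
  proof (rule free[OF au a])
    fix n assume "n \<in> lists M2"
    then obtain m where "m \<in> lists M1" and m: "tps_eq C {} [c', a', e', u', n] [c, a, e, u, m]"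
      using g5 by blast
    then show "\<exists>m\<in>lists M1. tps_eq C {} [a', n] [a, m]"
      using tps_eq_reindex[OF m, of "[1, 4]"] by auto
  qed
  have "rk c' (M2 \<union> set a') \<le> rk c' (set (a' @ e' @ u'))"
    using e'(1) u'(1) by (intro rk_antimono) (auto simp: lists_eq_set)
  also have "\<dots> = rk c (set (a @ e @ u))" using rk_tps[OF cae] by simp
  also have "\<dots> = rk c (M1 \<union> set a)" using r1 by (simp add: Un_ac)
  also have "\<dots> < rk c' M2" using ca c rc by (simp add: not_ind)
  finally have "\<not> ind M2 c' (set a')" by (simp add: not_ind)
  then show ?thesis using that cu au rc ra by blast
qed

section \<open>Orthogonality\<close>

text \<open>Orthogonality of the free extensions of the types of \<open>c\<close> and
  \<open>d\<close> over \<open>u\<close>. Letting \<open>u'\<close> range over copies of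
  \<open>u\<close> makes it depend on types over the empty set only, so it can be checked at a
  conjugate of \<open>u\<close>.\<close>

definition orth_at :: "'a list \<Rightarrow> 'a list \<Rightarrow> 'a list \<Rightarrow> bool" where
  "orth_at u c d \<longleftrightarrow> (\<forall>K x y u'. hom_model K \<and> small \<kappa> K \<and> u' \<in> lists K \<and>
     tps_eq C {} [x, u'] [c, u] \<and> tps_eq C {} [y, u'] [d, u] \<and>
     rk x K = rk c (set u) \<and> rk y K = rk d (set u) \<longrightarrow> ind K x (set y))"

lemma orth_at_sym: "orth_at u c d \<Longrightarrow> orth_at u d c"
  unfolding orth_at_def using ind_sym by blast

text \<open>Dependence in any model can be moved by \<open>dependence_transfer\<close> to the model
  \<open>N\<close> at hand, so one model and one copy of \<open>u\<close> decide.\<close>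

lemma orth_atI:
  assumes N: "hom_model N" "small \<kappa> N" and v: "v \<in> lists N" "tps_eq C {} [v] [u]"
    and *: "\<And>x y. tps_eq C {} [x, v] [c, u] \<Longrightarrow> tps_eq C {} [y, v] [d, u] \<Longrightarrow>
      rk x N = rk c (set u) \<Longrightarrow> rk y N = rk d (set u) \<Longrightarrow> ind N x (set y)"
  shows "orth_at u c d"
  unfolding orth_at_def
proof (intro allI impI, elim conjE)
  fix K x y u'
  assume K: "hom_model K" "small \<kappa> K" "u' \<in> lists K" and x: "tps_eq C {} [x, u'] [c, u]"
    and y: "tps_eq C {} [y, u'] [d, u]" and rk: "rk x K = rk c (set u)" "rk y K = rk d (set u)"
  show "ind K x (set y)"
  proof (rule ccontr)
    assume dep: "\<not> ind K x (set y)"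
    have rx: "rk x (set u') = rk c (set u)" using rk_tps[OF x] by simp
    have ry: "rk y (set u') = rk d (set u)" using rk_tps[OF y] by simp
    have "tps_eq C {} [u'] [u]" using tps_eq_reindex[OF x, of "[1]"] by simp
    then have vu: "tps_eq C {} [v] [u']" using v(2) tps_eq_trans tps_eq_sym by blast
    obtain x' y' where "tps_eq C {} [x', v] [x, u']" "tps_eq C {} [y', v] [y, u']"
      "rk x' N = rk x (set u')" "rk y' N = rk y (set u')" "\<not> ind N x' (set y')"
      by (rule dependence_transfer[OF K(1,3) _ _ dep N(2,1) v(1) vu]) (use rx ry rk in simp_all)
    then show False using *[of x' y'] x y rx ry tps_eq_trans by metis
  qed
qed

text \<open>The base \<open>M \<union> z\<close> is not a model; by dominated copies, the type of \<open>c @ d\<close> over an optimal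
  \<open>z' \<supseteq> z\<close> is stationary and its free extension to a model \<open>K \<supseteq> z'\<close> leaves both \<open>c\<close> and \<open>d\<close> free over \<open>K\<close>.\<close>

lemma orth_at_ind:
  assumes M: "hom_model M" "small \<kappa> M" and o: "orth_at u c d" and u: "u \<in> lists M"
    and cu: "rk c (set u) = rk c M" and du: "rk d (set u) = rk d M"
    and cz: "ind M c (set z)" and dz: "ind M d (set z)"
  shows "ind M c (set z \<union> set d)"
proof (rule ccontr)
  assume "\<not> ind M c (set z \<union> set d)"
  then have N: "rk c (M \<union> (set z \<union> set d)) < rk c M" by (simp add: not_ind)
  \<comment> \<open>The family keeps \<open>c\<close> and \<open>d\<close> separately free, but the
    rank of the pair is minimized, because it is the joint type that must become stationary.\<close>
  let ?P = "\<lambda>y. ind M c (set y) \<and> ind M d (set y) \<and> set z \<subseteq> set y"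
  obtain y where y: "?P y" and min: "\<forall>w. ?P w \<longrightarrow> rk (c @ d) (M \<union> set y) \<le> rk (c @ d) (M \<union> set w)"
    by (rule minimal_witness[of ?P z "\<lambda>w. rk (c @ d) (M \<union> set w)"]) (use cz dz in simp)
  define \<gamma> where "\<gamma> = rk (c @ d) (M \<union> set y)"
  obtain B1 where B1: "finite B1" "B1 \<subseteq> M" "rk (c @ d) (B1 \<union> set y) = rk (c @ d) (M \<union> set y)"
    by (rule rk_base_over)
  obtain B2 where B2: "finite B2" "B2 \<subseteq> M" "rk c (B2 \<union> (set y \<union> set d)) = rk c (M \<union> (set y \<union> set d))"
    by (rule rk_base_over)
  have uM: "set u \<subseteq> M" using u by (auto simp: lists_eq_set)
  define B where "B = B1 \<union> B2 \<union> set u"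
  have B: "finite B" "B \<subseteq> M" using B1 B2 uM by (auto simp: B_def)
  have Bcd: "rk (c @ d) (B \<union> set y) = \<gamma>" unfolding \<gamma>_def
    by (rule rk_base_over_mono[OF B1(3)]) (use B in \<open>auto simp: B_def\<close>)
  have "rk c (B \<union> (set y \<union> set d)) = rk c (M \<union> (set y \<union> set d))"
    by (rule rk_base_over_mono[OF B2(3)]) (use B in \<open>auto simp: B_def\<close>)
  also have "\<dots> \<le> rk c (M \<union> (set z \<union> set d))" using y by (intro rk_antimono) auto
  finally have Bc: "rk c (B \<union> set y \<union> set d) < rk c M" using N by (simp add: Un_assoc)
  define A where "A = B \<union> set y"
  have A: "finite A" "set u \<subseteq> A" using B by (auto simp: A_def B_def)
  have copy: "\<exists>e'. tps_eq C A [e'] [e] \<and> ?P (e' @ y)" for e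
  proof -
    obtain e' where e': "tps_eq C B [e', y] [e, y]" "\<forall>X. ind M y X \<longrightarrow> ind M (e' @ y) X"
      by (rule dominated_copy[OF M(1) B])
    have "ind M x (set (e' @ y))" if "ind M x (set y)" for x
      using ind_sym[OF M] that e'(2) by blast
    then show ?thesis using y tps_eq_set[OF e'(1)] by (auto simp: A_def)
  qed
  have copy_rk: "\<gamma> \<le> rk (c @ d) (A \<union> set e')" if "?P (e' @ y)" for e'
  proof -
    have "\<gamma> \<le> rk (c @ d) (M \<union> set (e' @ y))" unfolding \<gamma>_def using min that by blast
    also have "\<dots> \<le> rk (c @ d) (A \<union> set e')" using B by (intro rk_antimono) (auto simp: A_def)
    finally show ?thesis .
  qed
  have st: "stat (c @ d) A"
    by (rule statI[OF A(1)]) (use copy copy_rk Bcd in \<open>metis A_def\<close>)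
  obtain K where K: "hom_model K" "small \<kappa> K" "A \<subseteq> K"
    by (rule hom_model_exists[OF small_finite[OF A(1)]])
  obtain g where g: "tp C g A = tp C (c @ d) A" "rk g (A \<union> K) = rk (c @ d) A"
    by (rule stat_free_ext[OF st K(2)])
  have "length g = length c + length d" using tp_eq_length[OF g(1)] by simp
  then obtain x x' where gx: "g = x @ x'" "length x = length c" "length x' = length d"
    by (metis append_take_drop_id length_append add_left_cancel append_eq_conv_conj le_add1 length_take min.absorb2)
  have gcd: "tps_eq C A [g] [c @ d]" using g(1) tp_eq_length[OF g(1)] by (simp add: tps_eq_def)
  then have xd: "tps_eq C A [x, x'] [c, d]" using gx by (simp add: tps_eq_def)
  \<comment> \<open>A tuple of \<open>K\<close> is matched with a copy \<open>e'\<close> in the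
    family, and stationarity of the pair makes the two configurations alike. In this way the
    freeness of \<open>c\<close> and of \<open>d\<close> passes to \<open>x\<close> and
    \<open>x'\<close> over \<open>K\<close>.\<close>
  have trip: "\<exists>e'. ?P (e' @ y) \<and> tps_eq C A [c, d, e'] [x, x', n]" if n: "n \<in> lists K" for n
  proof -
    obtain e' where e': "tps_eq C A [e'] [n]" "?P (e' @ y)" using copy by blast
    have "rk (c @ d) A \<le> rk g (A \<union> set n)"
      unfolding g(2)[symmetric] using n K(3) by (intro rk_antimono) (auto simp: lists_eq_set)
    then have "tps_eq C A [c @ d, e'] [g, n]"
      using stat_pair[OF st tps_eq_refl gcd e'(1)] copy_rk[OF e'(2)] Bcd by (simp add: A_def)
    then show ?thesis using e'(2) gx by (auto simp: tps_eq_def)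
  qed
  have free: "rk w K = rk v (set u)"
    if v: "tps_eq C A [w] [v]" "rk v (set u) = rk v M"
      and ext: "\<And>n. n \<in> lists K \<Longrightarrow> \<exists>e'. ind M v (set (e' @ y)) \<and> tps_eq C A [v, e'] [w, n]" for v w
  proof (rule order_antisym)
    have "rk w K \<le> rk w (set u)" using A(2) K(3) by (intro rk_antimono) auto
    also have "\<dots> = rk v (set u)" using rk_tps1[OF tps_eq_mono[OF v(1) A(2)]] .
    finally show "rk w K \<le> rk v (set u)" .
    obtain F where F: "finite F" "F \<subseteq> K" "rk w F = rk w K" by (rule rk_base)
    from finite_list[OF F(1)] obtain n where n: "set n = F" ..
    have "n \<in> lists K" using n F(2) by (simp add: lists_eq_set)
    then obtain e' where e': "ind M v (set (e' @ y))" "tps_eq C A [v, e'] [w, n]" using ext by blast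
    have "rk v M \<le> rk v (A \<union> set e')" using e'(1) unfolding ind_def
      using rk_antimono[of "A \<union> set e'" "M \<union> set (e' @ y)" v] B by (auto simp: A_def)
    also have "\<dots> = rk w (A \<union> set n)" by (rule rk_tps[OF e'(2)])
    also have "\<dots> \<le> rk w F" using n by (intro rk_antimono) auto
    finally show "rk v (set u) \<le> rk w K" using v(2) F(3) by simp
  qed
  have cx: "tps_eq C A [x] [c]" using tps_eq_reindex[OF xd, of "[0]"] by simp
  have dx: "tps_eq C A [x'] [d]" using tps_eq_reindex[OF xd, of "[1]"] by simp
  have rx: "rk x K = rk c (set u)"
  proof (rule free[OF cx cu])
    fix n assume "n \<in> lists K"
    then obtain e' where "?P (e' @ y)" and t: "tps_eq C A [c, d, e'] [x, x', n]" using trip by blast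
    then show "\<exists>e'. ind M c (set (e' @ y)) \<and> tps_eq C A [c, e'] [x, n]"
      using tps_eq_reindex[OF t, of "[0, 2]"] by auto
  qed
  have rx': "rk x' K = rk d (set u)"
  proof (rule free[OF dx du])
    fix n assume "n \<in> lists K"
    then obtain e' where "?P (e' @ y)" and t: "tps_eq C A [c, d, e'] [x, x', n]" using trip by blast
    then show "\<exists>e'. ind M d (set (e' @ y)) \<and> tps_eq C A [d, e'] [x', n]"
      using tps_eq_reindex[OF t, of "[1, 2]"] by auto
  qed
  have over_u: "tps_eq C {} [w, u] [v, u]" if "tps_eq C A [w] [v]" for w v
    using tps_eq_unset[of C "{}" u "[w]" "[v]"] tps_eq_mono[OF that A(2)] by simp
  have "u \<in> lists K" using A(2) K(3) by (auto simp: lists_eq_set)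
  then have "ind K x (set x')"
    using o K(1,2) over_u[OF cx] over_u[OF dx] rx rx' unfolding orth_at_def by blast
  then have "rk c M = rk x (K \<union> set x')" using rx cu by (simp add: ind_def)
  also have "\<dots> \<le> rk x (A \<union> set x')" using K(3) by (intro rk_antimono) auto
  also have "\<dots> = rk c (A \<union> set d)" by (rule rk_tps[OF xd])
  finally show False using Bc by (simp add: A_def)
qed

text \<open>Choose \<open>z\<close>, independent from almost all members of the family, with the rank of \<open>a\<close> over \<open>M \<union> z\<close>
  minimal; then \<open>a\<close> is stationary over \<open>z\<close> and free from a fresh member \<open>c i\<close>, and symmetry over a model around \<open>z\<close> makes \<open>c i\<close> free from \<open>a\<close>.\<close>

lemma finite_weight:
  fixes c :: "nat \<Rightarrow> 'a list"
  assumes M: "hom_model M" "small \<kappa> M" and dep: "\<And>i. \<not> ind M (c i) (set a)"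
    and indep: "\<And>i j z. i \<noteq> j \<Longrightarrow> ind M (c i) (set z) \<Longrightarrow> ind M (c j) (set z) \<Longrightarrow>
      ind M (c i) (set z \<union> set (c j))"
  shows False
proof -
  let ?P = "\<lambda>z. finite {i. \<not> ind M (c i) (set z)}"
  have "?P []" by (simp add: ind_def)
  then obtain z where z: "?P z" and min: "\<forall>w. ?P w \<longrightarrow> rk a (M \<union> set z) \<le> rk a (M \<union> set w)"
    by (rule minimal_witness[of ?P "[]" "\<lambda>w. rk a (M \<union> set w)"])
  define \<beta> where "\<beta> = rk a (M \<union> set z)"
  obtain i where i: "ind M (c i) (set z)"
    using z by (metis (mono_tags, lifting) UNIV_eq_I finite_subset infinite_UNIV_nat mem_Collect_eq subsetI)
  obtain B1 where B1: "finite B1" "B1 \<subseteq> M" "rk a (B1 \<union> set z) = rk a (M \<union> set z)" by (rule rk_base_over)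
  obtain B2 where B2: "finite B2" "B2 \<subseteq> M" "rk (c i) B2 = rk (c i) M" by (rule rk_base)
  obtain B3 where B3: "finite B3" "B3 \<subseteq> M" "rk (c i) (B3 \<union> set a) = rk (c i) (M \<union> set a)" by (rule rk_base_over)
  define B where "B = B1 \<union> B2 \<union> B3"
  have B: "finite B" "B \<subseteq> M" using B1 B2 B3 by (auto simp: B_def)
  have Ba: "rk a (B \<union> set z) = \<beta>" unfolding \<beta>_def
    by (rule rk_base_over_mono[OF B1(3)]) (use B in \<open>auto simp: B_def\<close>)
  have Bc: "rk (c i) B = rk (c i) M" by (rule rk_base_mono[OF B2(3)]) (use B in \<open>auto simp: B_def\<close>)
  have Bca: "rk (c i) (B \<union> set a) = rk (c i) (M \<union> set a)"
    by (rule rk_base_over_mono[OF B3(3)]) (use B in \<open>auto simp: B_def\<close>)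
  define A where "A = B \<union> set z"
  have A: "finite A" "B \<subseteq> A" using B by (auto simp: A_def)
  \<comment> \<open>Adjoining \<open>c i\<close> to \<open>z\<close> loses at most the index
    \<open>i\<close>, so the longer tuple stays in the family.\<close>
  have "{j. \<not> ind M (c j) (set (z @ c i))} \<subseteq> insert i {j. \<not> ind M (c j) (set z)}"
    using indep[OF _ _ i] by auto
  then have "?P (z @ c i)" using z by (meson finite.insertI finite_subset)
  then have "\<beta> \<le> rk a (M \<union> set (z @ c i))" unfolding \<beta>_def using min by blast
  also have "\<dots> \<le> rk a (A \<union> set (c i))" using B by (intro rk_antimono) (auto simp: A_def)
  finally have aci: "\<beta> \<le> rk a (A \<union> set (c i))" .
  have st: "stat a A"
  proof (rule statI[OF A(1)])
    fix e
    obtain e' where e': "tps_eq C B [e', z] [e, z]" "\<forall>X. ind M z X \<longrightarrow> ind M (e' @ z) X"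
      by (rule dominated_copy[OF M(1) B])
    have "ind M x (set (e' @ z))" if "ind M x (set z)" for x
      using ind_sym[OF M] that e'(2) by blast
    then have "{j. \<not> ind M (c j) (set (e' @ z))} \<subseteq> {j. \<not> ind M (c j) (set z)}" by blast
    then have "?P (e' @ z)" using z finite_subset by blast
    then have "\<beta> \<le> rk a (M \<union> set (e' @ z))" unfolding \<beta>_def using min by blast
    also have "\<dots> \<le> rk a (A \<union> set e')" using B by (intro rk_antimono) (auto simp: A_def)
    finally show "\<exists>e'. tps_eq C A [e'] [e] \<and> rk a A \<le> rk a (A \<union> set e')"
      using tps_eq_set[OF e'(1)] Ba by (auto simp: A_def)
  qed
  obtain K where K: "hom_model K" "small \<kappa> K" "A \<subseteq> K"
    by (rule hom_model_exists[OF small_finite[OF A(1)]])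
  have BK: "B \<union> K = K" "A \<union> K = K" using A(2) K(3) by blast+
  have stc: "stat (c i) B" by (rule stat_hom[OF M(1) B Bc])
  \<comment> \<open>\<open>c i\<close> is replaced by a copy that is free over \<open>K\<close>.
    Both are free from \<open>z\<close>, so they have the same type over \<open>A\<close>, the base
    of the stationary type of \<open>a\<close>.\<close>
  obtain c' where c': "tp C c' B = tp C (c i) B" "rk c' (B \<union> K) = rk (c i) B"
    by (rule stat_free_ext[OF stc K(2)])
  have "rk (c i) B \<le> rk c' (B \<union> set z)"
    unfolding c'(2)[symmetric] using K(3) by (intro rk_antimono) (auto simp: A_def)
  moreover have "rk (c i) B \<le> rk (c i) (B \<union> set z)"
    using Bc i rk_antimono[of "B \<union> set z" "M \<union> set z" "c i"] B by (auto simp: ind_def)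
  ultimately have "tp C c' A = tp C (c i) A"
    unfolding A_def using stat_unique[OF stc c'(1) _ refl] by blast
  then have cc: "tps_eq C A [c i] [c']" using tp_eq_length[OF c'(1)] by (simp add: tps_eq_def)
  \<comment> \<open>Making \<open>a'\<close> free over \<open>K\<close> and \<open>c'\<close>
    together allows symmetry over \<open>K\<close>; stationarity of the type of \<open>a\<close>
    over \<open>A\<close> carries the result back to \<open>(a, c i)\<close>.\<close>
  obtain a' where a': "tp C a' A = tp C a A" "rk a' (A \<union> (K \<union> set c')) = rk a A"
    by (rule stat_free_ext[OF st small_Un[OF K(2) small_finite[OF finite_set]]])
  have aa: "tps_eq C A [a'] [a]" using a'(1) tp_eq_length[OF a'(1)] by (simp add: tps_eq_def)
  have rka: "rk a' (K \<union> set c') = rk a A" using a'(2) BK by (simp add: Un_assoc[symmetric])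
  have "rk a' K \<le> rk a' A" using K(3) by (rule rk_antimono)
  then have "rk a' K \<le> rk a' (K \<union> set c')" using rka rk_tps1[OF aa] by simp
  then have "ind K a' (set c')" using not_ind[of K a' "set c'"] by (meson leD)
  then have ca: "ind K c' (set a')" by (rule ind_sym[OF K(1,2)])
  have "rk a A \<le> rk a' (A \<union> set c')" unfolding rka[symmetric] using K(3) by (intro rk_antimono) auto
  then have "tps_eq C A [a, c i] [a', c']"
    using stat_pair[OF st tps_eq_refl aa cc] aci Ba by (simp add: A_def)
  from tps_eq_reindex[OF this, of "[1, 0]"] have "tps_eq C A [c i, a] [c', a']" by simp
  then have "rk (c i) (A \<union> set a) = rk c' (A \<union> set a')" by (rule rk_tps)
  also have "\<dots> \<ge> rk c' (K \<union> set a')" using K(3) by (intro rk_antimono) auto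
  finally have "rk (c i) M \<le> rk (c i) (A \<union> set a)" using ca c'(2) BK Bc by (simp add: ind_def)
  also have "\<dots> \<le> rk (c i) (B \<union> set a)" using A(2) by (intro rk_antimono) auto
  finally show False using dep[of i] Bca by (simp add: not_ind)
qed


section \<open>From types to the tuples that realize them\<close>

lemma free_ext_tp:
  assumes "A \<subseteq> B" "length c = length c0"
  shows "free_ext C D (length c0) (tp C c0 A) B (tp C c B) \<longleftrightarrow> tps_eq C A [c0] [c] \<and> rk c B = rk c0 A"
proof -
  have "rank C D (length c0) (tp C c B) = rank C D (length c0) (tp C c0 A) \<longleftrightarrow> rk c B = rk c0 A"
    using rank_eq_rk[of c0 A] rank_eq_rk[of c B] assms(2) by simp
  moreover have "tp C c B \<in> S_D C D (length c0) B" using tp_in_S_D[of c B] assms(2) by simp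
  moreover have "tp C c0 A \<subseteq> tp C c B \<longleftrightarrow> tp C c0 A = tp C c A"
    by (rule tp_subset_iff) (use assms in simp_all)
  ultimately show ?thesis using assms(2) by (simp add: free_ext_def tps_eq_def)
qed

lemma indep_iff_ind:
  assumes M: "hom_model M" shows "indep C D (set a) M (set b) \<longleftrightarrow> ind M a (set b)"
proof -
  have "rank C D (length x) (tp C x M) = rank C D (length x) (tp C x (M \<union> set b)) \<longleftrightarrow> ind M x (set b)" for x
    unfolding rank_eq_rk ind_def by auto
  moreover have "ind M x (set b)" if "ind M a (set b)" "x \<in> lists (set a)" for x
    by (rule ind_sub[OF M that(1)]) (use that(2) in \<open>auto simp: lists_eq_set\<close>)
  ultimately show ?thesis unfolding indep_def by (auto simp: lists_eq_set)
qed

lemma orth_tp: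
  "orth C D \<kappa> (length c0) A (tp C c0 A) (length d0) B (tp C d0 B) \<longleftrightarrow>
    (\<forall>M c d. hom_model M \<and> small \<kappa> M \<and> A \<union> B \<subseteq> M \<and> tps_eq C A [c0] [c] \<and> rk c M = rk c0 A \<and>
      tps_eq C B [d0] [d] \<and> rk d M = rk d0 B \<longrightarrow> ind M c (set d))"
proof -
  have 1: "A \<union> B \<subseteq> M \<and> length c = length c0 \<and> length d = length d0 \<and>
      free_ext C D (length c0) (tp C c0 A) M (tp C c M) \<and> free_ext C D (length d0) (tp C d0 B) M (tp C d M) \<longleftrightarrow>
    A \<union> B \<subseteq> M \<and> tps_eq C A [c0] [c] \<and> rk c M = rk c0 A \<and> tps_eq C B [d0] [d] \<and> rk d M = rk d0 B" for M c d
  proof (cases "A \<union> B \<subseteq> M \<and> length c = length c0 \<and> length d = length d0")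
    case True
    then show ?thesis using free_ext_tp[of A M c c0] free_ext_tp[of B M d d0] by auto
  next
    case False
    then show ?thesis by (auto simp: tps_eq_def)
  qed
  have "(hom_model M \<and> small \<kappa> M \<and> A \<union> B \<subseteq> M \<and> length c = length c0 \<and> length d = length d0 \<and>
      free_ext C D (length c0) (tp C c0 A) M (tp C c M) \<and> free_ext C D (length d0) (tp C d0 B) M (tp C d M) \<longrightarrow>
        indep C D (set c) M (set d)) \<longleftrightarrow>
    (hom_model M \<and> small \<kappa> M \<and> A \<union> B \<subseteq> M \<and> tps_eq C A [c0] [c] \<and> rk c M = rk c0 A \<and>
      tps_eq C B [d0] [d] \<and> rk d M = rk d0 B \<longrightarrow> ind M c (set d))" for M c d
    unfolding 1 using indep_iff_ind[of M c d] by blast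
  then show ?thesis unfolding orth_def by simp
qed

text \<open>\<open>d\<close> is a base of the type of \<open>c\<close> over \<open>N\<close>, so a
  realization of the type over \<open>d\<close> whose rank has not dropped is the unique free
  one.\<close>

lemma free_tps_eq:
  assumes N: "hom_model N" and d: "d \<in> lists N" "rk c (set d) = rk c N"
    and x: "tps_eq C {} [x, d] [c, d]" "rk c N \<le> rk x (set d \<union> N)"
  shows "tps_eq C N [x] [c]"
proof -
  have dN: "set d \<subseteq> N" using d(1) by (auto simp: lists_eq_set)
  have "tp C x (set d) = tp C c (set d)" using tps_eq_set[OF x(1)] by (simp add: tps_eq_def)
  then have "tp C x (set d \<union> N) = tp C c (set d \<union> N)"
    using stat_unique[OF stat_hom[OF N finite_set dN d(2)], of x N c] x(2) d(2) dN
    by (simp add: Un_absorb1)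
  then show ?thesis using x(1) dN by (simp add: tps_eq_def Un_absorb1)
qed

text \<open>A forking extension \<open>y\<close> of the copy over \<open>M\<close> that is not orthogonal to the copy is reflected, together
  with a finite tuple \<open>v\<close> witnessing this, freely over \<open>N\<close>; there it contradicts the regularity of the
  original type.\<close>

lemma regular_transfer:
  assumes N: "hom_model N" "small \<kappa> N" and reg: "regular C D \<kappa> (length c) N (tp C c N)"
    and d: "d \<in> lists N" "rk c (set d) = rk c N"
    and M: "hom_model M" "small \<kappa> M" and d': "d' \<in> lists M" "tps_eq C {} [c', d'] [c, d]"
    and c': "rk c' M = rk c N"
  shows "regular C D \<kappa> (length c) M (tp C c' M)"
proof -
  have dN: "set d \<subseteq> N" and d'M: "set d' \<subseteq> M" using d(1) d'(1) by (auto simp: lists_eq_set)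
  have len: "length c' = length c" using d'(2) by (simp add: tps_eq_def)
  have stc: "stat c (set d)" by (rule stat_hom[OF N(1) finite_set dN d(2)])
  have c'd': "rk c' (set d') = rk c' M" using rk_tps[OF d'(2)] d(2) c' by simp
  have stat: "stationary C D \<kappa> (length c) M (tp C c' M)"
    unfolding stationary_def
  proof (intro conjI allI impI)
    show "tp C c' M \<in> S_D C D (length c) M" using tp_in_S_D[of c' M] len by simp
    fix B assume B: "M \<subseteq> B \<and> small \<kappa> B"
    then have MB: "M \<union> B = B" by blast
    obtain e where e: "tps_eq C M [e] [c']" "ind M e B" by (rule hom_free_ext[OF M]) (use B in blast)
    have le: "length e = length c'" using e(1) by (simp add: tps_eq_def)
    show "\<exists>!q. free_ext C D (length c) (tp C c' M) B q"
    proof (rule ex1I)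
      show "free_ext C D (length c) (tp C c' M) B (tp C e B)"
        using free_ext_tp[of M B e c'] B le len e MB rk_tps1[OF e(1)] tps_eq_sym by (simp add: ind_def)
      fix q assume q: "free_ext C D (length c) (tp C c' M) B q"
      then have "q \<in> S_D C D (length c) B" by (simp add: free_ext_def)
      then obtain f where f: "length f = length c" "q = tp C f B" by (rule S_D_tp) (use B in blast)
      then have *: "tps_eq C M [c'] [f]" "rk f B = rk c' M"
        using q free_ext_tp[of M B f c'] B len by auto
      have "ind M f B" using * MB rk_tps1[OF *(1)] by (simp add: ind_def)
      then have "tps_eq C (M \<union> B) [e] [f]"
        by (rule ind_unique[OF M(1) tps_eq_trans[OF e(1) *(1)] e(2)])
      then show "q = tp C e B" using f(2) MB by (simp add: tps_eq_def)
    qed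
  qed
  have "free_ext C D (length c) (tp C c' M) M (tp C c' M)"
    using free_ext_tp[of M M c' c'] len by (simp add: tps_eq_refl)
  \<comment> \<open>The whole of \<open>M\<close> serves as the base in the definition of
    regularity, so the dichotomy concerns extensions of the full type over \<open>M\<close>.\<close>
  then have based: "based_on C D \<kappa> (length c) M (tp C c' M) M"
    using stat by (simp add: based_on_def restr_tp')
  have orth: "orth C D \<kappa> (length c) M (tp C c' M) (length c) E q"
    if q: "q \<in> S_D C D (length c) E" "M \<subseteq> E" "small \<kappa> E" "tp C c' M \<subseteq> q"
      and forks: "\<not> free_ext C D (length c) (tp C c' M) E q" for E q
  proof (rule ccontr)
    obtain b where b: "length b = length c" "q = tp C b E" by (rule S_D_tp[OF q(1,3)])
    have cb: "tps_eq C M [c'] [b]"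
      using q(4) tp_subset_iff[OF q(2), of c' b C] b len by (simp add: tps_eq_def)
    have "rk b E \<noteq> rk c' M" using forks free_ext_tp[OF q(2), of b c'] b len cb by simp
    then have lt: "rk b E < rk c' M" using rk_antimono[OF q(2), of b] rk_tps1[OF cb] by simp
    assume "\<not> orth C D \<kappa> (length c) M (tp C c' M) (length c) E q"
    then have "\<not> orth C D \<kappa> (length c') M (tp C c' M) (length b) E (tp C b E)"
      using b len by simp
    then obtain L x y where L: "hom_model L" "M \<union> E \<subseteq> L" and x: "tps_eq C M [c'] [x]" "rk x L = rk c' M"
      and y: "tps_eq C E [b] [y]" "rk y L = rk b E" and dep: "\<not> ind L x (set y)"
      unfolding orth_tp by blast
    obtain F1 where F1: "finite F1" "F1 \<subseteq> L" "rk x F1 = rk x L" by (rule rk_base)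
    obtain F2 where F2: "finite F2" "F2 \<subseteq> L" "rk y F2 = rk y L" by (rule rk_base)
    from finite_list[of "F1 \<union> F2"] F1(1) F2(1) obtain v where v: "set v = F1 \<union> F2" by auto
    have d'L: "set d' \<subseteq> L" using d'M L(2) by blast
    have vd: "v @ d' \<in> lists L" using v F1(2) F2(2) d'L by (auto simp: lists_eq_set)
    have rx: "rk x (set (v @ d')) = rk x L" by (rule rk_base_mono[OF F1(3)]) (use v F1 F2 d'L in auto)
    have ry: "rk y (set (v @ d')) = rk y L" by (rule rk_base_mono[OF F2(3)]) (use v F1 F2 d'L in auto)
    \<comment> \<open>A base over \<open>M\<close> for the pair \<open>y @ v\<close>: realizing this
      much of \<open>M\<close> in \<open>N\<close> suffices to move the pair freely over
      \<open>N\<close>.\<close>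
    obtain F3 where F3: "finite F3" "F3 \<subseteq> M" "rk (y @ v) F3 = rk (y @ v) M" by (rule rk_base)
    from finite_list[OF F3(1)] obtain w where w: "set w = F3" ..
    have wd: "w @ d' \<in> lists M" using w F3(2) d'(1) by (auto simp: lists_eq_set)
    have rw: "rk (y @ v) (set (w @ d')) = rk (y @ v) M"
      by (rule rk_base_mono[OF F3(3)]) (use w F3(2) d'M in auto)
    have dd: "tps_eq C {} [d] [d']" using tps_eq_reindex[OF tps_eq_sym[OF d'(2)], of "[1]"] by simp
    obtain w' where w': "w' \<in> lists N" "tps_eq C {} [w', d] [w, d']" by (rule hom_realize_list[OF N(1) d(1) dd])
    obtain g where g: "\<forall>n\<in>lists N. \<exists>m\<in>lists M. tps_eq C {} [g, w' @ d, n] [y @ v, w @ d', m]"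
      by (rule transfer[OF M(1) wd rw tps_eq_append[OF w'(2)] N(2)])
    define y' v' where "y' = take (length y) g" and "v' = drop (length y) g"
    have split: "\<exists>m\<in>lists M. tps_eq C {} [y', v', w', d, n] [y, v, w, d', m]" if n: "n \<in> lists N" for n
    proof -
      obtain m where m: "m \<in> lists M" "tps_eq C {} [g, w' @ d, n] [y @ v, w @ d', m]" using g n by blast
      have "length g = length y + length v" using m(2) by (simp add: tps_eq_def)
      then have "tps_eq C {} [y', v', w', d, n] [y, v, w, d', m]"
        using m(2) w'(2) by (simp add: tps_eq_def y'_def v'_def flip: append_assoc)
      then show ?thesis using m(1) by blast
    qed
    obtain m0 where m0: "tps_eq C {} [y', v', w', d, []] [y, v, w, d', m0]" using split[of "[]"] by auto
    have yM: "tps_eq C M [y] [c']"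
      using tps_eq_trans[OF cb tps_eq_mono[OF y(1) q(2)]] by (rule tps_eq_sym)
    have y'd: "tps_eq C {} [y', d] [c, d]"
    proof -
      have "tps_eq C {} [y', d] [y, d']" using tps_eq_reindex[OF m0, of "[0, 3]"] by simp
      moreover have "tps_eq C {} [y, d'] [c', d']"
        using tps_eq_unset[of C "{}" d' "[y]" "[c']"] tps_eq_mono[OF yM d'M] by simp
      ultimately show ?thesis using d'(2) tps_eq_trans by blast
    qed
    have "tps_eq C N [y'] [c]"
    proof (rule free_tps_eq[OF N(1) d y'd])
      obtain F where F: "finite F" "F \<subseteq> set d \<union> N" "rk y' F = rk y' (set d \<union> N)" by (rule rk_base)
      from finite_list[OF F(1)] obtain n where n: "set n = F" ..
      have "n \<in> lists N" using n F(2) dN by (auto simp: lists_eq_set)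
      then obtain m where m: "m \<in> lists M" "tps_eq C {} [y', v', w', d, n] [y, v, w, d', m]" using split by blast
      have "tps_eq C {} [y', n] [y, m]" using tps_eq_reindex[OF m(2), of "[0, 4]"] by simp
      then have "rk y' (set n) = rk y (set m)" using rk_tps[of "{}"] by fastforce
      moreover have "rk y M \<le> rk y (set m)" using m(1) by (intro rk_antimono) (auto simp: lists_eq_set)
      ultimately show "rk c N \<le> rk y' (set d \<union> N)" using rk_tps1[OF yM] c' n F(3) by simp
    qed
    note y'c = this
    obtain K where K: "hom_model K" "small \<kappa> K" "N \<union> set v' \<subseteq> K"
      by (rule hom_model_exists[OF small_Un[OF N(2) small_finite[OF finite_set]]])
    have dK: "set d \<subseteq> K" using dN K(3) by blast
    have v'd: "v' @ d \<in> lists K" using K(3) dK by (auto simp: lists_eq_set)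
    have "tps_eq C {} [v', d] [v, d']" using tps_eq_reindex[OF m0, of "[1, 3]"] by simp
    note vv = tps_eq_append[OF this]
    \<comment> \<open>The dependence is moved from \<open>L\<close> to the model \<open>K\<close>
      around \<open>N\<close> and \<open>v'\<close>, where the regularity of the original type can
      be applied.\<close>
    obtain x2 y2 where x2: "tps_eq C {} [x2, v' @ d] [x, v @ d']" "rk x2 K = rk x (set (v @ d'))"
      and y2: "tps_eq C {} [y2, v' @ d] [y, v @ d']" "rk y2 K = rk y (set (v @ d'))"
      and dep2: "\<not> ind K x2 (set y2)"
      by (rule dependence_transfer[OF L(1) vd rx ry dep K(2,1) v'd vv])
    have lv: "length v' = length v" using m0 by (simp add: tps_eq_def)
    have x2c: "tps_eq C N [x2] [c]"
    proof (rule free_tps_eq[OF N(1) d])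
      have "tps_eq C {} [x2, v', d] [x, v, d']" using x2(1) lv by (simp add: tps_eq_def)
      from tps_eq_reindex[OF this, of "[0, 2]"] have "tps_eq C {} [x2, d] [x, d']" by simp
      moreover have "tps_eq C {} [x, d'] [c', d']"
        using tps_eq_unset[of C "{}" d' "[x]" "[c']"] tps_eq_mono[OF tps_eq_sym[OF x(1)] d'M] by simp
      ultimately show "tps_eq C {} [x2, d] [c, d]" using d'(2) tps_eq_trans by blast
      have "rk c N = rk x2 K" using x2(2) rx x(2) c' by simp
      also have "\<dots> \<le> rk x2 (set d \<union> N)" using dK K(3) by (intro rk_antimono) auto
      finally show "rk c N \<le> rk x2 (set d \<union> N)" .
    qed
    \<comment> \<open>The transfer controls \<open>y2\<close> only over \<open>v' @ d\<close>. The
      type there is stationary, and adding \<open>N\<close> lowers the rank of neither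
      \<open>y2\<close> nor \<open>y'\<close>, hence they agree on \<open>N\<close>.\<close>
    have y2y': "tps_eq C N [y2] [y']"
    proof -
      have "stat y (set (v @ d'))"
        by (rule stat_hom[OF L(1)]) (use vd ry in \<open>auto simp: lists_eq_set\<close>)
      moreover have t: "tps_eq C {} [y, v @ d'] [y', v' @ d]"
        using tps_eq_reindex[OF tps_eq_sym[OF m0], of "[0, 1, 3]"] by (simp add: tps_eq_def)
      ultimately have st: "stat y' (set (v' @ d))" using stat_tps by blast
      have t2: "tps_eq C {} [y2, v' @ d] [y', v' @ d]" by (rule tps_eq_trans[OF y2(1) t])
      have ry': "rk y' (set (v' @ d)) = rk y L" using rk_tps[OF t] ry by simp
      have "tp C y2 (set (v' @ d) \<union> N) = tp C y' (set (v' @ d) \<union> N)"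
      proof (rule stat_unique[OF st _ _ refl])
        show "tp C y2 (set (v' @ d)) = tp C y' (set (v' @ d))"
          using tps_eq_set[OF t2] by (simp add: tps_eq_def)
        have "rk y2 K \<le> rk y2 (set (v' @ d) \<union> N)" using K(3) dK by (intro rk_antimono) auto
        then show "rk y' (set (v' @ d)) \<le> rk y2 (set (v' @ d) \<union> N)" using y2(2) ry ry' by simp
        obtain F where F: "finite F" "F \<subseteq> N" "rk y' (F \<union> set (v' @ d)) = rk y' (N \<union> set (v' @ d))"
          by (rule rk_base_over)
        from finite_list[OF F(1)] obtain n where n: "set n = F" ..
        have "n \<in> lists N" using n F(2) by (auto simp: lists_eq_set)
        then obtain m where m: "m \<in> lists M" "tps_eq C {} [y', v', w', d, n] [y, v, w, d', m]" using split by blast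
        have "tps_eq C {} [y', n, v', d] [y, m, v, d']"
          using tps_eq_reindex[OF m(2), of "[0, 4, 1, 3]"] by simp
        then have "tps_eq C {} [y', n @ v' @ d] [y, m @ v @ d']" by (simp add: tps_eq_def)
        then have "rk y' (set (n @ v' @ d)) = rk y (set (m @ v @ d'))" using rk_tps[of "{}"] by fastforce
        moreover have "rk y L \<le> rk y (set (m @ v @ d'))"
          using m(1) vd L(2) by (intro rk_antimono) (auto simp: lists_eq_set)
        ultimately show "rk y' (set (v' @ d)) \<le> rk y' (set (v' @ d) \<union> N)"
          using ry' n F(3) by (simp add: Un_ac)
      qed
      then have "tp C y2 N = tp C y' N" by (rule tp_mono_eq) simp
      then show ?thesis using t2 by (simp add: tps_eq_def)
    qed
    have y2c: "tps_eq C N [y2] [c]" by (rule tps_eq_trans[OF y2y' y'c])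
    obtain B where B: "B \<subseteq> N" "free_ext C D (length c) (tp C c B) N (tp C c N)"
      and dich: "\<And>E q. q \<in> S_D C D (length c) E \<Longrightarrow> B \<subseteq> E \<Longrightarrow> small \<kappa> E \<Longrightarrow> tp C c B \<subseteq> q \<Longrightarrow>
        free_ext C D (length c) (tp C c B) E q \<or> orth C D \<kappa> (length c) N (tp C c N) (length c) E q"
      using reg unfolding regular_def based_on_def by (metis restr_tp')
    have rB: "rk c N = rk c B" using B free_ext_tp[OF B(1), of c c] by simp
    have BK: "B \<subseteq> K" using B(1) K(3) by blast
    have ly: "length y2 = length c" using y2c by (simp add: tps_eq_def)
    have sub: "tp C c B \<subseteq> tp C y2 K"
      using tp_subset_iff[OF BK, of c y2 C] ly tps_eq_mono[OF y2c B(1)] by (simp add: tps_eq_def)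
    have "tp C y2 K \<in> S_D C D (length c) K" using tp_in_S_D[of y2 K] ly by simp
    \<comment> \<open>The first alternative fails because \<open>y2\<close> inherits the rank drop
      of \<open>b\<close>, the second because \<open>x2\<close> and \<open>y2\<close> are dependent
      over \<open>K\<close>.\<close>
    then consider "free_ext C D (length c) (tp C c B) K (tp C y2 K)"
      | "orth C D \<kappa> (length c) N (tp C c N) (length y2) K (tp C y2 K)"
      using dich[OF _ BK K(2) sub] ly by auto
    then show False
    proof cases
      case 1
      then have "rk y2 K = rk c B" using free_ext_tp[OF BK ly] by simp
      then show False using y2(2) ry y(2) lt c' rB by simp
    next
      case 2
      have "rk x2 K = rk c N" using x2(2) rx x(2) c' by simp
      then have "ind K x2 (set y2)"
        using 2[unfolded orth_tp] K tps_eq_sym[OF x2c] tps_eq_refl by blast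
      then show False using dep2 by simp
    qed
  qed
  have r: "restr (tp C c' M) M = tp C c' M" by (rule restr_tp') simp
  show ?thesis
    unfolding regular_def
  proof (intro conjI exI[of _ M] allI ballI impI)
    fix E q assume "q \<in> S_D C D (length c) E" "M \<subseteq> E \<and> small \<kappa> E \<and> restr (tp C c' M) M \<subseteq> q"
    then show "free_ext C D (length c) (restr (tp C c' M) M) E q \<or>
        orth C D \<kappa> (length c) M (tp C c' M) (length c) E q"
      unfolding r using orth by blast
  qed (rule stat based)+
qed

section \<open>Reduction of orthogonality to regular types\<close>

lemma orth_model_if_orth_regular:
  assumes N: "hom_model N" "small \<kappa> N" and M: "hom_model M" "M \<subseteq> N"
    and reg: "regular C D \<kappa> (length c0) N (tp C c0 N)"
    and all: "\<And>m q. q \<in> S_D C D m M \<Longrightarrow> regular C D \<kappa> m M q \<Longrightarrow>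
      orth C D \<kappa> (length c0) N (tp C c0 N) m M q"
  shows "orth_model C D \<kappa> (length c0) N (tp C c0 N) M"
proof (rule ccontr)
  have Ms: "small \<kappa> M" by (rule small_subset[OF N(2) M(2)])
  assume "\<not> orth_model C D \<kappa> (length c0) N (tp C c0 N) M"
  then obtain m q where q: "q \<in> S_D C D m M" "\<not> orth C D \<kappa> (length c0) N (tp C c0 N) m M q"
    by (auto simp: orth_model_def)
  obtain a0 where a0: "length a0 = m" "q = tp C a0 M" by (rule S_D_tp[OF q(1) Ms])
  have "\<not> orth C D \<kappa> (length c0) N (tp C c0 N) (length a0) M (tp C a0 M)" using q(2) a0 by simp
  then obtain L c a where L: "hom_model L" "N \<union> M \<subseteq> L" and c: "tps_eq C N [c0] [c]" "rk c L = rk c0 N"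
    and a: "tps_eq C M [a0] [a]" "rk a L = rk a0 M" and dep: "\<not> ind L c (set a)"
    unfolding orth_tp by blast
  obtain F1 where F1: "finite F1" "F1 \<subseteq> N" "rk c0 F1 = rk c0 N" by (rule rk_base)
  from finite_list[OF F1(1)] obtain d where d: "set d = F1" ..
  obtain F2 where F2: "finite F2" "F2 \<subseteq> M" "rk a0 F2 = rk a0 M" by (rule rk_base)
  from finite_list[OF F2(1)] obtain b where b: "set b = F2" ..
  have dN: "d \<in> lists N" and bM: "b \<in> lists M" using d b F1 F2 by (auto simp: lists_eq_set)
  have db: "d @ b \<in> lists L" using dN bM L(2) by (auto simp: lists_eq_set)
  have cd: "tps_eq C {} [c, d] [c0, d]"
  proof -
    have "tps_eq C ({} \<union> set d) [c] [c0]"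
      by (rule tps_eq_mono[OF tps_eq_sym[OF c(1)]]) (use d F1 in auto)
    from tps_eq_unset[OF this] show ?thesis by simp
  qed
  have ab: "tps_eq C (set b) [a] [a0]" by (rule tps_eq_mono[OF tps_eq_sym[OF a(1)]]) (use b F2 in auto)
  have "rk c (set d) = rk c L" using rk_tps[OF cd] d F1(3) c(2) by simp
  then have rc: "rk c (set (d @ b)) = rk c L" by (rule rk_base_mono) (use db in \<open>auto simp: lists_eq_set\<close>)
  have "rk a (set b) = rk a L" using rk_tps1[OF ab] b F2(3) a(2) by simp
  then have ra: "rk a (set (d @ b)) = rk a L" by (rule rk_base_mono) (use db in \<open>auto simp: lists_eq_set\<close>)

  \<comment> \<open>\<open>h\<close> lists the earlier choices; \<open>f\<close> copies
    \<open>d\<close> over their points and over the base \<open>b\<close> of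
    \<open>q\<close>.\<close>
  define P where "P h f \<longleftrightarrow> f \<in> lists M \<and> tps_eq C (set b \<union> \<Union> (set ` set h)) [f] [d]" for h f
  define pick where "pick h = (SOME f. P h f)" for h
  have pick: "P h (pick h)" if h: "set h \<subseteq> lists M" for h
  proof -
    have "\<exists>f. P h f"
      unfolding P_def
    proof (rule hom_realize[OF M(1)])
      show "finite (set b \<union> \<Union> (set ` set h))" by simp
      show "set b \<union> \<Union> (set ` set h) \<subseteq> M" using h bM by (fastforce simp: lists_eq_set)
    qed blast
    then show ?thesis unfolding pick_def by (rule someI_ex)
  qed
  \<comment> \<open>The recursion carries the whole list, since each choice depends on all previous
    ones.\<close>
  define H where "H = rec_nat [] (\<lambda>_ h. h @ [pick h])"
  have H0: "H 0 = []" and HS: "H (Suc n) = H n @ [pick (H n)]" for n by (simp_all add: H_def)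
  define f where "f i = pick (H i)" for i
  have HM: "set (H n) \<subseteq> lists M" for n
    by (induction n) (use pick in \<open>auto simp: H0 HS P_def\<close>)
  have fH: "f i \<in> set (H j)" if "i < j" for i j
    using that by (induction j) (auto simp: HS f_def less_Suc_eq)
  have f: "f i \<in> lists M" and fd: "tps_eq C (set b \<union> \<Union> (set ` set (H i))) [f i] [d]" for i
    using pick[OF HM[of i]] by (auto simp: P_def f_def)
  have fb: "tps_eq C {} [f i, b] [d, b]" for i
    using tps_eq_unset[of C "{}" b "[f i]" "[d]"] tps_eq_mono[OF fd[of i]] by simp
  have ff: "tps_eq C {} [f j, f i] [d, f i]" if "i < j" for i j
  proof -
    have "tps_eq C ({} \<union> set (f i)) [f j] [d]" by (rule tps_eq_mono[OF fd[of j]]) (use fH[OF that] in auto)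
    from tps_eq_unset[OF this] show ?thesis by simp
  qed

  \<comment> \<open>Conjugating \<open>d\<close> to \<open>f i\<close> moves the dependence to
    \<open>M\<close>. The partner \<open>y\<close> has the type of \<open>a0\<close> over
    \<open>M\<close>, so a further transport over \<open>M\<close> makes all copies depend on the
    same tuple \<open>a0\<close>.\<close>
  have ex: "\<exists>x. tps_eq C {} [x, f i @ b] [c, d @ b] \<and> rk x M = rk c0 N \<and> \<not> ind M x (set a0)" for i
  proof -
    have fbM: "f i @ b \<in> lists M" using f bM by simp
    obtain x y where x: "tps_eq C {} [x, f i @ b] [c, d @ b]" "rk x M = rk c (set (d @ b))"
      and y: "tps_eq C {} [y, f i @ b] [a, d @ b]" "rk y M = rk a (set (d @ b))" and xy: "\<not> ind M x (set y)"
      by (rule dependence_transfer[OF L(1) db rc ra dep Ms M(1) fbM tps_eq_append[OF fb]])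
    have "tps_eq C {} [y, f i, b] [a, d, b]" using y(1) fb[of i] by (simp add: tps_eq_def)
    from tps_eq_reindex[OF this, of "[0, 2]"] have "tps_eq C {} [y, b] [a, b]" by simp
    moreover have "tps_eq C {} [a, b] [a0, b]" using tps_eq_unset[of C "{}" b "[a]" "[a0]"] ab by simp
    ultimately have yb: "tps_eq C {} [y, b] [a0, b]" by (rule tps_eq_trans)
    have ya: "tps_eq C M [y] [a0]"
    proof (rule free_tps_eq[OF M(1) bM _ yb])
      show "rk a0 (set b) = rk a0 M" using b F2(3) by simp
      show "rk a0 M \<le> rk y (set b \<union> M)"
        using y(2) ra a(2) bM by (simp add: Un_absorb1 lists_eq_set)
    qed
    obtain x' where x': "tps_eq C M [x', a0] [x, y]" by (rule transport[OF ya Ms])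
    have xx: "tps_eq C M [x'] [x]" using tps_eq_reindex[OF x', of "[0]"] by simp
    have "tps_eq C ({} \<union> set (f i @ b)) [x'] [x]"
      by (rule tps_eq_mono[OF xx]) (use fbM in \<open>auto simp: lists_eq_set\<close>)
    from tps_eq_unset[OF this] have "tps_eq C {} [x', f i @ b] [x, f i @ b]" by simp
    then have "tps_eq C {} [x', f i @ b] [c, d @ b]" using x(1) tps_eq_trans by blast
    moreover have "rk x' M = rk c0 N" using rk_tps1[OF xx] x(2) rc c(2) by simp
    moreover have "\<not> ind M x' (set a0)"
      using xy rk_tps[OF x'] rk_tps1[OF xx] by (simp add: not_ind)
    ultimately show ?thesis by blast
  qed
  then obtain g where g: "\<And>i. tps_eq C {} [g i, f i @ b] [c, d @ b]" "\<And>i. rk (g i) M = rk c0 N"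
    "\<And>i. \<not> ind M (g i) (set a0)" by metis
  have gf: "tps_eq C {} [g i, f i] [c0, d]" for i
  proof -
    have "tps_eq C {} [g i, f i, b] [c, d, b]" using g(1)[of i] fb[of i] by (simp add: tps_eq_def)
    from tps_eq_reindex[OF this, of "[0, 1]"] have "tps_eq C {} [g i, f i] [c, d]" by simp
    then show ?thesis using cd tps_eq_trans by blast
  qed
  have d0: "rk c0 (set d) = rk c0 N" using d F1(3) by simp
  have gfr: "rk (g i) (set (f i)) = rk (g i) M" for i using rk_tps[OF gf[of i]] d0 g(2)[of i] by simp
  have lg: "length (g i) = length c0" for i using gf[of i] by (simp add: tps_eq_def)
  have fM: "set (f i) \<subseteq> M" for i using f[of i] by (auto simp: lists_eq_set)
  have o: "orth C D \<kappa> (length c0) N (tp C c0 N) (length (g i)) M (tp C (g i) M)" for i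
  proof -
    have "regular C D \<kappa> (length c0) M (tp C (g i) M)"
      by (rule regular_transfer[OF N reg dN d0 M(1) Ms f gf g(2)])
    then show ?thesis using all[of "tp C (g i) M" "length c0"] tp_in_S_D[of "g i" M] lg[of i] by simp
  qed
  have grk: "rk (g k) (set (f j @ f i)) = rk (g k) M" if "k = i \<or> k = j" for i j k
    using gfr[of k] by (rule rk_base_mono) (use that fM in auto)
  \<comment> \<open>\<open>(f j, f i)\<close> is exchanged for \<open>(d, f i)\<close>, whose
    entries are in \<open>N\<close>. There \<open>x\<close> realizes the original type and
    \<open>y\<close> the free extension of the type of \<open>g i\<close> over \<open>M\<close>, to
    which the orthogonality assumption applies.\<close>
  have oij: "orth_at (f j @ f i) (g j) (g i)" if ij: "i < j" for i j
  proof (rule orth_atI[OF N, of "d @ f i"])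
    show "d @ f i \<in> lists N" using dN f M(2) by (auto simp: lists_eq_set)
    show "tps_eq C {} [d @ f i] [f j @ f i]" by (rule tps_eq_append[OF tps_eq_sym[OF ff[OF ij]]])
    fix x y assume x: "tps_eq C {} [x, d @ f i] [g j, f j @ f i]" "rk x N = rk (g j) (set (f j @ f i))"
      and y: "tps_eq C {} [y, d @ f i] [g i, f j @ f i]" "rk y N = rk (g i) (set (f j @ f i))"
    have len: "length d = length (f j)" using gf[of j] by (simp add: tps_eq_def)
    have rx: "rk x N = rk c0 N" using x(2) grk g(2) by simp
    have ry: "rk y N = rk (g i) M" using y(2) grk by simp
    have "tps_eq C {} [x, d, f i] [g j, f j, f i]" using x(1) len by (simp add: tps_eq_def)
    from tps_eq_reindex[OF this, of "[0, 1]"] have "tps_eq C {} [x, d] [g j, f j]" by simp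
    then have xd: "tps_eq C {} [x, d] [c0, d]" using gf tps_eq_trans by blast
    have "set d \<union> N = N" using dN by (auto simp: lists_eq_set)
    then have xN: "tps_eq C N [x] [c0]" using free_tps_eq[OF N(1) dN d0 xd] rx by simp
    have "tps_eq C {} [y, d, f i] [g i, f j, f i]" using y(1) len by (simp add: tps_eq_def)
    from tps_eq_reindex[OF this, of "[0, 2]"] have yf: "tps_eq C {} [y, f i] [g i, f i]" by simp
    have "rk y N \<le> rk y (set (f i) \<union> M)" using M(2) fM by (intro rk_antimono) auto
    then have yM: "tps_eq C M [y] [g i]" using free_tps_eq[OF M(1) f gfr yf] ry by simp
    show "ind N x (set y)"
      using o[of i, unfolded orth_tp] N M(2) rx ry tps_eq_sym[OF xN] tps_eq_sym[OF yM] by blast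
  qed
  have ind: "ind M (g k) (set z \<union> set (g l))"
    if kl: "k \<noteq> l" "ind M (g k) (set z)" "ind M (g l) (set z)" for k l z
  proof (cases "k < l")
    case True
    show ?thesis
      by (rule orth_at_ind[OF M(1) Ms orth_at_sym[OF oij[OF True]]]) (use f kl grk in simp_all)
  next
    case False
    then have "l < k" using kl(1) by simp
    from oij[OF this] show ?thesis
      by (rule orth_at_ind[OF M(1) Ms]) (use f kl grk in simp_all)
  qed
  show False by (rule finite_weight[OF M(1) Ms g(3) ind])
qed

end

theorem mainTheorem5:
  fixes C :: "('f, 'r, 'a) struct" and D :: "('f, 'r) diag" and \<kappa> :: "'k rel"
    and M N :: "'a set" and n :: nat and p :: "('f, 'r, 'a) pfm set"
  assumes "monster C D \<kappa>" and "totally_transcendental C D"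
    and "aleph0_homogeneous C D M" and "aleph0_homogeneous C D N"
    and "small \<kappa> N" and "M \<subseteq> N"
    and "p \<in> S_D C D n N" and "regular C D \<kappa> n N p"
  shows "orth_model C D \<kappa> n N p M \<longleftrightarrow>
    (\<forall>m. \<forall>q\<in>S_D C D m M. regular C D \<kappa> m M q \<longrightarrow> orth C D \<kappa> n N p m M q)"
proof
  interpret tt_monster C D \<kappa> by unfold_locales (rule assms)+
  obtain c where c: "length c = n" "p = tp C c N" by (rule S_D_tp[OF assms(7,5)])
  assume *: "\<forall>m. \<forall>q\<in>S_D C D m M. regular C D \<kappa> m M q \<longrightarrow> orth C D \<kappa> n N p m M q"
  have "orth_model C D \<kappa> (length c) N (tp C c N) M"
    by (rule orth_model_if_orth_regular[OF assms(4,5,3,6)]) (use assms(8) * c in auto)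
  then show "orth_model C D \<kappa> n N p M" using c by simp
qed (auto simp: orth_model_def)

end
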